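(* Let $G$ be a compact Lie group (not necessarily connected), $M=G/H$ a commutative homogeneous space ($H$ a closed subgroup of $G$), $A$ an invariant function algebra on $M$, $\mathcal{M}_A$ its maximal ideal space, and $\mu$ the $G$-invariant probability measure on $M$. The following assertions are equivalent: (1) $A$ is antisymmetric; (2) $\mu$ is multiplicative on $A$; (3) there is a $G$-fixed point in $\mathcal{M}_A$. Moreover, the $G$-fixed point in (3) is unique.
   Context: A homogeneous space $M=G/H$ of a compact Lie group $G$ is called commutative if it is multiplicity free, i.e. the quasiregular representation $\tau_g f(x)=f(g^{-1}x)$ of $G$ in $C(M)$ contains every irreducible representation of $G$ with multiplicity $0$ or $1$ (equivalently, $(G,H)$ is a Gelfand pair). $C(M)$ is the Banach algebra of continuous complex-valued functions on $M$ with the sup-norm. An invariant function algebra on $M$ is a closed $G$-invariant subalgebra of $C(M)$ containing the constant functions. A function algebra is antisymmetric if every real-valued function in it is constant. The maximal ideal space $\mathcal{M}_A$ is the set of all nonzero multiplicative linear functionals $A\to\mathbb{C}$ with the weak-$*$ topology; $G$ acts on it by duality with the action $\tau$ on $A$. A probability measure $\mu$ on $M$ is multiplicative on $A$ if there is $\varphi\in\mathcal{M}_A$ with $\varphi(f)=\int f\,d\mu$ for all $f\in A$. *)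

theory Defs
  imports "HOL-Analysis.Analysis" "HOL-Algebra.Left_Coset"
begin

section \<open>Lie groups\<close>

text \<open>
  The dimension \<open>n\<close> is a number rather than a type, so that dimension 0 (finite groups, in the
  compact case) is included. The model space is the library's \<^const>\<open>Euclidean_space\<close>:
  real sequences vanishing from index \<open>n\<close> on. For open \<open>S\<close>, \<open>Ck_on n k S f\<close> says that all
  iterated partial derivatives of \<open>f\<close> up to order \<open>k\<close> exist and are continuous on \<open>S\<close>.
\<close>

primrec Ck_on :: "nat \<Rightarrow> nat \<Rightarrow> (nat \<Rightarrow> real) set \<Rightarrow> ((nat \<Rightarrow> real) \<Rightarrow> real) \<Rightarrow> bool" where
  "Ck_on n 0 S f \<longleftrightarrow> continuous_map (subtopology (Euclidean_space n) S) euclideanreal f"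
| "Ck_on n (Suc k) S f \<longleftrightarrow>
     continuous_map (subtopology (Euclidean_space n) S) euclideanreal f \<and>
     (\<exists>D. \<forall>i<n. (\<forall>x\<in>S. ((\<lambda>t. f (x(i := t))) has_real_derivative D i x) (at (x i))) \<and>
                Ck_on n k S (D i))"

definition smooth_on :: "nat \<Rightarrow> (nat \<Rightarrow> real) set \<Rightarrow> ((nat \<Rightarrow> real) \<Rightarrow> real) \<Rightarrow> bool" where
  "smooth_on n S f \<longleftrightarrow> openin (Euclidean_space n) S \<and> (\<forall>k. Ck_on n k S f)"

definition chart :: "nat \<Rightarrow> 'g topology \<Rightarrow> 'g set \<Rightarrow> ('g \<Rightarrow> nat \<Rightarrow> real) \<Rightarrow> bool" where
  "chart n T U \<phi> \<longleftrightarrow> openin T U \<and>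
     (\<exists>V. openin (Euclidean_space n) V \<and>
          homeomorphic_map (subtopology T U) (subtopology (Euclidean_space n) V) \<phi>)"

definition smooth_atlas ::
  "nat \<Rightarrow> 'g topology \<Rightarrow> ('g set \<times> ('g \<Rightarrow> nat \<Rightarrow> real)) set \<Rightarrow> bool" where
  "smooth_atlas n T \<A> \<longleftrightarrow>
     (\<forall>(U, \<phi>)\<in>\<A>. chart n T U \<phi>) \<and>
     (\<Union>(U, \<phi>)\<in>\<A>. U) = topspace T \<and>
     (\<forall>(U, \<phi>)\<in>\<A>. \<forall>(V, \<psi>)\<in>\<A>. \<forall>i<n.
        smooth_on n (\<phi> ` (U \<inter> V)) (\<lambda>x. \<psi> (inv_into U \<phi> x) i))"

definition smooth_manifold ::
  "nat \<Rightarrow> 'g topology \<Rightarrow> ('g set \<times> ('g \<Rightarrow> nat \<Rightarrow> real)) set \<Rightarrow> bool" where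
  "smooth_manifold n T \<A> \<longleftrightarrow>
     Hausdorff_space T \<and> second_countable T \<and> smooth_atlas n T \<A>"

definition topological_group :: "('g, 'b) monoid_scheme \<Rightarrow> 'g topology \<Rightarrow> bool" where
  "topological_group G T \<longleftrightarrow> group G \<and> topspace T = carrier G \<and>
     continuous_map (prod_topology T T) T (\<lambda>(x, y). x \<otimes>\<^bsub>G\<^esub> y) \<and>
     continuous_map T T (\<lambda>x. inv\<^bsub>G\<^esub> x)"

text \<open>
  A point of the product of two \<open>n\<close>-dimensional coordinate spaces is coded as a point \<open>w\<close> of
  the \<open>2n\<close>-dimensional one, with halves \<open>fst_half n w\<close> and \<open>snd_half n w\<close>.
\<close>

definition fst_half :: "nat \<Rightarrow> (nat \<Rightarrow> real) \<Rightarrow> nat \<Rightarrow> real" where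
  "fst_half n w = (\<lambda>i. if i < n then w i else 0)"

definition snd_half :: "nat \<Rightarrow> (nat \<Rightarrow> real) \<Rightarrow> nat \<Rightarrow> real" where
  "snd_half n w = (\<lambda>i. if i < n then w (n + i) else 0)"

definition smooth_mult ::
  "('g, 'b) monoid_scheme \<Rightarrow> nat \<Rightarrow> ('g set \<times> ('g \<Rightarrow> nat \<Rightarrow> real)) set \<Rightarrow> bool" where
  "smooth_mult G n \<A> \<longleftrightarrow>
     (\<forall>(U, \<phi>)\<in>\<A>. \<forall>(V, \<psi>)\<in>\<A>. \<forall>(W, \<theta>)\<in>\<A>. \<forall>i<n.
        let m = (\<lambda>w. inv_into U \<phi> (fst_half n w) \<otimes>\<^bsub>G\<^esub> inv_into V \<psi> (snd_half n w))
        in smooth_on (2 * n)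
             {w \<in> topspace (Euclidean_space (2 * n)).
                fst_half n w \<in> \<phi> ` U \<and> snd_half n w \<in> \<psi> ` V \<and> m w \<in> W}
             (\<lambda>w. \<theta> (m w) i))"

definition smooth_inv ::
  "('g, 'b) monoid_scheme \<Rightarrow> nat \<Rightarrow> ('g set \<times> ('g \<Rightarrow> nat \<Rightarrow> real)) set \<Rightarrow> bool" where
  "smooth_inv G n \<A> \<longleftrightarrow>
     (\<forall>(U, \<phi>)\<in>\<A>. \<forall>(V, \<psi>)\<in>\<A>. \<forall>i<n.
        smooth_on n (\<phi> ` {g \<in> U. inv\<^bsub>G\<^esub> g \<in> V}) (\<lambda>x. \<psi> (inv\<^bsub>G\<^esub> (inv_into U \<phi> x)) i))"

definition lie_group ::
  "('g, 'b) monoid_scheme \<Rightarrow> 'g topology \<Rightarrow> nat \<Rightarrow> ('g set \<times> ('g \<Rightarrow> nat \<Rightarrow> real)) set \<Rightarrow> bool"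
  where
  "lie_group G T n \<A> \<longleftrightarrow>
     topological_group G T \<and> smooth_manifold n T \<A> \<and> smooth_mult G n \<A> \<and> smooth_inv G n \<A>"


section \<open>Homogeneous spaces\<close>

definition homogeneous_space ::
  "('g, 'b) monoid_scheme \<Rightarrow> 'g topology \<Rightarrow> 'g set \<Rightarrow> 'g set topology" where
  "homogeneous_space G T H =
     topology (\<lambda>U. U \<subseteq> lcosets\<^bsub>G\<^esub> H \<and> openin T {g \<in> topspace T. g <#\<^bsub>G\<^esub> H \<in> U})"

lemma openin_homogeneous_space:
  "openin (homogeneous_space G T H) U \<longleftrightarrow>
     U \<subseteq> lcosets\<^bsub>G\<^esub> H \<and> openin T {g \<in> topspace T. g <#\<^bsub>G\<^esub> H \<in> U}"
proof -
  have "istopology (\<lambda>U. U \<subseteq> lcosets\<^bsub>G\<^esub> H \<and> openin T {g \<in> topspace T. g <#\<^bsub>G\<^esub> H \<in> U})"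
    unfolding istopology_def
  proof (rule conjI; intro allI impI; (elim conjE)?)
    fix S R
    assume *: "S \<subseteq> lcosets\<^bsub>G\<^esub> H" "openin T {g \<in> topspace T. g <#\<^bsub>G\<^esub> H \<in> S}"
              "openin T {g \<in> topspace T. g <#\<^bsub>G\<^esub> H \<in> R}"
    have "{g \<in> topspace T. g <#\<^bsub>G\<^esub> H \<in> S \<inter> R} =
          {g \<in> topspace T. g <#\<^bsub>G\<^esub> H \<in> S} \<inter> {g \<in> topspace T. g <#\<^bsub>G\<^esub> H \<in> R}"
      by blast
    then show "S \<inter> R \<subseteq> lcosets\<^bsub>G\<^esub> H \<and> openin T {g \<in> topspace T. g <#\<^bsub>G\<^esub> H \<in> S \<inter> R}"
      using * by (auto simp: openin_Int)
  next
    fix \<K>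
    assume *: "\<forall>K\<in>\<K>. K \<subseteq> lcosets\<^bsub>G\<^esub> H \<and> openin T {g \<in> topspace T. g <#\<^bsub>G\<^esub> H \<in> K}"
    have "{g \<in> topspace T. g <#\<^bsub>G\<^esub> H \<in> \<Union>\<K>} =
          (\<Union>K\<in>\<K>. {g \<in> topspace T. g <#\<^bsub>G\<^esub> H \<in> K})"
      by blast
    moreover have "openin T (\<Union>K\<in>\<K>. {g \<in> topspace T. g <#\<^bsub>G\<^esub> H \<in> K})"
      using * by (intro openin_Union) auto
    ultimately show
      "\<Union>\<K> \<subseteq> lcosets\<^bsub>G\<^esub> H \<and> openin T {g \<in> topspace T. g <#\<^bsub>G\<^esub> H \<in> \<Union>\<K>}"
      using * by auto
  qed
  then show ?thesis
    by (simp add: homogeneous_space_def topology_inverse')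
qed

lemma topspace_homogeneous_space:
  assumes "topspace T = carrier G"
  shows "topspace (homogeneous_space G T H) = lcosets\<^bsub>G\<^esub> H"
proof -
  have "{g \<in> topspace T. g <#\<^bsub>G\<^esub> H \<in> lcosets\<^bsub>G\<^esub> H} = topspace T"
    using assms by (auto simp: LCOSETS_def)
  then have "openin (homogeneous_space G T H) (lcosets\<^bsub>G\<^esub> H)"
    by (simp add: openin_homogeneous_space)
  then show ?thesis
    by (meson openin_homogeneous_space openin_subset openin_topspace subset_antisym)
qed

lemma quotient_map_homogeneous_space:
  assumes "topspace T = carrier G"
  shows "quotient_map T (homogeneous_space G T H) (\<lambda>g. g <#\<^bsub>G\<^esub> H)"
  unfolding quotient_map_def topspace_homogeneous_space [OF assms] openin_homogeneous_space
  using assms by (auto simp: LCOSETS_def)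


section \<open>The space \<open>C(M)\<close>\<close>

text \<open>
  \<open>C(M)\<close> is the library's metric space of bounded continuous functions (boundedness is
  automatic for compact \<open>M\<close>) with the sup-distance. Its elements are extensional, i.e.
  undefined off \<open>M\<close>, so the pointwise operations below restrict their results to \<open>M\<close>.
\<close>

abbreviation CM :: "'m topology \<Rightarrow> ('m \<Rightarrow> complex) metric" where
  "CM M \<equiv> cfunspace M euclidean_metric"

definition cf_const :: "'m topology \<Rightarrow> complex \<Rightarrow> 'm \<Rightarrow> complex" where
  "cf_const M c = (\<lambda>x\<in>topspace M. c)"

definition cf_add :: "'m topology \<Rightarrow> ('m \<Rightarrow> complex) \<Rightarrow> ('m \<Rightarrow> complex) \<Rightarrow> 'm \<Rightarrow> complex" where
  "cf_add M f g = (\<lambda>x\<in>topspace M. f x + g x)"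

definition cf_scale :: "'m topology \<Rightarrow> complex \<Rightarrow> ('m \<Rightarrow> complex) \<Rightarrow> 'm \<Rightarrow> complex" where
  "cf_scale M c f = (\<lambda>x\<in>topspace M. c * f x)"

definition cf_mult :: "'m topology \<Rightarrow> ('m \<Rightarrow> complex) \<Rightarrow> ('m \<Rightarrow> complex) \<Rightarrow> 'm \<Rightarrow> complex" where
  "cf_mult M f g = (\<lambda>x\<in>topspace M. f x * g x)"

definition linear_subspace :: "'m topology \<Rightarrow> ('m \<Rightarrow> complex) set \<Rightarrow> bool" where
  "linear_subspace M E \<longleftrightarrow> E \<subseteq> mspace (CM M) \<and> cf_const M 0 \<in> E \<and>
     (\<forall>f\<in>E. \<forall>g\<in>E. cf_add M f g \<in> E) \<and> (\<forall>c. \<forall>f\<in>E. cf_scale M c f \<in> E)"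

text \<open>
  The set \<open>g <# x\<close> is the translate \<open>g x\<close> of a coset \<open>x\<close>, so this is
  \<open>(\<tau>\<^sub>g f)(x) = f(g\<inverse> x)\<close>.
\<close>

definition quasiregular ::
  "('g, 'b) monoid_scheme \<Rightarrow> 'g set topology \<Rightarrow> 'g \<Rightarrow> ('g set \<Rightarrow> complex) \<Rightarrow> 'g set \<Rightarrow> complex"
  where
  "quasiregular G M g f = (\<lambda>x\<in>topspace M. f (inv\<^bsub>G\<^esub> g <#\<^bsub>G\<^esub> x))"

definition invariant ::
  "('g, 'b) monoid_scheme \<Rightarrow> 'g set topology \<Rightarrow> ('g set \<Rightarrow> complex) set \<Rightarrow> bool" where
  "invariant G M E \<longleftrightarrow> (\<forall>g\<in>carrier G. \<forall>f\<in>E. quasiregular G M g f \<in> E)"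


section \<open>Multiplicity-free homogeneous spaces\<close>

definition subrepresentation ::
  "('g, 'b) monoid_scheme \<Rightarrow> 'g set topology \<Rightarrow> ('g set \<Rightarrow> complex) set \<Rightarrow> bool" where
  "subrepresentation G M E \<longleftrightarrow>
     linear_subspace M E \<and> closedin (mtopology_of (CM M)) E \<and> invariant G M E"

definition irreducible_subrepresentation ::
  "('g, 'b) monoid_scheme \<Rightarrow> 'g set topology \<Rightarrow> ('g set \<Rightarrow> complex) set \<Rightarrow> bool" where
  "irreducible_subrepresentation G M E \<longleftrightarrow>
     subrepresentation G M E \<and> E \<noteq> {cf_const M 0} \<and>
     (\<forall>F. subrepresentation G M F \<and> F \<subseteq> E \<longrightarrow> F = {cf_const M 0} \<or> F = E)"

definition equivalent_representations ::
  "('g, 'b) monoid_scheme \<Rightarrow> 'g set topology \<Rightarrow>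
     ('g set \<Rightarrow> complex) set \<Rightarrow> ('g set \<Rightarrow> complex) set \<Rightarrow> bool" where
  "equivalent_representations G M E F \<longleftrightarrow>
     (\<exists>L. homeomorphic_map (subtopology (mtopology_of (CM M)) E)
                           (subtopology (mtopology_of (CM M)) F) L \<and>
          (\<forall>f\<in>E. \<forall>g\<in>E. L (cf_add M f g) = cf_add M (L f) (L g)) \<and>
          (\<forall>c. \<forall>f\<in>E. L (cf_scale M c f) = cf_scale M c (L f)) \<and>
          (\<forall>g\<in>carrier G. \<forall>f\<in>E. L (quasiregular G M g f) = quasiregular G M g (L f)))"

definition independent_subspaces ::
  "'m topology \<Rightarrow> nat \<Rightarrow> (nat \<Rightarrow> ('m \<Rightarrow> complex) set) \<Rightarrow> bool" where
  "independent_subspaces M k F \<longleftrightarrow>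
     (\<forall>v. (\<forall>i<k. v i \<in> F i) \<and> (\<forall>x\<in>topspace M. (\<Sum>i<k. v i x) = 0) \<longrightarrow>
          (\<forall>i<k. v i = cf_const M 0))"

text \<open>The largest number of independent copies of \<open>E\<close> in \<open>C(M)\<close>.\<close>

definition multiplicity_in_CM ::
  "('g, 'b) monoid_scheme \<Rightarrow> 'g set topology \<Rightarrow> ('g set \<Rightarrow> complex) set \<Rightarrow> enat" where
  "multiplicity_in_CM G M E =
     Sup {enat k | k. \<exists>F. (\<forall>i<k. subrepresentation G M (F i) \<and>
                                   equivalent_representations G M E (F i)) \<and>
                          independent_subspaces M k F}"

text \<open>
  It suffices to let \<open>E\<close> range over the irreducible representations occurring in \<open>C(M)\<close>;
  all others have multiplicity 0.
\<close>

definition commutative_space :: "('g, 'b) monoid_scheme \<Rightarrow> 'g set topology \<Rightarrow> bool" where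
  "commutative_space G M \<longleftrightarrow>
     (\<forall>E. irreducible_subrepresentation G M E \<longrightarrow> multiplicity_in_CM G M E \<le> 1)"


section \<open>Invariant function algebras\<close>

definition invariant_function_algebra ::
  "('g, 'b) monoid_scheme \<Rightarrow> 'g set topology \<Rightarrow> ('g set \<Rightarrow> complex) set \<Rightarrow> bool" where
  "invariant_function_algebra G M A \<longleftrightarrow>
     linear_subspace M A \<and> (\<forall>f\<in>A. \<forall>g\<in>A. cf_mult M f g \<in> A) \<and> (\<forall>c. cf_const M c \<in> A) \<and>
     closedin (mtopology_of (CM M)) A \<and> invariant G M A"

definition antisymmetric :: "'m topology \<Rightarrow> ('m \<Rightarrow> complex) set \<Rightarrow> bool" where
  "antisymmetric M A \<longleftrightarrow>
     (\<forall>f\<in>A. (\<forall>x\<in>topspace M. f x \<in> \<real>) \<longrightarrow> (\<exists>c. f = cf_const M c))"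

definition character ::
  "'m topology \<Rightarrow> ('m \<Rightarrow> complex) set \<Rightarrow> (('m \<Rightarrow> complex) \<Rightarrow> complex) \<Rightarrow> bool" where
  "character M A \<phi> \<longleftrightarrow>
     (\<forall>f\<in>A. \<forall>g\<in>A. \<phi> (cf_add M f g) = \<phi> f + \<phi> g) \<and>
     (\<forall>c. \<forall>f\<in>A. \<phi> (cf_scale M c f) = c * \<phi> f) \<and>
     (\<forall>f\<in>A. \<forall>g\<in>A. \<phi> (cf_mult M f g) = \<phi> f * \<phi> g) \<and>
     (\<exists>f\<in>A. \<phi> f \<noteq> 0)"

text \<open>
  The product topology is that of pointwise convergence on \<open>A\<close>, i.e. the weak-* topology. Its
  points are extensional, so that functionals on \<open>A\<close> are equal as soon as they agree on \<open>A\<close>.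
\<close>

definition maximal_ideal_space ::
  "'m topology \<Rightarrow> ('m \<Rightarrow> complex) set \<Rightarrow> (('m \<Rightarrow> complex) \<Rightarrow> complex) topology" where
  "maximal_ideal_space M A =
     subtopology (product_topology (\<lambda>_. euclidean) A) {\<phi>. character M A \<phi>}"

definition dual_action ::
  "('g, 'b) monoid_scheme \<Rightarrow> 'g set topology \<Rightarrow> ('g set \<Rightarrow> complex) set \<Rightarrow> 'g \<Rightarrow>
     (('g set \<Rightarrow> complex) \<Rightarrow> complex) \<Rightarrow> ('g set \<Rightarrow> complex) \<Rightarrow> complex" where
  "dual_action G M A g \<phi> = (\<lambda>f\<in>A. \<phi> (quasiregular G M (inv\<^bsub>G\<^esub> g) f))"

definition fixed_points ::
  "('g, 'b) monoid_scheme \<Rightarrow> 'g set topology \<Rightarrow> ('g set \<Rightarrow> complex) set \<Rightarrow>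
     (('g set \<Rightarrow> complex) \<Rightarrow> complex) set" where
  "fixed_points G M A =
     {\<phi> \<in> topspace (maximal_ideal_space M A). \<forall>g\<in>carrier G. dual_action G M A g \<phi> = \<phi>}"

definition invariant_probability ::
  "('g, 'b) monoid_scheme \<Rightarrow> 'g set topology \<Rightarrow> 'g set measure \<Rightarrow> bool" where
  "invariant_probability G M \<mu> \<longleftrightarrow>
     space \<mu> = topspace M \<and> sets \<mu> = sigma_sets (topspace M) {U. openin M U} \<and>
     emeasure \<mu> (space \<mu>) = 1 \<and>
     (\<forall>g\<in>carrier G. \<forall>B\<in>sets \<mu>. emeasure \<mu> ((\<lambda>x. g <#\<^bsub>G\<^esub> x) ` B) = emeasure \<mu> B)"

definition multiplicative_measure ::
  "'m topology \<Rightarrow> ('m \<Rightarrow> complex) set \<Rightarrow> 'm measure \<Rightarrow> bool" where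
  "multiplicative_measure M A \<mu> \<longleftrightarrow>
     (\<exists>\<phi>\<in>topspace (maximal_ideal_space M A). \<forall>f\<in>A. \<phi> f = (\<integral>x. f x \<partial>\<mu>))"

end

theory Submission
  imports Defs "HOL-Probability.Probability_Measure" "HOL-Library.Diagonal_Subsequence"
begin

text \<open>
  Write \<open>mean f\<close> for the integral of \<open>f\<close> against the invariant probability \<open>\<mu>\<close>.

  \<^emph>\<open>Fixed points are the mean.\<close> A character of \<open>A\<close> has norm at most 1
  (lemma \<open>multiplicative_functional_bounded\<close>). If it is fixed by \<open>G\<close>, it is therefore
  constant on the closed convex hull of the orbit of each \<open>f\<close>. By transitivity an invariant
  element of this hull is a constant function, and that constant must be \<open>mean f\<close>. So the
  only possible fixed point is the mean (\<open>fixed_point_eq_mean\<close>), which gives uniqueness and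
  the equivalence of (2) and (3). If the mean is multiplicative and \<open>f\<close> is real, then
  \<open>f - mean f\<close> has \<open>L\<^sup>2\<close> norm 0, hence vanishes, because \<open>\<mu>\<close> has full
  support; this is (2) implies (1).

  \<^emph>\<open>Antisymmetry makes the mean multiplicative.\<close> Let \<open>E\<close> be the space of the
  functions in \<open>A\<close> with mean 0 and \<open>F\<close> the space of their complex conjugates. The mean
  is multiplicative on \<open>A\<close> exactly when \<open>E\<close> and \<open>F\<close> are orthogonal in
  \<open>L\<^sup>2\<close>, and antisymmetry says that they meet only in 0. Suppose that \<open>f\<close> in
  \<open>E\<close> and \<open>h\<close> in \<open>F\<close> are not orthogonal. Averaging over \<open>G\<close> the rank one
  operators given by the translates of \<open>f\<close> and of \<open>h\<close> yields two operators \<open>R\<close>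
  and \<open>Q\<close> that commute with \<open>G\<close>, are compact and positive, and have their ranges in
  \<open>E\<close> and \<open>F\<close>. Then \<open>R Q R\<close> is compact, positive and nonzero, so it has an
  eigenvalue \<open>\<rho> > 0\<close>; its eigenspace is finite-dimensional and contained in \<open>E\<close>.
  Let \<open>V\<close> be an irreducible subspace of it. On \<open>V\<close> the operator \<open>Q R\<close> has the
  left inverse \<open>R / \<rho>\<close>, so \<open>V\<close> is equivalent to its image, which lies in \<open>F\<close>
  (\<open>equivalent_irreducible_subspaces\<close>). As \<open>E\<close> and \<open>F\<close> are independent, the
  representation \<open>V\<close> occurs at least twice in \<open>C(M)\<close>, contrary to commutativity
  (\<open>commutative_orthogonality\<close>).

  \<^emph>\<open>Averaging.\<close> The averages are obtained from \<open>\<mu>\<close> alone, without integrating over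
  \<open>G\<close>. In the convex hull of the kernels \<open>f (g x) * cnj (b (g y))\<close>, with \<open>g\<close> in
  \<open>G\<close>, take a sequence that minimises the Hilbert-Schmidt norm. By the parallelogram law it
  is Cauchy in the \<open>L\<^sup>2\<close> sense; the hull is equicontinuous and \<open>\<mu>\<close> charges
  the translates of an open set uniformly, so the sequence is even uniformly Cauchy. Its limit is
  the unique minimiser and hence invariant (\<open>invariant_kernel_in_closed_hull\<close>). For
  \<open>b = 1\<close> this is the constant in the hull of an orbit, for \<open>b = f\<close> the kernel of
  \<open>R\<close>. All properties of \<open>R\<close> are checked on the hull, by induction on the number of
  midpoints taken, and passed on to the limit.
\<close>

section \<open>Compact groups and transitive actions\<close>

locale compact_group =
  fixes G :: "('g, 'b) monoid_scheme" (structure) and T :: "'g topology"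
  assumes topological: "topological_group G T"
    and compact_T: "compact_space T"
begin

sublocale group G
  using topological by (simp add: topological_group_def)

lemma topspace_T: "topspace T = carrier G"
  using topological by (simp add: topological_group_def)

lemma mult_continuous: "continuous_map (prod_topology T T) T (\<lambda>(x, y). x \<otimes> y)"
  using topological by (simp add: topological_group_def)

lemma left_mult_continuous:
  assumes "g \<in> carrier G" shows "continuous_map T T (\<lambda>a. g \<otimes> a)"
proof -
  have "continuous_map T (prod_topology T T) (\<lambda>a. (g, a))"
    using assms topspace_T by (simp add: continuous_map_pairedI)
  from continuous_map_compose[OF this mult_continuous] show ?thesis by (simp add: o_def)
qed

lemma right_mult_continuous:
  assumes "g \<in> carrier G" shows "continuous_map T T (\<lambda>a. a \<otimes> g)"
proof -
  have "continuous_map T (prod_topology T T) (\<lambda>a. (a, g))"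
    using assms topspace_T by (simp add: continuous_map_pairedI)
  from continuous_map_compose[OF this mult_continuous] show ?thesis by (simp add: o_def)
qed

lemma openin_right_translate:
  assumes "openin T U" "a \<in> carrier G"
  shows "openin T ((\<lambda>g. g \<otimes> a) ` U)"
proof -
  have U: "U \<subseteq> carrier G" using assms openin_subset topspace_T by blast
  have "(\<lambda>g. g \<otimes> a) ` U = {g \<in> topspace T. g \<otimes> inv a \<in> U}"
  proof (intro equalityI subsetI)
    fix g assume "g \<in> {g \<in> topspace T. g \<otimes> inv a \<in> U}"
    then have "g \<in> carrier G" "g \<otimes> inv a \<in> U" by (auto simp: topspace_T)
    then have "g = (g \<otimes> inv a) \<otimes> a" using assms(2) by (simp add: m_assoc)
    then show "g \<in> (\<lambda>g. g \<otimes> a) ` U" using \<open>g \<otimes> inv a \<in> U\<close> by blast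
  qed (use U assms(2) in \<open>auto simp: topspace_T m_assoc subset_iff\<close>)
  then show ?thesis
    using openin_continuous_map_preimage[OF right_mult_continuous assms(1)] assms(2) by simp
qed

lemma openin_left_translate:
  assumes "openin T U" "a \<in> carrier G"
  shows "openin T ((\<lambda>g. a \<otimes> g) ` U)"
proof -
  have U: "U \<subseteq> carrier G" using assms openin_subset topspace_T by blast
  have "(\<lambda>g. a \<otimes> g) ` U = {g \<in> topspace T. inv a \<otimes> g \<in> U}"
  proof (intro equalityI subsetI)
    fix g assume "g \<in> {g \<in> topspace T. inv a \<otimes> g \<in> U}"
    then have "g \<in> carrier G" "inv a \<otimes> g \<in> U" by (auto simp: topspace_T)
    then have "g = a \<otimes> (inv a \<otimes> g)" using assms(2) by (simp add: m_assoc[symmetric])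
    then show "g \<in> (\<lambda>g. a \<otimes> g) ` U" using \<open>inv a \<otimes> g \<in> U\<close> by blast
  qed (use U assms(2) in \<open>auto simp: topspace_T m_assoc[symmetric] subset_iff\<close>)
  then show ?thesis
    using openin_continuous_map_preimage[OF left_mult_continuous assms(1)] assms(2) by simp
qed

text \<open>
  The form in which compactness of the group enters the uniform estimates.
\<close>

lemma finite_translates_cover:
  assumes "\<And>k. k \<in> carrier G \<Longrightarrow> openin T (W k) \<and> k \<in> W k"
  obtains D where "finite D" "D \<subseteq> carrier G" "carrier G \<subseteq> (\<Union>k\<in>D. W k)"
proof -
  have "compactin T (carrier G)" using compact_T topspace_T compact_space_def by metis
  then obtain \<F> where "finite \<F>" "\<F> \<subseteq> W ` carrier G" "carrier G \<subseteq> \<Union>\<F>"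
    using compactinD[of T "carrier G" "W ` carrier G"] assms by blast
  then show thesis using that finite_subset_image by (metis (no_types, lifting))
qed

end

text \<open>
  A transitive action on a space that carries the quotient topology of each orbit map, so that
  continuity on \<open>M\<close> can be tested on the group.
\<close>

locale compact_homogeneous_space = compact_group G T
  for G :: "('g, 'b) monoid_scheme" (structure) and T :: "'g topology" +
  fixes M :: "'x topology"
    and act :: "'g \<Rightarrow> 'x \<Rightarrow> 'x" (infixr \<open>\<star>\<close> 75)
    and \<mu> :: "'x measure"
  assumes act_closed: "\<lbrakk>g \<in> carrier G; x \<in> topspace M\<rbrakk> \<Longrightarrow> g \<star> x \<in> topspace M"
    and act_one: "x \<in> topspace M \<Longrightarrow> \<one> \<star> x = x"
    and act_mult: "\<lbrakk>g \<in> carrier G; h \<in> carrier G; x \<in> topspace M\<rbrakk> \<Longrightarrow> (g \<otimes> h) \<star> x = g \<star> (h \<star> x)"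
    and transitive: "\<lbrakk>x \<in> topspace M; y \<in> topspace M\<rbrakk> \<Longrightarrow> \<exists>g\<in>carrier G. g \<star> x = y"
    and orbit_continuous: "x \<in> topspace M \<Longrightarrow> continuous_map T M (\<lambda>g. g \<star> x)"
    and orbit_open: "x \<in> topspace M \<Longrightarrow> open_map T M (\<lambda>g. g \<star> x)"
    and space_\<mu>: "space \<mu> = topspace M"
    and sets_\<mu>: "sets \<mu> = sigma_sets (topspace M) {U. openin M U}"
    and emeasure_space_\<mu>: "emeasure \<mu> (space \<mu>) = 1"
    and emeasure_act: "\<lbrakk>g \<in> carrier G; B \<in> sets \<mu>\<rbrakk> \<Longrightarrow> emeasure \<mu> ((\<star>) g ` B) = emeasure \<mu> B"
begin

abbreviation X :: "'x set" where
  "X \<equiv> topspace M"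

sublocale prob_space \<mu>
  by standard (rule emeasure_space_\<mu>)

lemma topspace_M_nonempty: "X \<noteq> {}"
  using not_empty space_\<mu> by simp

lemma act_inv_cancel [simp]:
  assumes "g \<in> carrier G" "x \<in> X"
  shows "inv g \<star> g \<star> x = x" "g \<star> inv g \<star> x = x"
  using assms by (metis act_mult act_one inv_closed l_inv r_inv)+

lemma openin_sets: "openin M U \<Longrightarrow> U \<in> sets \<mu>"
  by (simp add: sets_\<mu> sigma_sets.Basic)

lemma orbit_image: "x \<in> X \<Longrightarrow> (\<lambda>g. g \<star> x) ` carrier G = X"
  using act_closed transitive by (auto simp: image_iff) metis

lemma orbit_quotient:
  assumes "x \<in> X"
  shows "quotient_map T M (\<lambda>g. g \<star> x)"
  using assms continuous_open_imp_quotient_map orbit_continuous orbit_open orbit_image topspace_T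
  by metis

lemma act_continuous:
  assumes "g \<in> carrier G" shows "continuous_map M M ((\<star>) g)"
proof -
  obtain x0 where x0: "x0 \<in> X" using topspace_M_nonempty by blast
  have "continuous_map T M ((\<lambda>a. a \<star> x0) \<circ> (\<lambda>a. g \<otimes> a))"
    by (rule continuous_map_compose[OF left_mult_continuous[OF assms] orbit_continuous[OF x0]])
  then have "continuous_map T M ((\<star>) g \<circ> (\<lambda>a. a \<star> x0))"
    by (rule continuous_map_eq) (use assms x0 in \<open>auto simp: act_mult topspace_T\<close>)
  then show ?thesis
    using continuous_compose_quotient_map orbit_quotient[OF x0] by blast
qed

lemma compact_M: "compact_space M"
  by (metis compact_T compact_space_def image_compactin orbit_continuous orbit_image topspace_T
      topspace_M_nonempty ex_in_conv)

section \<open>Continuous functions and the invariant mean\<close>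

abbreviation cts :: "('x \<Rightarrow> complex) \<Rightarrow> bool" where
  "cts u \<equiv> continuous_map M euclidean u"

lemma cts_via:
  assumes "continuous_on UNIV F" "cts u" "cts v"
  shows "cts (\<lambda>x. F (u x, v x))"
proof -
  have "continuous_map M (prod_topology euclidean euclidean) (\<lambda>x. (u x, v x))"
    by (intro continuous_map_pairedI assms)
  then have pair: "continuous_map M euclidean (\<lambda>x. (u x, v x))"
    by simp
  have "continuous_map euclidean euclidean F" using assms(1) by simp
  from continuous_map_compose[OF pair this] show ?thesis by (simp add: o_def)
qed

lemma cts_mult [intro]: "cts u \<Longrightarrow> cts v \<Longrightarrow> cts (\<lambda>x. u x * v x)"
  using cts_via[of "\<lambda>p. fst p * snd p" u v] by (simp add: continuous_intros)

lemma cts_add [intro]: "cts u \<Longrightarrow> cts v \<Longrightarrow> cts (\<lambda>x. u x + v x)"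
  by (rule continuous_map_add)

lemma cts_diff [intro]: "cts u \<Longrightarrow> cts v \<Longrightarrow> cts (\<lambda>x. u x - v x)"
  by (rule continuous_map_diff)

lemma cts_cnj [intro]: "cts u \<Longrightarrow> cts (\<lambda>x. cnj (u x))"
  using cts_via[of "\<lambda>p. cnj (fst p)" u u] by (simp add: continuous_intros)

lemma cts_const [intro]: "cts (\<lambda>x. c)"
  by simp

lemma cts_act [intro]: "g \<in> carrier G \<Longrightarrow> cts u \<Longrightarrow> cts (\<lambda>x. u (g \<star> x))"
  using continuous_map_compose[OF act_continuous, of g euclidean u] by (simp add: o_def)

lemma cts_sum [intro]: "(\<And>i. i \<in> I \<Longrightarrow> cts (u i)) \<Longrightarrow> finite I \<Longrightarrow> cts (\<lambda>x. \<Sum>i\<in>I. u i x)"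
  by (intro continuous_map_sum) auto

lemma cts_bounded:
  assumes "cts u" obtains B where "B > 0" "\<And>x. x \<in> X \<Longrightarrow> cmod (u x) \<le> B"
proof -
  have "compact (u ` X)"
    using image_compactin[of M "X" euclidean u] compact_M assms
    by (simp add: compact_space_def)
  then obtain B where "\<forall>z\<in>u ` X. cmod z \<le> B"
    using compact_imp_bounded bounded_iff by metis
  then show thesis using that[of "max B 1"] by (fastforce simp: le_max_iff_disj)
qed

lemma cts_measurable:
  assumes "cts u" shows "u \<in> borel_measurable \<mu>"
proof (rule borel_measurableI)
  fix S :: "complex set" assume "open S"
  then have "openin M {x \<in> X. u x \<in> S}"
    using openin_continuous_map_preimage[OF assms] by simp
  moreover have "u -` S \<inter> space \<mu> = {x \<in> X. u x \<in> S}" using space_\<mu> by auto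
  ultimately show "u -` S \<inter> space \<mu> \<in> sets \<mu>" by (simp add: openin_sets)
qed

lemma cts_integrable [intro]:
  assumes "cts u" shows "integrable \<mu> u"
proof -
  obtain B where "\<And>x. x \<in> X \<Longrightarrow> cmod (u x) \<le> B" using cts_bounded[OF assms] by metis
  then show ?thesis
    by (intro integrable_const_bound[of _ B] cts_measurable[OF assms] AE_I2) (auto simp: space_\<mu>)
qed

lemma act_measurable:
  assumes "g \<in> carrier G" shows "(\<star>) g \<in> measurable \<mu> \<mu>"
proof (rule measurable_sigma_sets[OF sets_\<mu>])
  show "{U. openin M U} \<subseteq> Pow (X)" using openin_subset by blast
  show "(\<star>) g \<in> space \<mu> \<rightarrow> X" using assms act_closed by (auto simp: space_\<mu>)
  fix U assume "U \<in> {U. openin M U}"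
  then have "openin M {x \<in> X. g \<star> x \<in> U}"
    using openin_continuous_map_preimage[OF act_continuous[OF assms]] by blast
  moreover have "(\<star>) g -` U \<inter> space \<mu> = {x \<in> X. g \<star> x \<in> U}" using space_\<mu> by auto
  ultimately show "(\<star>) g -` U \<inter> space \<mu> \<in> sets \<mu>" by (simp add: openin_sets)
qed

lemma distr_act:
  assumes g: "g \<in> carrier G" shows "distr \<mu> \<mu> ((\<star>) g) = \<mu>"
proof (rule measure_eqI)
  fix B assume "B \<in> sets (distr \<mu> \<mu> ((\<star>) g))"
  then have B: "B \<in> sets \<mu>" by simp
  then have BM: "B \<subseteq> X" using sets.sets_into_space space_\<mu> by blast
  have "(\<star>) g -` B \<inter> space \<mu> = (\<star>) (inv g) ` B"
  proof (intro equalityI subsetI)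
    fix x assume "x \<in> (\<star>) g -` B \<inter> space \<mu>"
    then have "x = inv g \<star> (g \<star> x)" "g \<star> x \<in> B" using g by (auto simp: space_\<mu>)
    then show "x \<in> (\<star>) (inv g) ` B" by blast
  next
    fix x assume "x \<in> (\<star>) (inv g) ` B"
    then obtain y where "y \<in> B" "x = inv g \<star> y" by blast
    then show "x \<in> (\<star>) g -` B \<inter> space \<mu>" using BM g by (auto simp: space_\<mu> act_closed subset_iff)
  qed
  then show "emeasure (distr \<mu> \<mu> ((\<star>) g)) B = emeasure \<mu> B"
    using g B emeasure_act[of "inv g" B] by (simp add: emeasure_distr act_measurable)
qed simp

definition mean :: "('x \<Rightarrow> complex) \<Rightarrow> complex" where
  "mean u = (\<integral>x. u x \<partial>\<mu>)"

lemma mean_act: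
  assumes "g \<in> carrier G" "cts u" shows "mean (\<lambda>x. u (g \<star> x)) = mean u"
proof -
  have "mean u = (\<integral>x. u x \<partial>(distr \<mu> \<mu> ((\<star>) g)))" by (simp add: mean_def distr_act assms)
  also have "\<dots> = mean (\<lambda>x. u (g \<star> x))"
    unfolding mean_def by (intro integral_distr act_measurable cts_measurable assms)
  finally show ?thesis by simp
qed

lemma mean_cong: "(\<And>x. x \<in> X \<Longrightarrow> u x = v x) \<Longrightarrow> mean u = mean v"
  unfolding mean_def by (rule Bochner_Integration.integral_cong) (auto simp: space_\<mu>)

lemma mean_add: "cts u \<Longrightarrow> cts v \<Longrightarrow> mean (\<lambda>x. u x + v x) = mean u + mean v"
  unfolding mean_def by (simp add: cts_integrable)

lemma mean_diff: "cts u \<Longrightarrow> cts v \<Longrightarrow> mean (\<lambda>x. u x - v x) = mean u - mean v"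
  unfolding mean_def by (simp add: cts_integrable)

lemma mean_cmult: "mean (\<lambda>x. c * u x) = c * mean u"
  unfolding mean_def by simp

lemma mean_multc: "mean (\<lambda>x. u x * c) = mean u * c"
  unfolding mean_def by simp

lemma mean_cnj: "mean (\<lambda>x. cnj (u x)) = cnj (mean u)"
  unfolding mean_def by simp

lemma mean_const: "mean (\<lambda>x. c) = c"
  unfolding mean_def using prob_space by simp

lemma mean_sum: "(\<And>i. i \<in> I \<Longrightarrow> cts (u i)) \<Longrightarrow> mean (\<lambda>x. \<Sum>i\<in>I. u i x) = (\<Sum>i\<in>I. mean (u i))"
  unfolding mean_def by (intro Bochner_Integration.integral_sum) auto

lemma mean_bound:
  assumes "\<And>x. x \<in> X \<Longrightarrow> cmod (u x) \<le> B" shows "cmod (mean u) \<le> B"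
proof (cases "integrable \<mu> u")
  case True
  have "cmod (mean u) \<le> (\<integral>x. cmod (u x) \<partial>\<mu>)" unfolding mean_def by simp
  also have "\<dots> \<le> (\<integral>x. B \<partial>\<mu>)"
    by (rule integral_mono) (use True assms in \<open>auto simp: space_\<mu>\<close>)
  also have "\<dots> = B" using prob_space by simp
  finally show ?thesis .
next
  case False
  obtain x where "x \<in> X" using topspace_M_nonempty by blast
  then have "0 \<le> B" using assms norm_ge_zero order_trans by blast
  then show ?thesis using False by (simp add: mean_def not_integrable_integral_eq)
qed

abbreviation ip :: "('x \<Rightarrow> complex) \<Rightarrow> ('x \<Rightarrow> complex) \<Rightarrow> complex" where
  "ip u v \<equiv> mean (\<lambda>x. u x * cnj (v x))"

text \<open>
  The squared \<open>L\<^sup>2\<close> norm.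
\<close>

definition sqnorm :: "('x \<Rightarrow> complex) \<Rightarrow> real" where
  "sqnorm u = Re (ip u u)"

lemma sqnorm_integral: "sqnorm u = (\<integral>x. (cmod (u x))\<^sup>2 \<partial>\<mu>)"
proof -
  have "sqnorm u = Re (mean (\<lambda>x. of_real ((cmod (u x))\<^sup>2)))"
    unfolding sqnorm_def by (simp only: complex_norm_square)
  also have "\<dots> = (\<integral>x. (cmod (u x))\<^sup>2 \<partial>\<mu>)"
    unfolding mean_def by (subst integral_complex_of_real) simp
  finally show ?thesis .
qed

lemma sqnorm_nonneg: "0 \<le> sqnorm u"
  by (simp add: sqnorm_integral)

lemma mean_self: "ip u u = of_real (sqnorm u)"
proof -
  have "ip u u = mean (\<lambda>x. of_real ((cmod (u x))\<^sup>2))"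
    by (simp only: complex_norm_square)
  then show ?thesis
    unfolding sqnorm_integral mean_def by (simp only: integral_complex_of_real)
qed

section \<open>Equicontinuity and full support\<close>

definition one_nhd :: "'g set \<Rightarrow> bool" where
  "one_nhd U \<longleftrightarrow> openin T U \<and> \<one> \<in> U"

lemma one_nhd_carrier: "one_nhd U \<Longrightarrow> g \<in> U \<Longrightarrow> g \<in> carrier G"
  using one_nhd_def openin_subset topspace_T by blast

lemma one_nhd_Int: "one_nhd U \<Longrightarrow> one_nhd V \<Longrightarrow> one_nhd (U \<inter> V)"
  by (simp add: one_nhd_def openin_Int)

text \<open>
  The difference is a continuous function of \<open>k\<close>, \<open>g\<close> and the point, and it vanishes
  for \<open>g = \<one>\<close>. Since \<open>k\<close> and the point range over compact spaces, the tube lemma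
  provides one neighbourhood \<open>U\<close> for all of them. The uniformity in \<open>k\<close> makes the set
  of all translates of \<open>u\<close> equicontinuous.
\<close>

lemma translates_equicontinuous:
  assumes u: "cts u" and e: "e > 0"
  obtains U where "one_nhd U"
    "\<And>k g x. \<lbrakk>k \<in> carrier G; g \<in> U; x \<in> X\<rbrakk> \<Longrightarrow> cmod (u (k \<star> g \<star> x) - u (k \<star> x)) < e"
proof -
  obtain x0 where x0: "x0 \<in> X" using topspace_M_nonempty by blast
  let ?P = "prod_topology (prod_topology T T) T"
  define F where "F = (\<lambda>a. u (a \<star> x0))"
  have F: "continuous_map T euclidean F"
    using continuous_map_compose[OF orbit_continuous[OF x0] u] by (simp add: o_def F_def)
  have k: "continuous_map ?P T (\<lambda>p. fst (fst p))" and a: "continuous_map ?P T (\<lambda>p. snd (fst p))"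
    and g: "continuous_map ?P T snd"
    using continuous_map_compose[OF continuous_map_fst continuous_map_fst]
      continuous_map_compose[OF continuous_map_fst continuous_map_snd] continuous_map_snd
    by (simp_all add: o_def)
  have mult: "continuous_map ?P T (\<lambda>p. \<alpha> p \<otimes> \<beta> p)"
    if "continuous_map ?P T \<alpha>" "continuous_map ?P T \<beta>" for \<alpha> \<beta>
    using continuous_map_compose[OF continuous_map_pairedI[OF that] mult_continuous]
    by (simp add: o_def)
  have "continuous_map ?P euclidean (\<lambda>p. F (fst (fst p) \<otimes> (snd p \<otimes> snd (fst p))) - F (fst (fst p) \<otimes> snd (fst p)))"
    using continuous_map_compose[OF mult[OF k mult[OF g a]] F] continuous_map_compose[OF mult[OF k a] F]
    by (intro continuous_map_diff) (simp_all add: o_def)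
  then have W: "openin ?P {p \<in> topspace ?P. F (fst (fst p) \<otimes> (snd p \<otimes> snd (fst p))) - F (fst (fst p) \<otimes> snd (fst p)) \<in> ball 0 e}"
    (is "openin _ ?W")
    by (rule openin_continuous_map_preimage) simp
  have C: "compactin (prod_topology T T) (carrier G \<times> carrier G)"
    using compact_T topspace_T by (simp add: compactin_Times compact_space_def)
  have sub: "(carrier G \<times> carrier G) \<times> {\<one>} \<subseteq> ?W"
    using e by (auto simp: topspace_T)
  obtain U' V where V: "openin T V" "carrier G \<times> carrier G \<subseteq> U'" "\<one> \<in> V" "U' \<times> V \<subseteq> ?W"
    using tube_lemma_left[OF W C _ sub] topspace_T by auto
  show thesis
  proof (rule that)
    show "one_nhd V" using V by (simp add: one_nhd_def)
    fix k g x assume *: "k \<in> carrier G" "g \<in> V" "x \<in> X"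
    then have g: "g \<in> carrier G" using V(1) openin_subset topspace_T by blast
    obtain a where a: "a \<in> carrier G" "a \<star> x0 = x" using transitive x0 * by blast
    have "((k, a), g) \<in> ?W" using V * a by blast
    then have "cmod (F (k \<otimes> (g \<otimes> a)) - F (k \<otimes> a)) < e" by (simp add: dist_norm norm_minus_commute)
    then show "cmod (u (k \<star> g \<star> x) - u (k \<star> x)) < e"
      using * g a x0 by (simp add: F_def act_mult act_closed)
  qed
qed

text \<open>
  The converse of equicontinuity under small group elements: orbit maps are quotient maps, so it
  suffices to check continuity on the group.
\<close>

lemma ctsI:
  assumes "\<And>e. e > 0 \<Longrightarrow> \<exists>U. one_nhd U \<and> (\<forall>g\<in>U. \<forall>x\<in>X. cmod (u (g \<star> x) - u x) \<le> e)"
  shows "cts u"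
proof -
  obtain x0 where x0: "x0 \<in> X" using topspace_M_nonempty by blast
  have "continuous_map T euclidean (u \<circ> (\<lambda>a. a \<star> x0))"
    unfolding continuous_map_def
  proof (intro conjI allI impI)
    fix S :: "complex set" assume "openin euclidean S"
    then have S: "open S" by simp
    show "openin T {a \<in> topspace T. (u \<circ> (\<lambda>a. a \<star> x0)) a \<in> S}"
    proof (subst openin_subopen, intro ballI)
      fix a assume "a \<in> {a \<in> topspace T. (u \<circ> (\<lambda>a. a \<star> x0)) a \<in> S}"
      then have a: "a \<in> carrier G" "u (a \<star> x0) \<in> S" by (auto simp: topspace_T)
      then obtain e where e: "e > 0" "\<And>z. dist z (u (a \<star> x0)) < e \<Longrightarrow> z \<in> S"
        using S open_dist by metis
      obtain U where U: "one_nhd U" "\<forall>g\<in>U. \<forall>x\<in>X. cmod (u (g \<star> x) - u x) \<le> e/2"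
        using assms[of "e/2"] e by auto
      have "(\<lambda>g. g \<otimes> a) ` U \<subseteq> {a \<in> topspace T. (u \<circ> (\<lambda>a. a \<star> x0)) a \<in> S}"
      proof safe
        fix g assume g: "g \<in> U"
        then have gc: "g \<in> carrier G" using U one_nhd_carrier by blast
        then show "g \<otimes> a \<in> topspace T" using a by (simp add: topspace_T)
        have "cmod (u (g \<star> a \<star> x0) - u (a \<star> x0)) \<le> e/2" using U g a x0 act_closed by blast
        then show "(u \<circ> (\<lambda>a. a \<star> x0)) (g \<otimes> a) \<in> S"
          using e gc a x0 by (simp add: act_mult dist_norm)
      qed
      moreover have "openin T ((\<lambda>g. g \<otimes> a) ` U)" using U a openin_right_translate one_nhd_def by blast
      moreover have "a \<in> (\<lambda>g. g \<otimes> a) ` U" using U a by (force simp: one_nhd_def)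
      ultimately show "\<exists>B. openin T B \<and> a \<in> B \<and> B \<subseteq> {a \<in> topspace T. (u \<circ> (\<lambda>a. a \<star> x0)) a \<in> S}"
        by blast
    qed
  qed auto
  then show ?thesis using continuous_compose_quotient_map orbit_quotient[OF x0] by blast
qed

lemma cts_cong: "cts u \<Longrightarrow> (\<And>x. x \<in> X \<Longrightarrow> u x = v x) \<Longrightarrow> cts v"
  using continuous_map_eq by blast

lemma cts_uniform_limit:
  assumes "\<And>e. e > 0 \<Longrightarrow> \<exists>v. cts v \<and> (\<forall>x\<in>X. cmod (u x - v x) \<le> e)"
  shows "cts u"
proof (rule ctsI)
  fix e :: real assume e: "e > 0"
  then obtain v where v: "cts v" "\<forall>x\<in>X. cmod (u x - v x) \<le> e/3" using assms[of "e/3"] by auto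
  obtain U where U: "one_nhd U"
    "\<And>k g x. \<lbrakk>k \<in> carrier G; g \<in> U; x \<in> X\<rbrakk> \<Longrightarrow> cmod (v (k \<star> g \<star> x) - v (k \<star> x)) < e/3"
    using translates_equicontinuous[OF v(1), of "e/3"] e by auto
  have "cmod (u (g \<star> x) - u x) \<le> e" if "g \<in> U" "x \<in> X" for g x
  proof -
    have g: "g \<in> carrier G" using that U one_nhd_carrier by blast
    have "cmod (v (g \<star> x) - v x) < e/3" using U(2)[of \<one> g x] that g by (simp add: act_one act_closed)
    moreover have "cmod (u (g \<star> x) - v (g \<star> x)) \<le> e/3" using v that g act_closed by blast
    moreover have "cmod (u x - v x) \<le> e/3" using v that by blast
    moreover have "cmod (u (g \<star> x) - u x) \<le> cmod (u (g \<star> x) - v (g \<star> x)) + cmod (v (g \<star> x) - v x) + cmod (u x - v x)"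
      by (rule order_trans[of _ "cmod ((u (g \<star> x) - v (g \<star> x)) + (v (g \<star> x) - v x) - (u x - v x))"])
        (simp, smt (verit) norm_triangle_ineq norm_triangle_ineq4)
    ultimately show ?thesis by linarith
  qed
  then show "\<exists>U. one_nhd U \<and> (\<forall>g\<in>U. \<forall>x\<in>X. cmod (u (g \<star> x) - u x) \<le> e)" using U by blast
qed

text \<open>
  Finitely many translates of \<open>U\<close> cover the group, so as many translates of \<open>U x\<close>
  cover \<open>M\<close>, and all of these have the same measure. The bound depends on \<open>U\<close> only,
  not on \<open>x\<close>; in particular \<open>\<mu>\<close> has full support.
\<close>

lemma orbit_nhd_measure:
  assumes "one_nhd U"
  obtains \<delta> where "\<delta> > 0"
    "\<And>x. x \<in> X \<Longrightarrow> (\<lambda>g. g \<star> x) ` U \<in> sets \<mu> \<and> \<delta> \<le> measure \<mu> ((\<lambda>g. g \<star> x) ` U)"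
proof -
  have Uc: "U \<subseteq> carrier G" using assms one_nhd_carrier by blast
  obtain D where D: "finite D" "D \<subseteq> carrier G" "carrier G \<subseteq> (\<Union>k\<in>D. (\<lambda>g. k \<otimes> g) ` U)"
  proof (rule finite_translates_cover[of "\<lambda>k. (\<lambda>g. k \<otimes> g) ` U"])
    fix k assume "k \<in> carrier G"
    then show "openin T ((\<lambda>g. k \<otimes> g) ` U) \<and> k \<in> (\<lambda>g. k \<otimes> g) ` U"
      using assms openin_left_translate by (force simp: one_nhd_def)
  qed auto
  have Dne: "D \<noteq> {}" using D by auto
  show thesis
  proof (rule that)
    show "1 / card D > 0" using Dne D by (simp add: card_gt_0_iff)
    fix x assume x: "x \<in> X"
    let ?B = "(\<lambda>g. g \<star> x) ` U"
    have B: "?B \<in> sets \<mu>"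
      using orbit_open[OF x] assms by (intro openin_sets) (auto simp: open_map_def one_nhd_def)
    have BM: "?B \<subseteq> X" using Uc x act_closed by blast
    have kB: "(\<star>) k ` ?B \<in> sets \<mu>" "measure \<mu> ((\<star>) k ` ?B) = measure \<mu> ?B" if k: "k \<in> D" for k
    proof -
      have kc: "k \<in> carrier G" using k D by blast
      have "(\<star>) k ` ?B = (\<lambda>g. g \<star> x) ` ((\<lambda>g. k \<otimes> g) ` U)"
        using kc Uc x by (auto simp: act_mult subset_iff image_iff)
      then show "(\<star>) k ` ?B \<in> sets \<mu>"
        using orbit_open[OF x] openin_left_translate[OF _ kc] assms
        by (intro openin_sets) (auto simp: open_map_def one_nhd_def)
      show "measure \<mu> ((\<star>) k ` ?B) = measure \<mu> ?B"
        using emeasure_act[OF kc B] by (simp add: measure_def)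
    qed
    have "X \<subseteq> (\<Union>k\<in>D. (\<star>) k ` ?B)"
    proof
      fix y assume "y \<in> X"
      then obtain a where a: "a \<in> carrier G" "a \<star> x = y" using transitive x by blast
      then obtain k g where kg: "k \<in> D" "g \<in> U" "a = k \<otimes> g" using D by blast
      then have "y = k \<star> (g \<star> x)" using a x D Uc act_mult by blast
      then show "y \<in> (\<Union>k\<in>D. (\<star>) k ` ?B)" using kg by blast
    qed
    then have "1 \<le> measure \<mu> (\<Union>k\<in>D. (\<star>) k ` ?B)"
      using prob_space kB D by (metis (no_types, lifting) finite_measure_mono sets.finite_UN space_\<mu>)
    also have "\<dots> \<le> (\<Sum>k\<in>D. measure \<mu> ((\<star>) k ` ?B))"
      using kB D by (intro finite_measure_subadditive_finite) auto
    also have "\<dots> = card D * measure \<mu> ?B" using kB by simp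
    finally show "?B \<in> sets \<mu> \<and> 1 / card D \<le> measure \<mu> ?B"
      using B Dne D by (simp add: field_simps card_gt_0_iff mult.commute)
  qed
qed

lemma integral_ge_on_set:
  fixes f :: "'x \<Rightarrow> real"
  assumes "integrable \<mu> f" "\<And>x. x \<in> X \<Longrightarrow> 0 \<le> f x" "B \<in> sets \<mu>" "\<And>x. x \<in> B \<Longrightarrow> c \<le> f x"
    "0 \<le> c" "\<delta> \<le> measure \<mu> B"
  shows "c * \<delta> \<le> (\<integral>x. f x \<partial>\<mu>)"
proof -
  have "c * \<delta> \<le> c * measure \<mu> B" using assms mult_left_mono by blast
  also have "\<dots> = (\<integral>x. c * indicator B x \<partial>\<mu>)"
    using assms(3) sets.sets_into_space[OF assms(3)] by (simp add: Int_absorb1 Int_commute)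
  also have "\<dots> \<le> (\<integral>x. f x \<partial>\<mu>)"
  proof (rule integral_mono)
    have "integrable \<mu> (indicator B :: 'x \<Rightarrow> real)"
      using assms(3) by (intro integrable_real_indicator) (auto simp: less_top[symmetric])
    then show "integrable \<mu> (\<lambda>x. c * indicator B x)" by simp
  qed (use assms in \<open>auto simp: space_\<mu> split: split_indicator\<close>)
  finally show ?thesis .
qed

lemma sqnorm_integrable: "cts u \<Longrightarrow> integrable \<mu> (\<lambda>x. (cmod (u x))\<^sup>2)"
  using cts_integrable[OF cts_mult[OF _ cts_cnj], of u u]
  by (simp only: complex_norm_square[symmetric] complex_of_real_integrable_eq)

text \<open>
  A continuous function that is nonzero at a point stays away from 0 on a set \<open>U x\<close>, which
  has positive measure.
\<close>

lemma sqnorm_zero: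
  assumes u: "cts u" and "sqnorm u = 0" and x: "x \<in> X"
  shows "u x = 0"
proof (rule ccontr)
  assume "u x \<noteq> 0"
  then have e: "cmod (u x) / 2 > 0" (is "?e > 0") by simp
  obtain U where U: "one_nhd U"
    "\<And>k g x. \<lbrakk>k \<in> carrier G; g \<in> U; x \<in> X\<rbrakk> \<Longrightarrow> cmod (u (k \<star> g \<star> x) - u (k \<star> x)) < ?e"
    using translates_equicontinuous[OF u e] by blast
  obtain \<delta> where \<delta>: "\<delta> > 0" "(\<lambda>g. g \<star> x) ` U \<in> sets \<mu>" "\<delta> \<le> measure \<mu> ((\<lambda>g. g \<star> x) ` U)"
    using orbit_nhd_measure[OF U(1)] x by metis
  have "?e\<^sup>2 * \<delta> \<le> (\<integral>x. (cmod (u x))\<^sup>2 \<partial>\<mu>)"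
  proof (rule integral_ge_on_set[OF sqnorm_integrable[OF u] _ \<delta>(2) _ _ \<delta>(3)])
    fix y assume "y \<in> (\<lambda>g. g \<star> x) ` U"
    then obtain g where g: "g \<in> U" "y = g \<star> x" by blast
    then have "cmod (u y - u x) < ?e"
      using U(2)[of \<one> g x] x one_nhd_carrier[OF U(1)] by (simp add: act_one act_closed)
    then have "?e \<le> cmod (u y)" using norm_triangle_ineq2[of "u x" "u y"] by (simp add: norm_minus_commute)
    then show "?e\<^sup>2 \<le> (cmod (u y))\<^sup>2" using e power_mono by (metis less_imp_le)
  qed auto
  moreover have "?e\<^sup>2 * \<delta> > 0" using e \<delta> by simp
  ultimately show False using assms sqnorm_integral by simp
qed

text \<open>
  The discriminant argument, for the value of a positive semidefinite Hermitian form at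
  \<open>u + c v\<close>. It serves both the inner product and the form \<open>\<langle>S u, v\<rangle>\<close> of a
  positive operator.
\<close>

lemma complex_Cauchy_Schwarz:
  assumes "\<And>c. 0 \<le> a + 2 * Re (cnj c * b) + (cmod c)\<^sup>2 * d" "0 \<le> d"
  shows "(cmod b)\<^sup>2 \<le> a * d"
proof (cases "d = 0")
  case True
  have "b = 0"
  proof (rule ccontr)
    assume b: "b \<noteq> 0"
    have "0 \<le> a + 2 * Re (cnj (of_real (-t) * b) * b)" for t
      using assms(1)[of "of_real (-t) * b"] True by simp
    moreover have "Re (cnj (of_real (-t) * b) * b) = - (t * (cmod b)\<^sup>2)" for t
      by (simp add: cmod_power2, simp add: power2_eq_square algebra_simps)
    ultimately have *: "2 * (t * (cmod b)\<^sup>2) \<le> a" for t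
      by (smt (verit, best))
    have "2 * ((\<bar>a\<bar> + 1) / (cmod b)\<^sup>2 * (cmod b)\<^sup>2) \<le> a" by (rule *)
    then show False using b by auto
  qed
  then show ?thesis using True by simp
next
  case False
  then have d: "d > 0" using assms by simp
  have "0 \<le> a + 2 * Re (cnj (- b / d) * b) + (cmod (- b / d))\<^sup>2 * d" by (rule assms(1))
  also have "Re (cnj (- b / d) * b) = - (cmod b)\<^sup>2 / d"
    using d by (simp add: cmod_power2, simp add: power2_eq_square field_simps)
  also have "(cmod (- b / d))\<^sup>2 * d = (cmod b)\<^sup>2 / d"
    using d by (simp add: norm_divide power_divide power2_eq_square)
  finally show ?thesis using d by (simp add: field_simps)
qed

lemma sqnorm_expand:
  assumes "cts u" "cts v"
  shows "sqnorm (\<lambda>x. u x + c * v x) = sqnorm u + 2 * Re (cnj c * ip u v) + (cmod c)\<^sup>2 * sqnorm v"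
proof -
  have "complex_of_real (sqnorm (\<lambda>x. u x + c * v x)) = mean (\<lambda>x. (u x + c * v x) * cnj (u x + c * v x))"
    by (rule mean_self[symmetric])
  also have "\<dots> = mean (\<lambda>x. (u x * cnj (u x) + (c * cnj c) * (v x * cnj (v x))) +
      (cnj c * (u x * cnj (v x)) + c * cnj (u x * cnj (v x))))"
    by (simp add: algebra_simps)
  also have "\<dots> = (of_real (sqnorm u) + (c * cnj c) * of_real (sqnorm v)) +
     (cnj c * ip u v + c * cnj (ip u v))"
    unfolding mean_cnj[symmetric] mean_cmult[symmetric] mean_self[symmetric]
    using assms by (subst mean_add; (subst mean_add)?; (subst mean_add)?; (intro cts_add cts_mult cts_const cts_cnj)?) auto
  finally have "sqnorm (\<lambda>x. u x + c * v x) = Re \<dots>"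
    by (metis Re_complex_of_real)
  then show ?thesis by (simp add: cmod_power2, simp add: algebra_simps power2_eq_square)
qed

lemma Cauchy_Schwarz:
  assumes "cts u" "cts v"
  shows "(cmod (ip u v))\<^sup>2 \<le> sqnorm u * sqnorm v"
  using sqnorm_expand[OF assms] sqnorm_nonneg by (intro complex_Cauchy_Schwarz) (metis, simp)

lemma sqnorm_bound:
  assumes "\<And>x. x \<in> X \<Longrightarrow> cmod (u x) \<le> B" shows "sqnorm u \<le> B\<^sup>2"
proof -
  have "cmod (ip u u) \<le> B\<^sup>2"
    by (rule mean_bound) (use assms in \<open>auto simp: norm_mult power2_eq_square intro!: mult_mono order_trans[OF norm_ge_zero]\<close>)
  then show ?thesis by (simp add: mean_self sqnorm_nonneg)
qed

section \<open>Averaging a kernel over the group\<close>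

text \<open>
  The continuous functions on \<open>M \<times> M\<close>, described by the action of the group in each
  variable. In this form a modulus of continuity can be shared by a whole family of kernels.
\<close>

definition kernel :: "('x \<Rightarrow> 'x \<Rightarrow> complex) \<Rightarrow> bool" where
  "kernel K \<longleftrightarrow> (\<exists>B. \<forall>x\<in>X. \<forall>y\<in>X. cmod (K x y) \<le> B) \<and>
     (\<forall>e>0. \<exists>U. one_nhd U \<and> (\<forall>g\<in>U. \<forall>h\<in>U. \<forall>x\<in>X. \<forall>y\<in>X.
        cmod (K (g \<star> x) (h \<star> y) - K x y) \<le> e))"

lemma kernel_bound:
  assumes "kernel K"
  obtains B where "B > 0" "\<And>x y. \<lbrakk>x \<in> X; y \<in> X\<rbrakk> \<Longrightarrow> cmod (K x y) \<le> B"
proof -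
  obtain B where "\<forall>x\<in>X. \<forall>y\<in>X. cmod (K x y) \<le> B"
    using assms unfolding kernel_def by blast
  then show thesis using that[of "max B 1"] by (fastforce simp: le_max_iff_disj)
qed

lemma kernel_modulus:
  assumes "kernel K" "e > 0"
  obtains U where "one_nhd U"
    "\<And>g h x y. \<lbrakk>g \<in> U; h \<in> U; x \<in> X; y \<in> X\<rbrakk> \<Longrightarrow> cmod (K (g \<star> x) (h \<star> y) - K x y) \<le> e"
  using assms unfolding kernel_def by meson

lemma kernel_diff:
  assumes K: "kernel K" and L: "kernel L"
  shows "kernel (\<lambda>x y. K x y - L x y)"
  unfolding kernel_def
proof (intro conjI allI impI)
  obtain B C where "\<And>x y. \<lbrakk>x \<in> X; y \<in> X\<rbrakk> \<Longrightarrow> cmod (K x y) \<le> B"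
    "\<And>x y. \<lbrakk>x \<in> X; y \<in> X\<rbrakk> \<Longrightarrow> cmod (L x y) \<le> C"
    using kernel_bound[OF K] kernel_bound[OF L] by metis
  then have "\<forall>x\<in>X. \<forall>y\<in>X. cmod (K x y - L x y) \<le> B + C"
    by (meson add_mono norm_triangle_ineq4 order_trans)
  then show "\<exists>B. \<forall>x\<in>X. \<forall>y\<in>X. cmod (K x y - L x y) \<le> B" by blast
  fix e :: real assume "e > 0"
  then have e: "e/2 > 0" by simp
  obtain U where U: "one_nhd U" "\<And>g h x y. \<lbrakk>g \<in> U; h \<in> U; x \<in> X; y \<in> X\<rbrakk> \<Longrightarrow> cmod (K (g \<star> x) (h \<star> y) - K x y) \<le> e/2"
    using kernel_modulus[OF K e] by metis
  obtain V where V: "one_nhd V" "\<And>g h x y. \<lbrakk>g \<in> V; h \<in> V; x \<in> X; y \<in> X\<rbrakk> \<Longrightarrow> cmod (L (g \<star> x) (h \<star> y) - L x y) \<le> e/2"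
    using kernel_modulus[OF L e] by metis
  have "cmod (K (g \<star> x) (h \<star> y) - L (g \<star> x) (h \<star> y) - (K x y - L x y)) \<le> e"
    if "g \<in> U \<inter> V" "h \<in> U \<inter> V" "x \<in> X" "y \<in> X" for g h x y
  proof -
    have "cmod (K (g \<star> x) (h \<star> y) - L (g \<star> x) (h \<star> y) - (K x y - L x y))
      = cmod ((K (g \<star> x) (h \<star> y) - K x y) - (L (g \<star> x) (h \<star> y) - L x y))"
      by (simp add: algebra_simps)
    then show ?thesis
      using U(2)[of g h x y] V(2)[of g h x y] that
        norm_triangle_ineq4[of "K (g \<star> x) (h \<star> y) - K x y" "L (g \<star> x) (h \<star> y) - L x y"]
      by fastforce
  qed
  then show "\<exists>U. one_nhd U \<and> (\<forall>g\<in>U. \<forall>h\<in>U. \<forall>x\<in>X. \<forall>y\<in>X.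
        cmod (K (g \<star> x) (h \<star> y) - L (g \<star> x) (h \<star> y) - (K x y - L x y)) \<le> e)"
    using one_nhd_Int[OF U(1) V(1)] by blast
qed

lemma kernel_cts_left:
  assumes "kernel K" "x \<in> X" shows "cts (K x)"
proof (rule ctsI)
  fix e :: real assume e: "e > 0"
  obtain U where U: "one_nhd U" "\<And>g h x y. \<lbrakk>g \<in> U; h \<in> U; x \<in> X; y \<in> X\<rbrakk> \<Longrightarrow> cmod (K (g \<star> x) (h \<star> y) - K x y) \<le> e"
    using kernel_modulus[OF assms(1) e] by metis
  show "\<exists>U. one_nhd U \<and> (\<forall>g\<in>U. \<forall>y\<in>X. cmod (K x (g \<star> y) - K x y) \<le> e)"
    using U(1) U(2)[of \<one> _ x] assms(2) by (auto simp: act_one one_nhd_def)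
qed

lemma kernel_apply_cts:
  assumes K: "kernel K" and u: "cts u"
  shows "cts (\<lambda>x. mean (\<lambda>y. K x y * u y))"
proof (rule ctsI)
  fix e :: real assume e: "e > 0"
  obtain B where B: "B > 0" "\<And>x. x \<in> X \<Longrightarrow> cmod (u x) \<le> B" using cts_bounded[OF u] by metis
  obtain U where U: "one_nhd U" "\<And>g h x y. \<lbrakk>g \<in> U; h \<in> U; x \<in> X; y \<in> X\<rbrakk> \<Longrightarrow> cmod (K (g \<star> x) (h \<star> y) - K x y) \<le> e/B"
    using kernel_modulus[OF K, of "e/B"] e B by auto
  have "cmod (mean (\<lambda>y. K (g \<star> x) y * u y) - mean (\<lambda>y. K x y * u y)) \<le> e"
    if g: "g \<in> U" and x: "x \<in> X" for g x
  proof -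
    have gx: "g \<star> x \<in> X" using one_nhd_carrier[OF U(1) g] x act_closed by blast
    have "mean (\<lambda>y. K (g \<star> x) y * u y) - mean (\<lambda>y. K x y * u y) = mean (\<lambda>y. K (g \<star> x) y * u y - K x y * u y)"
      by (intro mean_diff[symmetric] cts_mult kernel_cts_left K u gx x)
    also have "cmod \<dots> \<le> e"
    proof (rule mean_bound)
      fix y assume y: "y \<in> X"
      have "cmod (K (g \<star> x) y - K x y) * cmod (u y) \<le> (e/B) * B"
        using U(2)[of g \<one> x y] g x y U(1) B e by (intro mult_mono) (auto simp: act_one one_nhd_def)
      then show "cmod (K (g \<star> x) y * u y - K x y * u y) \<le> e"
        using B by (simp add: norm_mult[symmetric] left_diff_distrib)
    qed
    finally show ?thesis .
  qed
  then show "\<exists>U. one_nhd U \<and> (\<forall>g\<in>U. \<forall>x\<in>X. cmod (mean (\<lambda>y. K (g \<star> x) y * u y) - mean (\<lambda>y. K x y * u y)) \<le> e)"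
    using U(1) by blast
qed

lemma kernel_sqnorm_cts:
  assumes K: "kernel K"
  shows "cts (\<lambda>x. of_real (sqnorm (K x)))"
proof (rule ctsI)
  fix e :: real assume e: "e > 0"
  obtain B where B: "B > 0" "\<And>x y. \<lbrakk>x \<in> X; y \<in> X\<rbrakk> \<Longrightarrow> cmod (K x y) \<le> B" using kernel_bound[OF K] by metis
  obtain U where U: "one_nhd U" "\<And>g h x y. \<lbrakk>g \<in> U; h \<in> U; x \<in> X; y \<in> X\<rbrakk> \<Longrightarrow> cmod (K (g \<star> x) (h \<star> y) - K x y) \<le> e/(2*B)"
    using kernel_modulus[OF K, of "e/(2*B)"] e B by auto
  have "cmod (of_real (sqnorm (K (g \<star> x))) - of_real (sqnorm (K x))) \<le> e"
    if g: "g \<in> U" and x: "x \<in> X" for g x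
  proof -
    have gx: "g \<star> x \<in> X" using one_nhd_carrier[OF U(1) g] x act_closed by blast
    have "of_real (sqnorm (K (g \<star> x))) - of_real (sqnorm (K x)) = mean (\<lambda>y. K (g \<star> x) y * cnj (K (g \<star> x) y) - K x y * cnj (K x y))"
      unfolding mean_self[symmetric]
      by (intro mean_diff[symmetric] cts_mult cts_cnj kernel_cts_left K gx x)
    also have "cmod \<dots> \<le> e"
    proof (rule mean_bound)
      fix y assume y: "y \<in> X"
      let ?a = "K (g \<star> x) y" and ?b = "K x y"
      have d: "cmod (?a - ?b) \<le> e/(2*B)" using U(2)[of g \<one> x y] g x y U(1) by (auto simp: act_one one_nhd_def)
      have "cmod (?a * cnj ?a - ?b * cnj ?b) = cmod (?a * cnj (?a - ?b) + (?a - ?b) * cnj ?b)"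
        by (simp add: algebra_simps)
      also have "\<dots> \<le> cmod ?a * cmod (?a - ?b) + cmod (?a - ?b) * cmod ?b"
        by (rule norm_triangle_le) (simp add: norm_mult del: complex_cnj_diff)
      also have "\<dots> \<le> B * (e/(2*B)) + (e/(2*B)) * B"
        using d B(1) B(2)[OF gx y] B(2)[OF x y] e by (intro add_mono mult_mono) auto
      also have "\<dots> = e" using B by simp
      finally show "cmod (?a * cnj ?a - ?b * cnj ?b) \<le> e" .
    qed
    finally show ?thesis .
  qed
  then show "\<exists>U. one_nhd U \<and> (\<forall>g\<in>U. \<forall>x\<in>X. cmod (complex_of_real (sqnorm (K (g \<star> x))) - of_real (sqnorm (K x))) \<le> e)"
    using U(1) by blast
qed

text \<open>
  The squared Hilbert-Schmidt norm, as an iterated integral.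
\<close>

definition hs_sq :: "('x \<Rightarrow> 'x \<Rightarrow> complex) \<Rightarrow> real" where
  "hs_sq K = (\<integral>x. sqnorm (K x) \<partial>\<mu>)"

lemma hs_sq_integrable: "kernel K \<Longrightarrow> integrable \<mu> (\<lambda>x. sqnorm (K x))"
  using cts_integrable[OF kernel_sqnorm_cts] by (simp only: complex_of_real_integrable_eq)

lemma hs_sq_nonneg: "0 \<le> hs_sq K"
  unfolding hs_sq_def by (simp add: sqnorm_nonneg)

lemma sqnorm_cong: "(\<And>x. x \<in> X \<Longrightarrow> u x = v x) \<Longrightarrow> sqnorm u = sqnorm v"
  unfolding sqnorm_def by (metis (no_types, lifting) mean_cong)

lemma hs_sq_cong:
  assumes "\<And>x y. \<lbrakk>x \<in> X; y \<in> X\<rbrakk> \<Longrightarrow> K x y = L x y" shows "hs_sq K = hs_sq L"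
  unfolding hs_sq_def
  by (rule Bochner_Integration.integral_cong) (use assms in \<open>auto simp: space_\<mu> intro: sqnorm_cong\<close>)

lemma hs_sq_of_real: "of_real (hs_sq K) = mean (\<lambda>x. of_real (sqnorm (K x)))"
  unfolding hs_sq_def mean_def by simp

lemma sqnorm_act:
  assumes "g \<in> carrier G" "cts u" shows "sqnorm (\<lambda>x. u (g \<star> x)) = sqnorm u"
  unfolding sqnorm_def using mean_act[OF assms(1) cts_mult[OF assms(2) cts_cnj[OF assms(2)]]] by simp

lemma hs_sq_invariant:
  assumes g: "g \<in> carrier G" and K: "kernel K"
  shows "hs_sq (\<lambda>x y. K (g \<star> x) (g \<star> y)) = hs_sq K"
proof -
  have "complex_of_real (hs_sq (\<lambda>x y. K (g \<star> x) (g \<star> y))) = mean (\<lambda>x. of_real (sqnorm (K (g \<star> x))))"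
    unfolding hs_sq_of_real
    by (rule mean_cong) (simp add: sqnorm_act[OF g kernel_cts_left[OF K act_closed[OF g]]])
  also have "\<dots> = of_real (hs_sq K)"
    unfolding hs_sq_of_real by (rule mean_act[OF g kernel_sqnorm_cts[OF K]])
  finally show ?thesis by simp
qed

lemma sqnorm_parallelogram:
  assumes "cts u" "cts v"
  shows "sqnorm (\<lambda>x. u x - v x) = 2 * sqnorm u + 2 * sqnorm v - 4 * sqnorm (\<lambda>x. (u x + v x) / 2)"
proof -
  have h: "sqnorm (\<lambda>x. (u x + v x) / 2) = sqnorm (\<lambda>x. u x + v x) / 4"
  proof -
    have "sqnorm (\<lambda>x. (u x + v x) / 2) = Re (mean (\<lambda>x. (1/4) * ((u x + v x) * cnj (u x + v x))))"
      unfolding sqnorm_def by simp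
    then show ?thesis unfolding mean_cmult sqnorm_def by simp
  qed
  show ?thesis using sqnorm_expand[OF assms, of 1] sqnorm_expand[OF assms, of "-1"] unfolding h by (simp add: field_simps)
qed

lemma hs_sq_parallelogram:
  assumes K: "kernel K" and L: "kernel L" and KL: "kernel (\<lambda>x y. (K x y + L x y) / 2)"
  shows "hs_sq (\<lambda>x y. K x y - L x y) = 2 * hs_sq K + 2 * hs_sq L - 4 * hs_sq (\<lambda>x y. (K x y + L x y) / 2)"
proof -
  have "hs_sq (\<lambda>x y. K x y - L x y) = (\<integral>x. 2 * sqnorm (K x) + 2 * sqnorm (L x) - 4 * sqnorm (\<lambda>y. (K x y + L x y) / 2) \<partial>\<mu>)"
    unfolding hs_sq_def
    by (rule Bochner_Integration.integral_cong)
      (auto simp: space_\<mu> sqnorm_parallelogram[OF kernel_cts_left[OF K] kernel_cts_left[OF L]])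
  then show ?thesis
    unfolding hs_sq_def using hs_sq_integrable[OF K] hs_sq_integrable[OF L] hs_sq_integrable[OF KL] by simp
qed

text \<open>
  This upgrades \<open>L\<^sup>2\<close> convergence to uniform convergence on an equicontinuous set of
  kernels: where \<open>D\<close> reaches \<open>e\<close>, it exceeds \<open>e/2\<close> on a product
  \<open>U x \<times> U y\<close>, the measure of which is bounded below.
\<close>

lemma hs_sq_small_imp_small:
  assumes U: "one_nhd U" and e: "e > 0"
  obtains \<eta> where "\<eta> > 0" "\<And>D x y. \<lbrakk>kernel D;
     \<And>g h x y. \<lbrakk>g \<in> U; h \<in> U; x \<in> X; y \<in> X\<rbrakk> \<Longrightarrow> cmod (D (g \<star> x) (h \<star> y) - D x y) \<le> e/2;
     hs_sq D < \<eta>; x \<in> X; y \<in> X\<rbrakk> \<Longrightarrow> cmod (D x y) < e"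
proof -
  obtain \<delta> where \<delta>: "\<delta> > 0"
    "\<And>x. x \<in> X \<Longrightarrow> (\<lambda>g. g \<star> x) ` U \<in> sets \<mu> \<and> \<delta> \<le> measure \<mu> ((\<lambda>g. g \<star> x) ` U)"
    using orbit_nhd_measure[OF U] by metis
  show thesis
  proof (rule that)
    show "(e/2)\<^sup>2 * \<delta> * \<delta> > 0" using e \<delta> by simp
    fix D x y assume D: "kernel D"
      and mod: "\<And>g h x y. \<lbrakk>g \<in> U; h \<in> U; x \<in> X; y \<in> X\<rbrakk> \<Longrightarrow> cmod (D (g \<star> x) (h \<star> y) - D x y) \<le> e/2"
      and hs_sq: "hs_sq D < (e/2)\<^sup>2 * \<delta> * \<delta>" and x: "x \<in> X" and y: "y \<in> X"
    show "cmod (D x y) < e"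
    proof (rule ccontr)
      assume "\<not> cmod (D x y) < e"
      then have big: "e/2 \<le> cmod (D (g \<star> x) (h \<star> y))" if "g \<in> U" "h \<in> U" for g h
        using mod[OF that x y] norm_triangle_ineq2[of "D x y" "D (g \<star> x) (h \<star> y)"]
        by (simp add: norm_minus_commute)
      have "(e/2)\<^sup>2 * \<delta> * \<delta> \<le> hs_sq D"
        unfolding hs_sq_def
      proof (rule integral_ge_on_set[OF hs_sq_integrable[OF D]])
        fix x' assume "x' \<in> (\<lambda>g. g \<star> x) ` U"
        then obtain g where g: "g \<in> U" "x' = g \<star> x" by blast
        then have x': "x' \<in> X" using one_nhd_carrier[OF U] act_closed x by blast
        show "(e/2)\<^sup>2 * \<delta> \<le> sqnorm (D x')"
          unfolding sqnorm_integral
        proof (rule integral_ge_on_set[OF sqnorm_integrable[OF kernel_cts_left[OF D x']]])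
          fix y' assume "y' \<in> (\<lambda>g. g \<star> y) ` U"
          then show "(e/2)\<^sup>2 \<le> (cmod (D x' y'))\<^sup>2" using big g e by (auto intro!: power_mono)
        qed (use \<delta> y in auto)
      qed (use \<delta> x sqnorm_nonneg in auto)
      then show False using hs_sq by simp
    qed
  qed
qed

text \<open>
  The orbit of the kernel \<open>f x * cnj (b y)\<close> under the diagonal action, closed under
  midpoints. Midpoints suffice for the parallelogram law, and they turn every statement about
  convex combinations into a two-case induction.
\<close>

inductive_set orbit_hull :: "('x \<Rightarrow> complex) \<Rightarrow> ('x \<Rightarrow> complex) \<Rightarrow> ('x \<Rightarrow> 'x \<Rightarrow> complex) set"
  for f b where
  orbit: "g \<in> carrier G \<Longrightarrow> (\<lambda>x y. f (g \<star> x) * cnj (b (g \<star> y))) \<in> orbit_hull f b"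
| midpoint: "\<lbrakk>K \<in> orbit_hull f b; L \<in> orbit_hull f b\<rbrakk> \<Longrightarrow> (\<lambda>x y. (K x y + L x y) / 2) \<in> orbit_hull f b"

lemma hull_cts:
  assumes "K \<in> orbit_hull f b" "cts f" "cts b"
  shows "cts (K x)" "cts (\<lambda>x. K x y)"
proof -
  have half: "cts (\<lambda>x. (u x + v x) / 2)" if "cts u" "cts v" for u v
    using cts_mult[OF cts_add[OF that] cts_const[of "1/2"]] by simp
  show "cts (K x)" "cts (\<lambda>x. K x y)"
    using assms(1) by induction (auto intro!: half cts_mult cts_cnj cts_act[OF _ assms(2)] cts_act[OF _ assms(3)])
qed

lemma hull_translate:
  assumes "K \<in> orbit_hull f b" "g \<in> carrier G"
  obtains L where "L \<in> orbit_hull f b" "\<And>x y. \<lbrakk>x \<in> X; y \<in> X\<rbrakk> \<Longrightarrow> L x y = K (g \<star> x) (g \<star> y)"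
proof -
  have "\<exists>L\<in>orbit_hull f b. \<forall>x\<in>X. \<forall>y\<in>X. L x y = K (g \<star> x) (g \<star> y)"
    using assms(1)
  proof induction
    case (orbit k)
    then show ?case
      using assms(2) orbit_hull.orbit[of "k \<otimes> g" f b] by (intro bexI) (auto simp: act_mult)
  next
    case (midpoint K L)
    then obtain K' L' where "K' \<in> orbit_hull f b" "L' \<in> orbit_hull f b"
      "\<forall>x\<in>X. \<forall>y\<in>X. K' x y = K (g \<star> x) (g \<star> y)"
      "\<forall>x\<in>X. \<forall>y\<in>X. L' x y = L (g \<star> x) (g \<star> y)"
      by blast
    then show ?case
      by (intro bexI[OF _ orbit_hull.midpoint[of K' f b L']]) auto
  qed
  then show thesis using that by blast
qed

lemma hull_equicontinuous:
  assumes f: "cts f" and b: "cts b" and e: "e > 0"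
  obtains U where "one_nhd U" "\<And>K g h x y. \<lbrakk>K \<in> orbit_hull f b; g \<in> U; h \<in> U; x \<in> X; y \<in> X\<rbrakk>
    \<Longrightarrow> cmod (K (g \<star> x) (h \<star> y) - K x y) \<le> e"
proof -
  obtain A where A: "A > 0" "\<And>x. x \<in> X \<Longrightarrow> cmod (f x) \<le> A" using cts_bounded[OF f] by metis
  obtain B where B: "B > 0" "\<And>x. x \<in> X \<Longrightarrow> cmod (b x) \<le> B" using cts_bounded[OF b] by metis
  obtain U where U: "one_nhd U"
    "\<And>k g x. \<lbrakk>k \<in> carrier G; g \<in> U; x \<in> X\<rbrakk> \<Longrightarrow> cmod (f (k \<star> g \<star> x) - f (k \<star> x)) < e/(2*B)"
    using translates_equicontinuous[OF f, of "e/(2*B)"] B e by auto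
  obtain V where V: "one_nhd V"
    "\<And>k g x. \<lbrakk>k \<in> carrier G; g \<in> V; x \<in> X\<rbrakk> \<Longrightarrow> cmod (b (k \<star> g \<star> x) - b (k \<star> x)) < e/(2*A)"
    using translates_equicontinuous[OF b, of "e/(2*A)"] A e by auto
  have "cmod (K (g \<star> x) (h \<star> y) - K x y) \<le> e"
    if K: "K \<in> orbit_hull f b" and g: "g \<in> U \<inter> V" and h: "h \<in> U \<inter> V" and x: "x \<in> X" and y: "y \<in> X"
    for K g h x y
    using K
  proof induction
    case (orbit k)
    let ?f = "f (k \<star> x)" and ?f' = "f (k \<star> g \<star> x)" and ?b = "b (k \<star> y)" and ?b' = "b (k \<star> h \<star> y)"
    have h': "h \<in> carrier G" using h U one_nhd_carrier by blast
    have "cmod (?f' * cnj ?b' - ?f * cnj ?b) = cmod ((?f' - ?f) * cnj ?b' + ?f * cnj (?b' - ?b))"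
      by (simp add: algebra_simps)
    also have "\<dots> \<le> cmod (?f' - ?f) * cmod ?b' + cmod ?f * cmod (?b' - ?b)"
      by (rule norm_triangle_le) (simp add: norm_mult del: complex_cnj_diff)
    also have "\<dots> \<le> (e/(2*B)) * B + A * (e/(2*A))"
      using U(2)[of k g x] V(2)[of k h y] A B orbit g h h' x y e
      by (intro add_mono mult_mono) (auto simp: act_closed less_imp_le)
    also have "\<dots> = e" using A B by simp
    finally show ?case .
  next
    case (midpoint K L)
    have "cmod ((K (g \<star> x) (h \<star> y) + L (g \<star> x) (h \<star> y)) / 2 - (K x y + L x y) / 2)
      = cmod (((K (g \<star> x) (h \<star> y) - K x y) + (L (g \<star> x) (h \<star> y) - L x y)) / 2)"
      by (rule arg_cong[of _ _ cmod]) (simp add: field_simps)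
    also have "\<dots> = cmod ((K (g \<star> x) (h \<star> y) - K x y) + (L (g \<star> x) (h \<star> y) - L x y)) / 2"
      by (simp add: norm_divide)
    also have "\<dots> \<le> (e + e) / 2"
      using norm_triangle_mono[OF midpoint.IH] by (intro divide_right_mono) auto
    finally show ?case by simp
  qed
  then show thesis using that[OF one_nhd_Int[OF U(1) V(1)]] by blast
qed

lemma hull_kernel:
  assumes f: "cts f" and b: "cts b" and K: "K \<in> orbit_hull f b"
  shows "kernel K"
  unfolding kernel_def
proof (intro conjI allI impI)
  show "\<exists>B. \<forall>x\<in>X. \<forall>y\<in>X. cmod (K x y) \<le> B"
    using K
  proof induction
    case (orbit k)
    obtain A where A: "A > 0" "\<And>x. x \<in> X \<Longrightarrow> cmod (f x) \<le> A" using cts_bounded[OF f] by metis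
    obtain B where B: "B > 0" "\<And>x. x \<in> X \<Longrightarrow> cmod (b x) \<le> B" using cts_bounded[OF b] by metis
    have "cmod (f (k \<star> x) * cnj (b (k \<star> y))) \<le> A * B" if "x \<in> X" "y \<in> X" for x y
      using A B that orbit by (auto simp: norm_mult act_closed intro!: mult_mono)
    then show ?case by blast
  next
    case (midpoint K L)
    then obtain A B where *: "\<forall>x\<in>X. \<forall>y\<in>X. cmod (K x y) \<le> A"
      "\<forall>x\<in>X. \<forall>y\<in>X. cmod (L x y) \<le> B" by blast
    have "cmod ((K x y + L x y) / 2) \<le> (A + B) / 2" if "x \<in> X" "y \<in> X" for x y
      using * that by (auto simp: norm_divide intro!: divide_right_mono norm_triangle_mono)
    then show ?case by blast
  qed
  fix e :: real assume "e > 0"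
  then show "\<exists>U. one_nhd U \<and> (\<forall>g\<in>U. \<forall>h\<in>U. \<forall>x\<in>X. \<forall>y\<in>X.
        cmod (K (g \<star> x) (h \<star> y) - K x y) \<le> e)"
    using hull_equicontinuous[OF f b] K by metis
qed

lemma kernel_uniform_limit:
  assumes "\<And>e. e > 0 \<Longrightarrow> \<exists>L. kernel L \<and> (\<forall>x\<in>X. \<forall>y\<in>X. cmod (K x y - L x y) \<le> e)"
  shows "kernel K"
  unfolding kernel_def
proof (intro conjI allI impI)
  obtain L where L: "kernel L" "\<forall>x\<in>X. \<forall>y\<in>X. cmod (K x y - L x y) \<le> 1"
    using assms[of 1] by auto
  obtain B where B: "\<And>x y. \<lbrakk>x \<in> X; y \<in> X\<rbrakk> \<Longrightarrow> cmod (L x y) \<le> B" using kernel_bound[OF L(1)] by metis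
  have "cmod (K x y) \<le> B + 1" if "x \<in> X" "y \<in> X" for x y
    using L(2) B that norm_triangle_ineq2[of "K x y" "L x y"] by fastforce
  then show "\<exists>B. \<forall>x\<in>X. \<forall>y\<in>X. cmod (K x y) \<le> B" by blast
  fix e :: real assume e: "e > 0"
  then obtain L where L: "kernel L" "\<forall>x\<in>X. \<forall>y\<in>X. cmod (K x y - L x y) \<le> e/3"
    using assms[of "e/3"] by auto
  obtain U where U: "one_nhd U" "\<And>g h x y. \<lbrakk>g \<in> U; h \<in> U; x \<in> X; y \<in> X\<rbrakk> \<Longrightarrow> cmod (L (g \<star> x) (h \<star> y) - L x y) \<le> e/3"
    using kernel_modulus[OF L(1), of "e/3"] e by auto
  have "cmod (K (g \<star> x) (h \<star> y) - K x y) \<le> e" if "g \<in> U" "h \<in> U" "x \<in> X" "y \<in> X" for g h x y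
  proof -
    let ?K = "K (g \<star> x) (h \<star> y)" and ?L = "L (g \<star> x) (h \<star> y)"
    have "cmod (?K - ?L) \<le> e/3" "cmod (K x y - L x y) \<le> e/3"
      using L(2) that one_nhd_carrier[OF U(1)] act_closed by blast+
    moreover have "cmod (?L - L x y) \<le> e/3" using U that by blast
    moreover have "cmod (?K - K x y) = cmod (((?K - ?L) + (?L - L x y)) - (K x y - L x y))" by simp
    ultimately show ?thesis
      using norm_triangle_ineq4[of "(?K - ?L) + (?L - L x y)" "K x y - L x y"]
        norm_triangle_ineq[of "?K - ?L" "?L - L x y"] by linarith
  qed
  then show "\<exists>U. one_nhd U \<and> (\<forall>g\<in>U. \<forall>h\<in>U. \<forall>x\<in>X. \<forall>y\<in>X.
        cmod (K (g \<star> x) (h \<star> y) - K x y) \<le> e)" using U(1) by blast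
qed

text \<open>
  The parallelogram law: if two kernels nearly minimise the Hilbert-Schmidt norm on the hull, then
  their midpoint cannot be much shorter, so their difference is short.
\<close>

lemma near_minimal_imp_close:
  assumes f: "cts f" and b: "cts b" and e: "e > 0"
  obtains \<eta> where "\<eta> > 0" "\<And>K L x y. \<lbrakk>K \<in> orbit_hull f b; L \<in> orbit_hull f b; hs_sq K < Inf (hs_sq ` orbit_hull f b) + \<eta>; hs_sq L < Inf (hs_sq ` orbit_hull f b) + \<eta>;
    x \<in> X; y \<in> X\<rbrakk> \<Longrightarrow> cmod (K x y - L x y) < e"
proof -
  obtain U where U: "one_nhd U" "\<And>K g h x y. \<lbrakk>K \<in> orbit_hull f b; g \<in> U; h \<in> U; x \<in> X; y \<in> X\<rbrakk>
    \<Longrightarrow> cmod (K (g \<star> x) (h \<star> y) - K x y) \<le> e/4"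
    using hull_equicontinuous[OF f b, of "e/4"] e by auto
  obtain \<eta> where \<eta>: "\<eta> > 0" "\<And>D x y. \<lbrakk>kernel D;
     \<And>g h x y. \<lbrakk>g \<in> U; h \<in> U; x \<in> X; y \<in> X\<rbrakk> \<Longrightarrow> cmod (D (g \<star> x) (h \<star> y) - D x y) \<le> e/2;
     hs_sq D < \<eta>; x \<in> X; y \<in> X\<rbrakk> \<Longrightarrow> cmod (D x y) < e"
    using hs_sq_small_imp_small[OF U(1) e] by metis
  show thesis
  proof (rule that)
    show "\<eta> / 4 > 0" using \<eta> by simp
    fix K L x y assume K: "K \<in> orbit_hull f b" and L: "L \<in> orbit_hull f b"
      and hs_sq: "hs_sq K < Inf (hs_sq ` orbit_hull f b) + \<eta> / 4" "hs_sq L < Inf (hs_sq ` orbit_hull f b) + \<eta> / 4"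
      and xy: "x \<in> X" "y \<in> X"
    have k: "kernel K" "kernel L" using hull_kernel f b K L by blast+
    have KL: "(\<lambda>x y. (K x y + L x y) / 2) \<in> orbit_hull f b" by (rule orbit_hull.midpoint[OF K L])
    have "Inf (hs_sq ` orbit_hull f b) \<le> hs_sq (\<lambda>x y. (K x y + L x y) / 2)"
      using KL hs_sq_nonneg by (intro cInf_lower imageI bdd_belowI[of _ 0]) auto
    then have "hs_sq (\<lambda>x y. K x y - L x y) < \<eta>"
      using hs_sq hs_sq_parallelogram[OF k hull_kernel[OF f b KL]] by simp
    moreover have "cmod ((K (g \<star> x) (h \<star> y) - L (g \<star> x) (h \<star> y)) - (K x y - L x y)) \<le> e/2"
      if "g \<in> U" "h \<in> U" "x \<in> X" "y \<in> X" for g h x y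
    proof -
      have "cmod (K (g \<star> x) (h \<star> y) - L (g \<star> x) (h \<star> y) - (K x y - L x y))
      = cmod ((K (g \<star> x) (h \<star> y) - K x y) - (L (g \<star> x) (h \<star> y) - L x y))"
      by (simp add: algebra_simps)
      then show ?thesis
        using U(2)[OF K that] U(2)[OF L that]
          norm_triangle_ineq4[of "K (g \<star> x) (h \<star> y) - K x y" "L (g \<star> x) (h \<star> y) - L x y"] by linarith
    qed
    ultimately show "cmod (K x y - L x y) < e"
      using \<eta>(2)[of "\<lambda>x y. K x y - L x y" x y] kernel_diff[OF k] xy by blast
  qed
qed

text \<open>
  The unique point of minimal norm in the closed convex hull of an orbit is fixed by the group.
  Here the limit \<open>K\<close> of a minimising sequence is invariant because translating the sequence
  gives another minimising sequence in the hull, which must stay close to the first.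
\<close>

theorem invariant_kernel_in_closed_hull:
  assumes f: "cts f" and b: "cts b"
  obtains K where "kernel K"
    "\<And>g x y. \<lbrakk>g \<in> carrier G; x \<in> X; y \<in> X\<rbrakk> \<Longrightarrow> K (g \<star> x) (g \<star> y) = K x y"
    "\<And>e. e > 0 \<Longrightarrow> \<exists>L\<in>orbit_hull f b. \<forall>x\<in>X. \<forall>y\<in>X. cmod (K x y - L x y) \<le> e"
proof -
  define m where "m = Inf (hs_sq ` orbit_hull f b)"
  have ne: "orbit_hull f b \<noteq> {}" using orbit_hull.orbit one_closed by blast
  have "\<exists>L\<in>orbit_hull f b. hs_sq L < m + 1 / Suc n" for n
    using ne hs_sq_nonneg cInf_lessD[of "hs_sq ` orbit_hull f b" "m + 1 / Suc n"] unfolding m_def by auto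
  then obtain \<kappa> where \<kappa>: "\<And>n. \<kappa> n \<in> orbit_hull f b" "\<And>n. hs_sq (\<kappa> n) < m + 1 / Suc n" by metis
  have tail: "\<exists>N. \<forall>n\<ge>N. hs_sq (\<kappa> n) < m + \<eta>" if "\<eta> > 0" for \<eta>
  proof -
    obtain N where N: "1 / Suc N < \<eta>" using reals_Archimedean[OF \<open>\<eta> > 0\<close>] by (auto simp: inverse_eq_divide)
    have "hs_sq (\<kappa> n) < m + \<eta>" if "n \<ge> N" for n
    proof -
      have "1 / Suc n \<le> 1 / Suc N" using that by (simp add: field_simps)
      then show ?thesis using \<kappa>(2)[of n] N by linarith
    qed
    then show ?thesis by blast
  qed
  have uC: "\<exists>N. \<forall>n\<ge>N. \<forall>n'\<ge>N. \<forall>x\<in>X. \<forall>y\<in>X. cmod (\<kappa> n x y - \<kappa> n' x y) < e" if e: "e > 0" for e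
  proof -
    obtain \<eta> where \<eta>: "\<eta> > 0" "\<And>K L x y. \<lbrakk>K \<in> orbit_hull f b; L \<in> orbit_hull f b; hs_sq K < m + \<eta>; hs_sq L < m + \<eta>;
      x \<in> X; y \<in> X\<rbrakk> \<Longrightarrow> cmod (K x y - L x y) < e"
      using near_minimal_imp_close[OF f b e] m_def by metis
    then show ?thesis using tail[OF \<eta>(1)] \<kappa>(1) by metis
  qed
  define K where "K = (\<lambda>x y. lim (\<lambda>n. \<kappa> n x y))"
  have lim: "(\<lambda>n. \<kappa> n x y) \<longlonglongrightarrow> K x y" if "x \<in> X" "y \<in> X" for x y
  proof -
    have "Cauchy (\<lambda>n. \<kappa> n x y)"
      unfolding Cauchy_def dist_norm using uC that by meson
    then show ?thesis unfolding K_def using Cauchy_convergent convergent_LIMSEQ_iff by blast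
  qed
  have close: "\<exists>N. \<forall>n\<ge>N. \<forall>x\<in>X. \<forall>y\<in>X. cmod (K x y - \<kappa> n x y) \<le> e" if e: "e > 0" for e
  proof -
    obtain N where N: "\<forall>n\<ge>N. \<forall>n'\<ge>N. \<forall>x\<in>X. \<forall>y\<in>X. cmod (\<kappa> n x y - \<kappa> n' x y) < e"
      using uC[OF e] by blast
    have "cmod (K x y - \<kappa> n x y) \<le> e" if "n \<ge> N" "x \<in> X" "y \<in> X" for n x y
    proof (rule LIMSEQ_le_const2)
      show "(\<lambda>n'. cmod (\<kappa> n' x y - \<kappa> n x y)) \<longlonglongrightarrow> cmod (K x y - \<kappa> n x y)"
        using lim that by (intro tendsto_intros) auto
      show "\<exists>N. \<forall>n'\<ge>N. cmod (\<kappa> n' x y - \<kappa> n x y) \<le> e" using N that less_imp_le by metis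
    qed
    then show ?thesis by blast
  qed
  have approx: "\<exists>L\<in>orbit_hull f b. \<forall>x\<in>X. \<forall>y\<in>X. cmod (K x y - L x y) \<le> e" if "e > 0" for e
    using close[OF that] \<kappa>(1) by blast
  show thesis
  proof (rule that)
    show "kernel K" using approx hull_kernel[OF f b] by (intro kernel_uniform_limit) blast
    show "\<exists>L\<in>orbit_hull f b. \<forall>x\<in>X. \<forall>y\<in>X. cmod (K x y - L x y) \<le> e" if "e > 0" for e
      using approx that .
    fix g x y assume g: "g \<in> carrier G" and x: "x \<in> X" and y: "y \<in> X"
    have "(\<lambda>n. \<kappa> n (g \<star> x) (g \<star> y) - \<kappa> n x y) \<longlonglongrightarrow> 0"
    proof (rule LIMSEQ_I)
      fix e :: real assume e: "e > 0"
      obtain \<eta> where \<eta>: "\<eta> > 0" "\<And>K L x y. \<lbrakk>K \<in> orbit_hull f b; L \<in> orbit_hull f b; hs_sq K < m + \<eta>; hs_sq L < m + \<eta>;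
        x \<in> X; y \<in> X\<rbrakk> \<Longrightarrow> cmod (K x y - L x y) < e"
        using near_minimal_imp_close[OF f b e] m_def by metis
      obtain N where N: "\<forall>n\<ge>N. hs_sq (\<kappa> n) < m + \<eta>" using tail[OF \<eta>(1)] by blast
      have "cmod (\<kappa> n (g \<star> x) (g \<star> y) - \<kappa> n x y) < e" if n: "n \<ge> N" for n
      proof -
        obtain L where L: "L \<in> orbit_hull f b"
          "\<And>x y. \<lbrakk>x \<in> X; y \<in> X\<rbrakk> \<Longrightarrow> L x y = \<kappa> n (g \<star> x) (g \<star> y)"
          using hull_translate[OF \<kappa>(1) g] by metis
        have "hs_sq L = hs_sq (\<kappa> n)"
          using hs_sq_cong[OF L(2)] hs_sq_invariant[OF g hull_kernel[OF f b \<kappa>(1)]] by simp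
        then show ?thesis using \<eta>(2)[OF L(1) \<kappa>(1)[of n] _ _ x y] N n L(2)[OF x y] by simp
      qed
      then show "\<exists>N. \<forall>n\<ge>N. cmod (\<kappa> n (g \<star> x) (g \<star> y) - \<kappa> n x y - 0) < e" by auto
    qed
    moreover have "(\<lambda>n. \<kappa> n (g \<star> x) (g \<star> y) - \<kappa> n x y) \<longlonglongrightarrow> K (g \<star> x) (g \<star> y) - K x y"
      by (intro tendsto_diff lim x y act_closed g)
    ultimately show "K (g \<star> x) (g \<star> y) = K x y"
      using LIMSEQ_unique by fastforce
  qed
qed

section \<open>Equivariant operators and their kernels\<close>

definition kernel_op :: "('x \<Rightarrow> 'x \<Rightarrow> complex) \<Rightarrow> ('x \<Rightarrow> complex) \<Rightarrow> 'x \<Rightarrow> complex" where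
  "kernel_op K u x = mean (\<lambda>y. K x y * u y)"

text \<open>
  The bound of the supremum norm by the \<open>L\<^sup>2\<close> norm is what makes the eigenspaces of
  nonzero eigenvalues finite-dimensional. All conditions concern values on \<open>M\<close> only.
\<close>

definition equivariant_op :: "(('x \<Rightarrow> complex) \<Rightarrow> 'x \<Rightarrow> complex) \<Rightarrow> bool" where
  "equivariant_op S \<longleftrightarrow> (\<forall>u. cts u \<longrightarrow> cts (S u)) \<and>
     (\<forall>u v c. \<forall>x\<in>X. cts u \<longrightarrow> cts v \<longrightarrow> S (\<lambda>x. u x + c * v x) x = S u x + c * S v x) \<and>
     (\<exists>C>0. \<forall>u. \<forall>x\<in>X. cts u \<longrightarrow> cmod (S u x) \<le> C * sqrt (sqnorm u)) \<and>
     (\<forall>g\<in>carrier G. \<forall>u. \<forall>x\<in>X. cts u \<longrightarrow> S (\<lambda>y. u (g \<star> y)) x = S u (g \<star> x))"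

definition symmetric_op :: "(('x \<Rightarrow> complex) \<Rightarrow> 'x \<Rightarrow> complex) \<Rightarrow> bool" where
  "symmetric_op S \<longleftrightarrow> (\<forall>u v. cts u \<longrightarrow> cts v \<longrightarrow>
     ip (S u) v = ip u (S v))"

definition positive_op :: "(('x \<Rightarrow> complex) \<Rightarrow> 'x \<Rightarrow> complex) \<Rightarrow> bool" where
  "positive_op S \<longleftrightarrow> (\<forall>u. cts u \<longrightarrow> 0 \<le> Re (ip (S u) u))"

definition L2_ball :: "('x \<Rightarrow> complex) set" where
  "L2_ball = {u. cts u \<and> sqnorm u \<le> 1}"

text \<open>
  Total boundedness of the image of the \<open>L\<^sup>2\<close> unit ball in the supremum norm, stated by
  a finite cover of the ball itself. In this form it is stable under midpoints (intersect two
  covers) and under uniform limits (keep the cover).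
\<close>

definition compact_op :: "(('x \<Rightarrow> complex) \<Rightarrow> 'x \<Rightarrow> complex) \<Rightarrow> bool" where
  "compact_op S \<longleftrightarrow> (\<forall>e>0. \<exists>P. finite P \<and> L2_ball = \<Union>P \<and>
     (\<forall>A\<in>P. \<forall>u\<in>A. \<forall>v\<in>A. \<forall>x\<in>X. cmod (S u x - S v x) \<le> e))"

text \<open>
  Uniformly closed invariant subspaces of \<open>C(M)\<close>, where functions may take any values off
  \<open>M\<close>. The closure condition with \<open>e\<close> arbitrary also makes membership depend only on
  the values on \<open>M\<close>.
\<close>

definition closed_invariant :: "('x \<Rightarrow> complex) set \<Rightarrow> bool" where
  "closed_invariant E \<longleftrightarrow> (\<forall>u\<in>E. cts u) \<and> (\<lambda>_. 0) \<in> E \<and>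
     (\<forall>u\<in>E. \<forall>v\<in>E. \<forall>c. (\<lambda>x. u x + c * v x) \<in> E) \<and>
     (\<forall>u\<in>E. \<forall>g\<in>carrier G. (\<lambda>x. u (g \<star> x)) \<in> E) \<and>
     (\<forall>u. (\<forall>e>0. \<exists>v\<in>E. \<forall>x\<in>X. cmod (u x - v x) \<le> e) \<longrightarrow> u \<in> E)"

lemma equivariant_op_bound:
  assumes "equivariant_op S"
  obtains C where "C > 0" "\<And>u x. \<lbrakk>cts u; x \<in> X\<rbrakk> \<Longrightarrow> cmod (S u x) \<le> C * sqrt (sqnorm u)"
proof -
  have "\<exists>C>0. \<forall>u. \<forall>x\<in>X. cts u \<longrightarrow> cmod (S u x) \<le> C * sqrt (sqnorm u)"
    using assms unfolding equivariant_op_def by (elim conjE)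
  then show thesis using that by meson
qed

lemma compact_opE:
  assumes "compact_op S" "e > 0"
  obtains P where "finite P" "L2_ball = \<Union>P"
    "\<And>A u v x. \<lbrakk>A \<in> P; u \<in> A; v \<in> A; x \<in> X\<rbrakk> \<Longrightarrow> cmod (S u x - S v x) \<le> e"
  using assms unfolding compact_op_def by meson

lemma equivariant_op_linear:
  assumes "equivariant_op S" "cts u" "cts v" "x \<in> X"
  shows "S (\<lambda>x. u x + c * v x) x = S u x + c * S v x"
  using assms(1) unfolding equivariant_op_def by (elim conjE) (simp add: assms(2-4))

lemma equivariant_op_cts: "equivariant_op S \<Longrightarrow> cts u \<Longrightarrow> cts (S u)"
  unfolding equivariant_op_def by (elim conjE) simp

lemma equivariant_op_act:
  "\<lbrakk>equivariant_op S; cts u; g \<in> carrier G; x \<in> X\<rbrakk> \<Longrightarrow> S (\<lambda>y. u (g \<star> y)) x = S u (g \<star> x)"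
  unfolding equivariant_op_def by (elim conjE) simp

lemma sqnorm_cmult: "sqnorm (\<lambda>x. c * u x) = (cmod c)\<^sup>2 * sqnorm u"
proof -
  have "mean (\<lambda>x. (c * u x) * cnj (c * u x)) = (c * cnj c) * ip u u"
    unfolding mean_cmult[symmetric] by (simp add: algebra_simps)
  also have "\<dots> = of_real ((cmod c)\<^sup>2 * sqnorm u)"
    by (simp only: mean_self complex_norm_square of_real_mult)
  finally show ?thesis unfolding sqnorm_def[of "\<lambda>x. c * u x"] by simp
qed

lemma equivariant_op_diff:
  assumes S: "equivariant_op S" and u: "cts u" and v: "cts v" and x: "x \<in> X"
  shows "S (\<lambda>x. u x - v x) x = S u x - S v x"
  using equivariant_op_linear[OF S u v x, of "-1"] by simp

lemma equivariant_op_zero: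
  assumes S: "equivariant_op S" and x: "x \<in> X"
  shows "S (\<lambda>x. 0) x = 0"
  using equivariant_op_diff[OF S _ _ x, of "\<lambda>_. 0" "\<lambda>_. 0"] by simp

lemma equivariant_op_cmult:
  assumes S: "equivariant_op S" and u: "cts u" and x: "x \<in> X"
  shows "S (\<lambda>x. c * u x) x = c * S u x"
  using equivariant_op_linear[OF S _ u x, of "\<lambda>_. 0" c] equivariant_op_zero[OF S x] by simp

lemma equivariant_op_sup_bound:
  assumes "equivariant_op S"
  obtains C where "C > 0" "\<And>u v x e. \<lbrakk>cts u; cts v; \<And>y. y \<in> X \<Longrightarrow> cmod (u y - v y) \<le> e; x \<in> X\<rbrakk>
     \<Longrightarrow> cmod (S u x - S v x) \<le> C * e"
proof -
  obtain C where C: "C > 0" "\<And>u x. \<lbrakk>cts u; x \<in> X\<rbrakk> \<Longrightarrow> cmod (S u x) \<le> C * sqrt (sqnorm u)"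
    using equivariant_op_bound[OF assms] by metis
  show thesis
  proof (rule that[OF C(1)])
    fix u v x e assume u: "cts u" and v: "cts v" and e: "\<And>y. y \<in> X \<Longrightarrow> cmod (u y - v y) \<le> e"
      and x: "x \<in> X"
    have "0 \<le> e" using e[OF x] norm_ge_zero order_trans by blast
    moreover have "sqnorm (\<lambda>x. u x - v x) \<le> e\<^sup>2" by (rule sqnorm_bound) (rule e)
    ultimately have "sqrt (sqnorm (\<lambda>x. u x - v x)) \<le> e" by (simp add: real_le_lsqrt sqnorm_nonneg)
    then have "C * sqrt (sqnorm (\<lambda>x. u x - v x)) \<le> C * e" using C by simp
    moreover have "cmod (S (\<lambda>x. u x - v x) x) \<le> C * sqrt (sqnorm (\<lambda>x. u x - v x))"
      by (rule C(2)[OF cts_diff[OF u v] x])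
    ultimately show "cmod (S u x - S v x) \<le> C * e"
      using equivariant_op_diff[OF assms u v x] by simp
  qed
qed

lemma equivariant_op_cong:
  assumes S: "equivariant_op S" and u: "cts u" and v: "cts v"
    and "\<And>x. x \<in> X \<Longrightarrow> u x = v x" and x: "x \<in> X"
  shows "S u x = S v x"
proof -
  obtain C where "\<And>u v x e. \<lbrakk>cts u; cts v; \<And>y. y \<in> X \<Longrightarrow> cmod (u y - v y) \<le> e; x \<in> X\<rbrakk>
     \<Longrightarrow> cmod (S u x - S v x) \<le> C * e"
    using equivariant_op_sup_bound[OF S] by metis
  from this[OF u v _ x, of 0] show ?thesis using assms(4) by simp
qed

lemma equivariant_op_comp:
  assumes R: "equivariant_op R" and S: "equivariant_op S"
  shows "equivariant_op (\<lambda>u. R (S u))"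
  unfolding equivariant_op_def
proof (intro conjI allI ballI impI)
  fix u assume u: "cts u"
  show "cts (R (S u))" using u R S equivariant_op_cts by blast
next
  fix u v c x assume u: "cts u" and v: "cts v" and x: "x \<in> X"
  have "R (S (\<lambda>x. u x + c * v x)) x = R (\<lambda>x. S u x + c * S v x) x"
  proof (rule equivariant_op_cong[OF R _ _ _ x])
    show "cts (S (\<lambda>x. u x + c * v x))" "cts (\<lambda>x. S u x + c * S v x)"
      by (intro equivariant_op_cts[OF S] cts_add cts_mult cts_const u v)+
  qed (rule equivariant_op_linear[OF S u v])
  also have "\<dots> = R (S u) x + c * R (S v) x"
    by (rule equivariant_op_linear[OF R _ _ x]) (use u v S equivariant_op_cts in auto)
  finally show "R (S (\<lambda>x. u x + c * v x)) x = R (S u) x + c * R (S v) x" .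
next
  fix g u x assume g: "g \<in> carrier G" and u: "cts u" and x: "x \<in> X"
  have "R (S (\<lambda>y. u (g \<star> y))) x = R (\<lambda>x. S u (g \<star> x)) x"
    by (rule equivariant_op_cong[OF R _ _ _ x])
      (use u g S equivariant_op_act equivariant_op_cts cts_act in auto)
  then show "R (S (\<lambda>y. u (g \<star> y))) x = R (S u) (g \<star> x)"
    using equivariant_op_act[OF R equivariant_op_cts[OF S u] g x] by simp
next
  obtain C where C: "C > 0" "\<And>u x. \<lbrakk>cts u; x \<in> X\<rbrakk> \<Longrightarrow> cmod (S u x) \<le> C * sqrt (sqnorm u)"
    using equivariant_op_bound[OF S] by metis
  obtain D where D: "D > 0" "\<And>u v x e. \<lbrakk>cts u; cts v; \<And>y. y \<in> X \<Longrightarrow> cmod (u y - v y) \<le> e; x \<in> X\<rbrakk>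
     \<Longrightarrow> cmod (R u x - R v x) \<le> D * e"
    using equivariant_op_sup_bound[OF R] by metis
  have "cmod (R (S u) x) \<le> (D * C) * sqrt (sqnorm u)" if u: "cts u" and x: "x \<in> X" for u x
    using D(2)[OF equivariant_op_cts[OF S u] cts_const, of 0 "C * sqrt (sqnorm u)" x] C(2)[OF u] x
      equivariant_op_zero[OF R x] by (simp add: mult.assoc)
  then show "\<exists>C>0. \<forall>u. \<forall>x\<in>X. cts u \<longrightarrow> cmod (R (S u) x) \<le> C * sqrt (sqnorm u)"
    using C D by (intro exI[of _ "D * C"]) auto
qed

lemma compact_op_comp:
  assumes R: "equivariant_op R" and S: "equivariant_op S" "compact_op S"
  shows "compact_op (\<lambda>u. R (S u))"
  unfolding compact_op_def
proof (intro allI impI)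
  fix e :: real assume e: "e > 0"
  obtain D where D: "D > 0" "\<And>u v x e. \<lbrakk>cts u; cts v; \<And>y. y \<in> X \<Longrightarrow> cmod (u y - v y) \<le> e; x \<in> X\<rbrakk>
     \<Longrightarrow> cmod (R u x - R v x) \<le> D * e"
    using equivariant_op_sup_bound[OF R] by metis
  have "e / D > 0" using e D by simp
  then obtain P where P: "finite P" "L2_ball = \<Union>P"
     "\<And>A u v x. \<lbrakk>A \<in> P; u \<in> A; v \<in> A; x \<in> X\<rbrakk> \<Longrightarrow> cmod (S u x - S v x) \<le> e / D"
    using compact_opE[OF S(2)] by metis
  have "cmod (R (S u) x - R (S v) x) \<le> e" if "A \<in> P" "u \<in> A" "v \<in> A" "x \<in> X" for A u v x
  proof -
    have "cts u" "cts v" using that P(2) by (auto simp: L2_ball_def)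
    then have "cmod (R (S u) x - R (S v) x) \<le> D * (e / D)"
      using that P(3) by (intro D(2) equivariant_op_cts[OF S(1)]) auto
    then show ?thesis using D by simp
  qed
  then show "\<exists>P. finite P \<and> L2_ball = \<Union>P \<and>
     (\<forall>A\<in>P. \<forall>u\<in>A. \<forall>v\<in>A. \<forall>x\<in>X. cmod (R (S u) x - R (S v) x) \<le> e)"
    using P(1,2) by (intro exI[of _ P] conjI ballI)
qed

lemma kernel_op_bound:
  assumes "cts (K x)" "cts u" "\<And>y. y \<in> X \<Longrightarrow> cmod (K x y) \<le> B"
  shows "cmod (kernel_op K u x) \<le> B * sqrt (sqnorm u)"
proof -
  obtain y where "y \<in> X" using topspace_M_nonempty by blast
  then have B: "0 \<le> B" using assms(3) norm_ge_zero order_trans by blast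
  have "(cmod (kernel_op K u x))\<^sup>2 \<le> sqnorm (K x) * sqnorm (\<lambda>y. cnj (u y))"
    using Cauchy_Schwarz[OF assms(1) cts_cnj[OF assms(2)]] by (simp add: kernel_op_def)
  also have "sqnorm (\<lambda>y. cnj (u y)) = sqnorm u" unfolding sqnorm_def by (simp add: mult.commute)
  also have "sqnorm (K x) * sqnorm u \<le> B\<^sup>2 * sqnorm u"
    using sqnorm_bound[of "K x" B] assms(3) by (intro mult_right_mono sqnorm_nonneg) auto
  also have "\<dots> = (B * sqrt (sqnorm u))\<^sup>2" by (simp add: power_mult_distrib sqnorm_nonneg)
  finally show ?thesis by (rule power2_le_imp_le) (simp add: B sqnorm_nonneg)
qed

lemma kernel_op_close:
  assumes K: "kernel K" and L: "kernel L" and u: "cts u" and x: "x \<in> X"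
    and "\<And>y. y \<in> X \<Longrightarrow> cmod (K x y - L x y) \<le> e"
  shows "cmod (kernel_op K u x - kernel_op L u x) \<le> e * sqrt (sqnorm u)"
proof -
  have "kernel_op K u x - kernel_op L u x = mean (\<lambda>y. K x y * u y - L x y * u y)"
    unfolding kernel_op_def
    by (rule mean_diff[symmetric]) (intro cts_mult kernel_cts_left K L u x)+
  also have "\<dots> = kernel_op (\<lambda>x y. K x y - L x y) u x"
    unfolding kernel_op_def by (simp add: left_diff_distrib)
  finally show ?thesis
    using kernel_op_bound[of "\<lambda>x y. K x y - L x y" x u e, OF kernel_cts_left[OF kernel_diff[OF K L] x] u]
      assms(5) by simp
qed

lemma equivariant_kernel_op:
  assumes K: "kernel K" and inv: "\<And>g x y. \<lbrakk>g \<in> carrier G; x \<in> X; y \<in> X\<rbrakk> \<Longrightarrow> K (g \<star> x) (g \<star> y) = K x y"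
  shows "equivariant_op (kernel_op K)"
  unfolding equivariant_op_def
proof (intro conjI allI ballI impI)
  fix u assume "cts u" then show "cts (kernel_op K u)"
    unfolding kernel_op_def by (rule kernel_apply_cts[OF K])
next
  fix u v c x assume *: "cts u" "cts v" "x \<in> X"
  have "kernel_op K (\<lambda>x. u x + c * v x) x = mean (\<lambda>y. K x y * u y + c * (K x y * v y))"
    unfolding kernel_op_def by (simp add: algebra_simps)
  also have "\<dots> = kernel_op K u x + c * kernel_op K v x"
    unfolding kernel_op_def mean_cmult[symmetric]
    by (rule mean_add) (intro cts_mult cts_const kernel_cts_left[OF K] *)+
  finally show "kernel_op K (\<lambda>x. u x + c * v x) x = kernel_op K u x + c * kernel_op K v x" .
next
  obtain B where "B > 0" "\<And>x y. \<lbrakk>x \<in> X; y \<in> X\<rbrakk> \<Longrightarrow> cmod (K x y) \<le> B"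
    using kernel_bound[OF K] by metis
  then show "\<exists>C>0. \<forall>u. \<forall>x\<in>X. cts u \<longrightarrow> cmod (kernel_op K u x) \<le> C * sqrt (sqnorm u)"
    using kernel_op_bound kernel_cts_left[OF K] by meson
next
  fix g u x assume *: "g \<in> carrier G" "cts u" "x \<in> X"
  have "kernel_op K (\<lambda>y. u (g \<star> y)) x = mean (\<lambda>y. K (g \<star> x) (g \<star> y) * u (g \<star> y))"
    unfolding kernel_op_def by (rule mean_cong) (simp add: inv *)
  also have "\<dots> = kernel_op K u (g \<star> x)"
    unfolding kernel_op_def
    by (rule mean_act[OF *(1), of "\<lambda>y. K (g \<star> x) y * u y"]) (intro cts_mult kernel_cts_left[OF K] act_closed *)
  finally show "kernel_op K (\<lambda>y. u (g \<star> y)) x = kernel_op K u (g \<star> x)" .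
qed

lemma kernel_op_orbit:
  "kernel_op (\<lambda>x y. f (g \<star> x) * cnj (b (g \<star> y))) u x = f (g \<star> x) * mean (\<lambda>y. u y * cnj (b (g \<star> y)))"
  unfolding kernel_op_def mean_cmult[symmetric] by (simp add: mult_ac)

lemma kernel_op_midpoint:
  assumes "K \<in> orbit_hull f b" "L \<in> orbit_hull f b" "cts f" "cts b" "cts u"
  shows "kernel_op (\<lambda>x y. (K x y + L x y) / 2) u x = (1/2) * (kernel_op K u x + kernel_op L u x)"
proof -
  have "mean (\<lambda>y. (K x y + L x y) / 2 * u y) = (1/2) * mean (\<lambda>y. K x y * u y + L x y * u y)"
    unfolding mean_cmult[symmetric] by (simp add: algebra_simps add_divide_distrib)
  also have "mean (\<lambda>y. K x y * u y + L x y * u y) = mean (\<lambda>y. K x y * u y) + mean (\<lambda>y. L x y * u y)"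
    by (rule mean_add) (intro cts_mult hull_cts(1)[OF _ assms(3,4)] assms)+
  finally show ?thesis unfolding kernel_op_def .
qed

lemma hull_op_cts:
  assumes "L \<in> orbit_hull f b" "cts f" "cts b" "cts u"
  shows "cts (kernel_op L u)"
  unfolding kernel_op_def by (rule kernel_apply_cts[OF hull_kernel]) (use assms in auto)

lemma hull_op_symmetric:
  assumes L: "L \<in> orbit_hull f f" and f: "cts f" and u: "cts u" and v: "cts v"
  shows "ip (kernel_op L u) v = ip u (kernel_op L v)"
  using L
proof induction
  case (orbit g)
  have "mean (\<lambda>x. kernel_op (\<lambda>x y. f (g \<star> x) * cnj (f (g \<star> y))) u x * cnj (v x))
    = mean (\<lambda>x. mean (\<lambda>y. u y * cnj (f (g \<star> y))) * (f (g \<star> x) * cnj (v x)))"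
    by (simp only: kernel_op_orbit mult_ac)
  also have "\<dots> = mean (\<lambda>y. u y * cnj (f (g \<star> y))) * mean (\<lambda>x. f (g \<star> x) * cnj (v x))"
    by (rule mean_cmult)
  also have "\<dots> = mean (\<lambda>x. u x * cnj (f (g \<star> x) * mean (\<lambda>y. v y * cnj (f (g \<star> y)))))"
    by (simp add: mean_multc mean_cnj[symmetric] mult_ac flip: mult.assoc)
  finally show ?case unfolding kernel_op_orbit .
next
  case (midpoint K L)
  note c = hull_op_cts[OF _ f f]
  have "mean (\<lambda>x. kernel_op (\<lambda>x y. (K x y + L x y) / 2) u x * cnj (v x))
    = (1/2) * mean (\<lambda>x. kernel_op K u x * cnj (v x) + kernel_op L u x * cnj (v x))"
    unfolding kernel_op_midpoint[OF midpoint.hyps f f u] mean_cmult[symmetric] by (simp add: algebra_simps)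
  also have "mean (\<lambda>x. kernel_op K u x * cnj (v x) + kernel_op L u x * cnj (v x))
    = mean (\<lambda>x. u x * cnj (kernel_op K v x) + u x * cnj (kernel_op L v x))"
    using midpoint by (subst (1 2) mean_add) (auto intro!: cts_mult cts_cnj c u v)
  also have "(1/2) * \<dots> = mean (\<lambda>x. u x * cnj (kernel_op (\<lambda>x y. (K x y + L x y) / 2) v x))"
    unfolding kernel_op_midpoint[OF midpoint.hyps f f v] mean_cmult[symmetric] by (simp add: algebra_simps)
  finally show ?case .
qed

text \<open>
  A single orbit element is the rank one operator of a translate of \<open>f\<close>, with quadratic form
  \<open>|\<langle>u, f(g \<cdot>)\<rangle>|\<^sup>2\<close>.
\<close>

lemma hull_op_quadratic_orbit:
  "mean (\<lambda>x. kernel_op (\<lambda>x y. f (g \<star> x) * cnj (f (g \<star> y))) u x * cnj (u x))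
    = of_real ((cmod (mean (\<lambda>x. u x * cnj (f (g \<star> x)))))\<^sup>2)"
proof -
  have "mean (\<lambda>x. kernel_op (\<lambda>x y. f (g \<star> x) * cnj (f (g \<star> y))) u x * cnj (u x))
    = mean (\<lambda>x. mean (\<lambda>y. u y * cnj (f (g \<star> y))) * (f (g \<star> x) * cnj (u x)))"
    by (simp only: kernel_op_orbit mult_ac)
  also have "\<dots> = mean (\<lambda>y. u y * cnj (f (g \<star> y))) * mean (\<lambda>x. f (g \<star> x) * cnj (u x))"
    by (rule mean_cmult)
  also have "mean (\<lambda>x. f (g \<star> x) * cnj (u x)) = cnj (mean (\<lambda>x. u x * cnj (f (g \<star> x))))"
    by (simp add: mean_cnj[symmetric] mult_ac)
  finally show ?thesis by (simp add: complex_norm_square del: of_real_power)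
qed

lemma hull_op_quadratic_midpoint:
  assumes "K \<in> orbit_hull f f" "L \<in> orbit_hull f f" "cts f" "cts u"
  shows "mean (\<lambda>x. kernel_op (\<lambda>x y. (K x y + L x y) / 2) u x * cnj (u x))
    = (ip (kernel_op K u) u + ip (kernel_op L u) u) / 2"
proof -
  have "mean (\<lambda>x. kernel_op (\<lambda>x y. (K x y + L x y) / 2) u x * cnj (u x))
    = (1/2) * mean (\<lambda>x. kernel_op K u x * cnj (u x) + kernel_op L u x * cnj (u x))"
    unfolding kernel_op_midpoint[OF assms(1,2,3,3,4)] mean_cmult[symmetric] by (simp add: algebra_simps)
  then show ?thesis
    using assms by (subst (asm) mean_add) (auto intro!: cts_mult cts_cnj hull_op_cts[OF _ assms(3,3)])
qed

text \<open>
  A rank one operator sends the unit ball to multiples of one function by scalars from a disc, and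
  the disc is totally bounded.
\<close>

lemma hull_op_compact:
  assumes L: "L \<in> orbit_hull f b" and f: "cts f" and b: "cts b"
  shows "compact_op (kernel_op L)"
  using L
proof induction
  case (orbit g)
  show ?case
    unfolding compact_op_def
  proof (intro allI impI)
    fix e :: real assume e: "e > 0"
    obtain A where A: "A > 0" "\<And>x. x \<in> X \<Longrightarrow> cmod (f x) \<le> A" using cts_bounded[OF f] by metis
    define \<alpha> where "\<alpha> = (\<lambda>u. mean (\<lambda>y. u y * cnj (b (g \<star> y))))"
    define r where "r = sqrt (sqnorm (\<lambda>y. b (g \<star> y)))"
    have \<alpha>: "\<alpha> u \<in> cball 0 r" if "u \<in> L2_ball" for u
    proof -
      have u: "cts u" "sqnorm u \<le> 1" using that by (auto simp: L2_ball_def)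
      have "(cmod (\<alpha> u))\<^sup>2 \<le> sqnorm u * sqnorm (\<lambda>y. b (g \<star> y))"
        unfolding \<alpha>_def by (rule Cauchy_Schwarz[OF u(1) cts_act[OF orbit b]])
      also have "\<dots> \<le> 1 * sqnorm (\<lambda>y. b (g \<star> y))" using u by (intro mult_right_mono sqnorm_nonneg)
      finally have "cmod (\<alpha> u) \<le> r" unfolding r_def by (intro real_le_rsqrt) simp
      then show ?thesis by simp
    qed
    have "e / (2 * A) > 0" using e A by simp
    then have "\<exists>F. finite F \<and> cball 0 r \<subseteq> (\<Union>z\<in>F. ball (z :: complex) (e / (2 * A)))"
      using compact_cball[of "0 :: complex" r] by (simp only: compact_eq_totally_bounded)
    then obtain F :: "complex set" where F: "finite F" "cball 0 r \<subseteq> (\<Union>z\<in>F. ball z (e / (2 * A)))"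
      by meson
    define P where "P = (\<lambda>z. {u \<in> L2_ball. \<alpha> u \<in> ball z (e / (2 * A))}) ` F"
    have "cmod (f (g \<star> x) * \<alpha> u - f (g \<star> x) * \<alpha> v) \<le> e"
      if B: "B \<in> P" "u \<in> B" "v \<in> B" "x \<in> X" for B u v x
    proof -
      obtain z where "dist z (\<alpha> u) < e / (2 * A)" "dist z (\<alpha> v) < e / (2 * A)"
        using B by (auto simp: P_def)
      then have "dist (\<alpha> u) (\<alpha> v) \<le> e / (2 * A) + e / (2 * A)"
        using dist_triangle3[of "\<alpha> u" "\<alpha> v" z] by linarith
      then have "cmod (\<alpha> u - \<alpha> v) \<le> e / A" by (simp add: dist_norm)
      then have "cmod (f (g \<star> x)) * cmod (\<alpha> u - \<alpha> v) \<le> A * (e / A)"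
        using A B orbit act_closed by (intro mult_mono) auto
      then show ?thesis using A by (simp add: norm_mult[symmetric] right_diff_distrib)
    qed
    moreover have "L2_ball = \<Union>P" using F(2) \<alpha> unfolding P_def by blast
    moreover have "finite P" using F(1) P_def by simp
    ultimately show "\<exists>P. finite P \<and> L2_ball = \<Union>P \<and>
      (\<forall>A\<in>P. \<forall>u\<in>A. \<forall>v\<in>A. \<forall>x\<in>X. cmod (kernel_op (\<lambda>x y. f (g \<star> x) * cnj (b (g \<star> y))) u x
           - kernel_op (\<lambda>x y. f (g \<star> x) * cnj (b (g \<star> y))) v x) \<le> e)"
      unfolding kernel_op_orbit \<alpha>_def by (intro exI[of _ P] conjI ballI)
  qed
next
  case (midpoint K L)
  show ?case
    unfolding compact_op_def
  proof (intro allI impI)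
    fix e :: real assume e: "e > 0"
    obtain P where P: "finite P" "L2_ball = \<Union>P"
      "\<And>A u v x. \<lbrakk>A \<in> P; u \<in> A; v \<in> A; x \<in> X\<rbrakk> \<Longrightarrow> cmod (kernel_op K u x - kernel_op K v x) \<le> e"
      using compact_opE[OF midpoint.IH(1) e] by metis
    obtain Q where Q: "finite Q" "L2_ball = \<Union>Q"
      "\<And>A u v x. \<lbrakk>A \<in> Q; u \<in> A; v \<in> A; x \<in> X\<rbrakk> \<Longrightarrow> cmod (kernel_op L u x - kernel_op L v x) \<le> e"
      using compact_opE[OF midpoint.IH(2) e] by metis
    define R where "R = (\<lambda>(A, B). A \<inter> B) ` (P \<times> Q)"
    have "\<Union>R = \<Union>P \<inter> \<Union>Q" unfolding R_def by blast
    then have "L2_ball = \<Union>R" by (simp only: P(2)[symmetric] Q(2)[symmetric] Int_absorb)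
    moreover have "finite R" using P(1) Q(1) R_def by simp
    moreover have "cmod (kernel_op (\<lambda>x y. (K x y + L x y) / 2) u x - kernel_op (\<lambda>x y. (K x y + L x y) / 2) v x) \<le> e"
      if C: "C \<in> R" "u \<in> C" "v \<in> C" and x: "x \<in> X" for C u v x
    proof -
      obtain A B where AB: "A \<in> P" "B \<in> Q" "C = A \<inter> B" using C(1) R_def by auto
      then have "u \<in> L2_ball" "v \<in> L2_ball" using C P by blast+
      then have uv: "cts u" "cts v" by (auto simp: L2_ball_def)
      have "kernel_op (\<lambda>x y. (K x y + L x y) / 2) u x - kernel_op (\<lambda>x y. (K x y + L x y) / 2) v x
        = (1/2) * ((kernel_op K u x - kernel_op K v x) + (kernel_op L u x - kernel_op L v x))"
        unfolding kernel_op_midpoint[OF midpoint.hyps f b uv(1)] kernel_op_midpoint[OF midpoint.hyps f b uv(2)]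
        by (simp add: algebra_simps)
      then have "cmod (kernel_op (\<lambda>x y. (K x y + L x y) / 2) u x - kernel_op (\<lambda>x y. (K x y + L x y) / 2) v x)
        = (1/2) * cmod ((kernel_op K u x - kernel_op K v x) + (kernel_op L u x - kernel_op L v x))"
        by (simp only: norm_mult) simp
      also have "\<dots> \<le> (1/2) * (e + e)"
        using P(3) Q(3) AB C x by (intro mult_left_mono norm_triangle_mono) auto
      finally show ?thesis by simp
    qed
    ultimately show "\<exists>P. finite P \<and> L2_ball = \<Union>P \<and> (\<forall>A\<in>P. \<forall>u\<in>A. \<forall>v\<in>A. \<forall>x\<in>X.
      cmod (kernel_op (\<lambda>x y. (K x y + L x y) / 2) u x - kernel_op (\<lambda>x y. (K x y + L x y) / 2) v x) \<le> e)"
      by (intro exI[of _ R] conjI ballI)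
  qed
qed

lemma closed_invariant_cts: "closed_invariant E \<Longrightarrow> u \<in> E \<Longrightarrow> cts u"
  unfolding closed_invariant_def by blast

lemma closed_invariant_zero: "closed_invariant E \<Longrightarrow> (\<lambda>_. 0) \<in> E"
  unfolding closed_invariant_def by blast

lemma closed_invariant_lin: "closed_invariant E \<Longrightarrow> u \<in> E \<Longrightarrow> v \<in> E \<Longrightarrow> (\<lambda>x. u x + c * v x) \<in> E"
  unfolding closed_invariant_def by blast

lemma closed_invariant_act: "closed_invariant E \<Longrightarrow> u \<in> E \<Longrightarrow> g \<in> carrier G \<Longrightarrow> (\<lambda>x. u (g \<star> x)) \<in> E"
  unfolding closed_invariant_def by blast

lemma closed_invariant_closed: "closed_invariant E \<Longrightarrow>
   (\<And>e. e > 0 \<Longrightarrow> \<exists>v\<in>E. \<forall>x\<in>X. cmod (u x - v x) \<le> e) \<Longrightarrow> u \<in> E"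
  unfolding closed_invariant_def by blast

lemma closed_invariant_cong:
  assumes "closed_invariant E" "u \<in> E" "\<And>x. x \<in> X \<Longrightarrow> u x = v x" shows "v \<in> E"
  by (rule closed_invariant_closed[OF assms(1)]) (use assms in \<open>auto intro!: bexI[OF _ assms(2)]\<close>)

lemma closed_invariant_cmult: "closed_invariant E \<Longrightarrow> u \<in> E \<Longrightarrow> (\<lambda>x. c * u x) \<in> E"
  using closed_invariant_lin[OF _ closed_invariant_zero, of E u c] by simp

lemma hull_op_range:
  assumes L: "L \<in> orbit_hull f b" and b: "cts b" and E: "closed_invariant E" and f: "f \<in> E" and u: "cts u"
  shows "kernel_op L u \<in> E"
  using L
proof induction
  case (orbit g)
  have "(\<lambda>x. mean (\<lambda>y. u y * cnj (b (g \<star> y))) * f (g \<star> x)) \<in> E"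
    by (intro closed_invariant_cmult closed_invariant_act E f orbit)
  then show ?case
    by (rule closed_invariant_cong[OF E]) (simp add: kernel_op_orbit)
next
  case (midpoint K L)
  have "(\<lambda>x. (1/2) * (kernel_op K u x + 1 * kernel_op L u x)) \<in> E"
    by (intro closed_invariant_cmult closed_invariant_lin E midpoint.IH)
  then show ?case
    by (rule closed_invariant_cong[OF E])
      (simp only: kernel_op_midpoint[OF midpoint.hyps closed_invariant_cts[OF E f] b u] mult_1)
qed

section \<open>Averages of rank one operators\<close>

lemma hull_op_pairing_tendsto:
  assumes f: "cts f" and b: "cts b" and K: "kernel K" and \<kappa>: "\<And>n. \<kappa> n \<in> orbit_hull f b"
    and close: "\<And>n x y. \<lbrakk>x \<in> X; y \<in> X\<rbrakk> \<Longrightarrow> cmod (K x y - \<kappa> n x y) \<le> inverse (real (Suc n))"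
    and u: "cts u" and w: "cts w"
  shows "(\<lambda>n. mean (\<lambda>x. kernel_op (\<kappa> n) u x * w x)) \<longlonglongrightarrow> mean (\<lambda>x. kernel_op K u x * w x)"
proof -
  obtain B where B: "B > 0" "\<And>x. x \<in> X \<Longrightarrow> cmod (w x) \<le> B" using cts_bounded[OF w] by metis
  have Ku: "cts (kernel_op K u)" unfolding kernel_op_def by (rule kernel_apply_cts[OF K u])
  note Lu = hull_op_cts[OF \<kappa> f b u]
  have "cmod (mean (\<lambda>x. kernel_op (\<kappa> n) u x * w x) - mean (\<lambda>x. kernel_op K u x * w x))
      \<le> inverse (real (Suc n)) * (sqrt (sqnorm u) * B)" for n
  proof -
    have "mean (\<lambda>x. kernel_op (\<kappa> n) u x * w x) - mean (\<lambda>x. kernel_op K u x * w x)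
      = mean (\<lambda>x. kernel_op (\<kappa> n) u x * w x - kernel_op K u x * w x)"
      by (rule mean_diff[symmetric]) (intro cts_mult Ku Lu w)+
    also have "cmod \<dots> \<le> inverse (real (Suc n)) * (sqrt (sqnorm u) * B)"
    proof (rule mean_bound)
      fix x assume x: "x \<in> X"
      have "cmod (kernel_op K u x - kernel_op (\<kappa> n) u x) \<le> inverse (real (Suc n)) * sqrt (sqnorm u)"
        by (rule kernel_op_close[OF K hull_kernel[OF f b \<kappa>] u x close[OF x]])
      then have "cmod (kernel_op K u x - kernel_op (\<kappa> n) u x) * cmod (w x) \<le> (inverse (real (Suc n)) * sqrt (sqnorm u)) * B"
        using B x by (intro mult_mono) (auto simp: sqnorm_nonneg)
      then show "cmod (kernel_op (\<kappa> n) u x * w x - kernel_op K u x * w x) \<le> inverse (real (Suc n)) * (sqrt (sqnorm u) * B)"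
        by (simp only: left_diff_distrib[symmetric] norm_mult norm_minus_commute mult.assoc)
    qed
    finally show ?thesis .
  qed
  then have "(\<lambda>n. mean (\<lambda>x. kernel_op (\<kappa> n) u x * w x) - mean (\<lambda>x. kernel_op K u x * w x)) \<longlonglongrightarrow> 0"
    by (intro Lim_null_comparison[OF always_eventually tendsto_mult_left_zero[OF LIMSEQ_inverse_real_of_nat]]) blast
  then show ?thesis by (rule LIM_zero_cancel)
qed

text \<open>
  An average of nonnegative numbers \<open>|\<langle>u, f(g \<cdot>)\<rangle>|\<^sup>2\<close> over \<open>g\<close> could be
  small although one of them is not. Replacing \<open>u\<close> by finitely many translates repairs this:
  they are chosen so that for every \<open>g\<close> at least one of them has a large pairing.
\<close>

lemma translate_pairing_bounded_below:
  assumes u: "cts u" and f: "cts f" and nz: "ip u f \<noteq> 0"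
  obtains D \<delta> where "finite D" "D \<subseteq> carrier G" "\<delta> > 0"
    "\<And>g. g \<in> carrier G \<Longrightarrow> \<exists>k\<in>D. \<delta> \<le> cmod (mean (\<lambda>x. u (k \<star> x) * cnj (f (g \<star> x))))"
proof -
  define c where "c = cmod (ip u f)"
  have c: "c > 0" using nz by (simp add: c_def)
  obtain B where B: "B > 0" "\<And>x. x \<in> X \<Longrightarrow> cmod (f x) \<le> B" using cts_bounded[OF f] by metis
  have "c / (2 * B) > 0" using c B by simp
  then obtain U where U: "one_nhd U"
    "\<And>k g x. \<lbrakk>k \<in> carrier G; g \<in> U; x \<in> X\<rbrakk> \<Longrightarrow> cmod (u (k \<star> g \<star> x) - u (k \<star> x)) < c / (2 * B)"
    using translates_equicontinuous[OF u] by metis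
  have near: "c / 2 \<le> cmod (mean (\<lambda>x. u (a \<star> x) * cnj (f x)))" if a: "a \<in> U" for a
  proof -
    have ac: "a \<in> carrier G" using a U one_nhd_carrier by blast
    have "ip u f - mean (\<lambda>x. u (a \<star> x) * cnj (f x)) = mean (\<lambda>x. u x * cnj (f x) - u (a \<star> x) * cnj (f x))"
      by (rule mean_diff[symmetric]) (intro cts_mult cts_cnj cts_act u f ac)+
    also have "cmod \<dots> \<le> c / 2"
    proof (rule mean_bound)
      fix x assume x: "x \<in> X"
      have "cmod (u (a \<star> x) - u x) \<le> c / (2 * B)"
        using U(2)[of \<one> a x] a ac x by (simp add: act_one act_closed less_imp_le)
      then have "cmod (u (a \<star> x) - u x) * cmod (f x) \<le> (c / (2 * B)) * B"
        using B x c by (intro mult_mono) auto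
      then show "cmod (u x * cnj (f x) - u (a \<star> x) * cnj (f x)) \<le> c / 2"
        using B by (simp add: left_diff_distrib[symmetric] norm_mult norm_minus_commute)
    qed
    finally show ?thesis
      using norm_triangle_ineq2[of "ip u f" "mean (\<lambda>x. u (a \<star> x) * cnj (f x))"]
      by (simp add: c_def)
  qed
  obtain D where D: "finite D" "D \<subseteq> carrier G" "carrier G \<subseteq> (\<Union>k\<in>D. (\<lambda>g. k \<otimes> g) ` U)"
  proof (rule finite_translates_cover[of "\<lambda>k. (\<lambda>g. k \<otimes> g) ` U"])
    fix k assume "k \<in> carrier G"
    then show "openin T ((\<lambda>g. k \<otimes> g) ` U) \<and> k \<in> (\<lambda>g. k \<otimes> g) ` U"
      using U(1) openin_left_translate by (force simp: one_nhd_def)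
  qed auto
  show thesis
  proof (rule that[of "m_inv G ` D" "c / 2"])
    show "finite (m_inv G ` D)" "m_inv G ` D \<subseteq> carrier G" "c / 2 > 0" using D c by auto
    fix g assume g: "g \<in> carrier G"
    then obtain k a where ka: "k \<in> D" "a \<in> U" "inv g = k \<otimes> a" using D(3) inv_closed by blast
    have kc: "k \<in> carrier G" and ac: "a \<in> carrier G" using ka D U one_nhd_carrier by blast+
    have a: "a = inv k \<otimes> inv g" using ka kc ac by (simp add: m_assoc[symmetric])
    have "mean (\<lambda>x. u (inv k \<star> x) * cnj (f (g \<star> x))) = mean (\<lambda>x. u (inv k \<star> inv g \<star> x) * cnj (f (g \<star> inv g \<star> x)))"
      by (rule mean_act[of "inv g" "\<lambda>x. u (inv k \<star> x) * cnj (f (g \<star> x))", symmetric])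
        (use g kc u f in \<open>auto intro!: cts_mult cts_cnj cts_act\<close>)
    also have "\<dots> = mean (\<lambda>x. u (a \<star> x) * cnj (f x))"
      by (rule mean_cong) (use g kc in \<open>simp add: a act_mult\<close>)
    finally show "\<exists>k\<in>m_inv G ` D. c / 2 \<le> cmod (mean (\<lambda>x. u (k \<star> x) * cnj (f (g \<star> x))))"
      using near[OF ka(2)] ka(1) by (intro bexI[of _ "inv k"]) auto
  qed
qed

text \<open>
  What is needed of the average of the rank one operators \<open>u \<mapsto> \<langle>u, f\<^sub>g\<rangle> f\<^sub>g\<close> over
  the translates \<open>f\<^sub>g\<close> of \<open>f\<close>.
\<close>

definition averaging_op :: "('x \<Rightarrow> complex) \<Rightarrow> (('x \<Rightarrow> complex) \<Rightarrow> 'x \<Rightarrow> complex) \<Rightarrow> bool" where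
  "averaging_op f R \<longleftrightarrow> equivariant_op R \<and> symmetric_op R \<and> positive_op R \<and> compact_op R \<and>
     (\<forall>E u. closed_invariant E \<longrightarrow> f \<in> E \<longrightarrow> cts u \<longrightarrow> R u \<in> E) \<and>
     (\<forall>u. cts u \<longrightarrow> ip u f \<noteq> 0 \<longrightarrow> 0 < Re (ip (R u) u))"

lemma averaging_opD:
  assumes "averaging_op f R"
  shows "equivariant_op R" "symmetric_op R" "positive_op R" "compact_op R"
    "\<And>E u. \<lbrakk>closed_invariant E; f \<in> E; cts u\<rbrakk> \<Longrightarrow> R u \<in> E"
    "\<And>u. \<lbrakk>cts u; ip u f \<noteq> 0\<rbrakk> \<Longrightarrow> 0 < Re (ip (R u) u)"
  using assms unfolding averaging_op_def by (elim conjE; simp)+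

text \<open>
  The operator of the invariant kernel in the closed hull of \<open>f x * cnj (f y)\<close>. Only strict
  positivity needs more than a passage to the limit: the quadratic forms of the hull elements,
  summed over finitely many translates of \<open>u\<close>, stay above a fixed bound, and for the
  invariant limit all these summands are equal.
\<close>

theorem averaging_op_exists:
  assumes f: "cts f"
  shows "\<exists>R. averaging_op f R"
proof -
  obtain K where K: "kernel K"
    and inv: "\<And>g x y. \<lbrakk>g \<in> carrier G; x \<in> X; y \<in> X\<rbrakk> \<Longrightarrow> K (g \<star> x) (g \<star> y) = K x y"
    and approx: "\<And>e. e > 0 \<Longrightarrow> \<exists>L\<in>orbit_hull f f. \<forall>x\<in>X. \<forall>y\<in>X. cmod (K x y - L x y) \<le> e"
    using invariant_kernel_in_closed_hull[OF f f] by metis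
  have "\<exists>L\<in>orbit_hull f f. \<forall>x\<in>X. \<forall>y\<in>X. cmod (K x y - L x y) \<le> inverse (real (Suc n))" for n
    by (rule approx) simp
  then obtain \<kappa> where \<kappa>: "\<And>n. \<kappa> n \<in> orbit_hull f f"
    "\<And>n x y. \<lbrakk>x \<in> X; y \<in> X\<rbrakk> \<Longrightarrow> cmod (K x y - \<kappa> n x y) \<le> inverse (real (Suc n))"
    by metis
  have lim: "(\<lambda>n. mean (\<lambda>x. kernel_op (\<kappa> n) u x * w x)) \<longlonglongrightarrow> mean (\<lambda>x. kernel_op K u x * w x)"
    if "cts u" "cts w" for u w
    by (rule hull_op_pairing_tendsto[OF f f K \<kappa> that])
  have eq: "equivariant_op (kernel_op K)" by (rule equivariant_kernel_op[OF K inv])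
  have hull_pos: "0 \<le> Re (ip (kernel_op L u) u)" if u: "cts u" and L: "L \<in> orbit_hull f f" for u L
    using L
  proof induction
    case (orbit g)
    show ?case unfolding hull_op_quadratic_orbit by simp
  next
    case (midpoint K L)
    then show ?case unfolding hull_op_quadratic_midpoint[OF midpoint.hyps f u] by simp
  qed
  have pos: "0 \<le> Re (ip (kernel_op K u) u)" if u: "cts u" for u
    by (rule LIMSEQ_le_const[OF tendsto_Re[OF lim[OF u cts_cnj[OF u]]]])
      (use hull_pos[OF u \<kappa>(1)] in blast)
  have sym: "ip (kernel_op K u) v = ip u (kernel_op K v)"
    if u: "cts u" and v: "cts v" for u v
  proof -
    have "(\<lambda>n. mean (\<lambda>x. kernel_op (\<kappa> n) u x * cnj (v x))) \<longlonglongrightarrow> cnj (ip (kernel_op K v) u)"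
      unfolding hull_op_symmetric[OF \<kappa>(1) f u v]
      using tendsto_cnj[OF lim[OF v cts_cnj[OF u]]] by (simp add: mean_cnj[symmetric] mult.commute)
    then have "ip (kernel_op K u) v = cnj (ip (kernel_op K v) u)"
      using lim[OF u cts_cnj[OF v]] LIMSEQ_unique by blast
    then show ?thesis by (simp add: mean_cnj[symmetric] mult.commute)
  qed
  have cpt: "compact_op (kernel_op K)"
    unfolding compact_op_def
  proof (intro allI impI)
    fix e :: real assume e: "e > 0"
    then have e3: "e / 3 > 0" by simp
    obtain L where L: "L \<in> orbit_hull f f" "\<And>x y. \<lbrakk>x \<in> X; y \<in> X\<rbrakk> \<Longrightarrow> cmod (K x y - L x y) \<le> e / 3"
      using approx[OF e3] by metis
    obtain P where P: "finite P" "L2_ball = \<Union>P"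
      "\<And>A u v x. \<lbrakk>A \<in> P; u \<in> A; v \<in> A; x \<in> X\<rbrakk> \<Longrightarrow> cmod (kernel_op L u x - kernel_op L v x) \<le> e / 3"
      using compact_opE[OF hull_op_compact[OF L(1) f f] e3] by metis
    have close: "cmod (kernel_op K u x - kernel_op L u x) \<le> e / 3" if "u \<in> L2_ball" "x \<in> X" for u x
    proof -
      have u: "cts u" "sqrt (sqnorm u) \<le> 1" using that by (auto simp: L2_ball_def)
      have "cmod (kernel_op K u x - kernel_op L u x) \<le> e / 3 * sqrt (sqnorm u)"
        by (rule kernel_op_close[OF K hull_kernel[OF f f L(1)] u(1) that(2) L(2)[OF that(2)]])
      also have "\<dots> \<le> e / 3 * 1" using u e by (intro mult_left_mono) auto
      finally show ?thesis by simp
    qed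
    have "cmod (kernel_op K u x - kernel_op K v x) \<le> e" if A: "A \<in> P" "u \<in> A" "v \<in> A" and x: "x \<in> X" for A u v x
    proof -
      have "u \<in> L2_ball" "v \<in> L2_ball" using A P(2) by auto
      then have "cmod (kernel_op K u x - kernel_op L u x) \<le> e / 3" "cmod (kernel_op K v x - kernel_op L v x) \<le> e / 3"
        using close x by blast+
      moreover have "cmod (kernel_op L u x - kernel_op L v x) \<le> e / 3" by (rule P(3)[OF A x])
      moreover have "cmod (kernel_op K u x - kernel_op K v x) = cmod (((kernel_op K u x - kernel_op L u x)
         + (kernel_op L u x - kernel_op L v x)) - (kernel_op K v x - kernel_op L v x))" by simp
      ultimately show ?thesis
        using norm_triangle_ineq4[of "(kernel_op K u x - kernel_op L u x) + (kernel_op L u x - kernel_op L v x)" "kernel_op K v x - kernel_op L v x"]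
          norm_triangle_ineq[of "kernel_op K u x - kernel_op L u x" "kernel_op L u x - kernel_op L v x"] by linarith
    qed
    then show "\<exists>P. finite P \<and> L2_ball = \<Union>P \<and>
      (\<forall>A\<in>P. \<forall>u\<in>A. \<forall>v\<in>A. \<forall>x\<in>X. cmod (kernel_op K u x - kernel_op K v x) \<le> e)"
      using P(1,2) by (intro exI[of _ P] conjI ballI)
  qed
  have "averaging_op f (kernel_op K)"
    unfolding averaging_op_def
  proof (intro conjI allI impI)
    show "equivariant_op (kernel_op K)" "compact_op (kernel_op K)" by fact+
    show "symmetric_op (kernel_op K)" unfolding symmetric_op_def using sym by blast
    show "positive_op (kernel_op K)" unfolding positive_op_def using pos by blast
    fix E u assume E: "closed_invariant E" "f \<in> E" and u: "cts u"
    show "kernel_op K u \<in> E"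
    proof (rule closed_invariant_closed[OF E(1)])
      fix e :: real assume e: "e > 0"
      have n: "sqrt (sqnorm u) + 1 > 0" by (simp add: sqnorm_nonneg add_nonneg_pos)
      then obtain L where L: "L \<in> orbit_hull f f" "\<And>x y. \<lbrakk>x \<in> X; y \<in> X\<rbrakk> \<Longrightarrow> cmod (K x y - L x y) \<le> e / (sqrt (sqnorm u) + 1)"
        using approx[of "e / (sqrt (sqnorm u) + 1)"] e by auto
      have "cmod (kernel_op K u x - kernel_op L u x) \<le> e" if x: "x \<in> X" for x
      proof -
        have "cmod (kernel_op K u x - kernel_op L u x) \<le> e / (sqrt (sqnorm u) + 1) * sqrt (sqnorm u)"
          by (rule kernel_op_close[OF K hull_kernel[OF f f L(1)] u x L(2)[OF x]])
        also have "\<dots> \<le> e / (sqrt (sqnorm u) + 1) * (sqrt (sqnorm u) + 1)" using e n by (intro mult_left_mono) auto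
        finally show ?thesis using n by simp
      qed
      then show "\<exists>v\<in>E. \<forall>x\<in>X. cmod (kernel_op K u x - v x) \<le> e"
        using hull_op_range[OF L(1) f E u] by blast
    qed
  next
    fix u assume u: "cts u" and nz: "ip u f \<noteq> 0"
    obtain D \<delta> where D: "finite D" "D \<subseteq> carrier G" and \<delta>: "\<delta> > 0"
      "\<And>g. g \<in> carrier G \<Longrightarrow> \<exists>k\<in>D. \<delta> \<le> cmod (mean (\<lambda>x. u (k \<star> x) * cnj (f (g \<star> x))))"
      using translate_pairing_bounded_below[OF u f nz] by metis
    let ?q = "\<lambda>L v. Re (ip (kernel_op L v) v)"
    have low: "\<delta>\<^sup>2 \<le> (\<Sum>k\<in>D. ?q L (\<lambda>x. u (k \<star> x)))" if "L \<in> orbit_hull f f" for L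
      using that
    proof induction
      case (orbit g)
      obtain k where k: "k \<in> D" "\<delta> \<le> cmod (mean (\<lambda>x. u (k \<star> x) * cnj (f (g \<star> x))))" using \<delta>(2)[OF orbit] by blast
      have "\<delta>\<^sup>2 \<le> (cmod (mean (\<lambda>x. u (k \<star> x) * cnj (f (g \<star> x)))))\<^sup>2" using k \<delta> by (intro power_mono) auto
      also have "\<dots> \<le> (\<Sum>k\<in>D. (cmod (mean (\<lambda>x. u (k \<star> x) * cnj (f (g \<star> x)))))\<^sup>2)"
        using k D by (intro member_le_sum) auto
      finally show ?case
        unfolding hull_op_quadratic_orbit[of f g "\<lambda>x. u (_ \<star> x)"] Re_complex_of_real .
    next
      case (midpoint K L)
      have "(\<Sum>k\<in>D. ?q (\<lambda>x y. (K x y + L x y) / 2) (\<lambda>x. u (k \<star> x)))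
        = (\<Sum>k\<in>D. (?q K (\<lambda>x. u (k \<star> x)) + ?q L (\<lambda>x. u (k \<star> x))) / 2)"
      proof (rule sum.cong)
        fix k assume "k \<in> D"
        then have c: "cts (\<lambda>x. u (k \<star> x))" using D u by (intro cts_act) auto
        show "?q (\<lambda>x y. (K x y + L x y) / 2) (\<lambda>x. u (k \<star> x)) = (?q K (\<lambda>x. u (k \<star> x)) + ?q L (\<lambda>x. u (k \<star> x))) / 2"
          by (subst hull_op_quadratic_midpoint[OF midpoint.hyps f c]) simp
      qed simp
      then show ?case
        using midpoint.IH by (simp add: sum_divide_distrib[symmetric] sum.distrib)
    qed
    have "(\<lambda>n. \<Sum>k\<in>D. ?q (\<kappa> n) (\<lambda>x. u (k \<star> x))) \<longlonglongrightarrow> (\<Sum>k\<in>D. ?q K (\<lambda>x. u (k \<star> x)))"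
      using D u by (intro tendsto_sum tendsto_Re lim cts_cnj cts_act) auto
    then have "\<delta>\<^sup>2 \<le> (\<Sum>k\<in>D. ?q K (\<lambda>x. u (k \<star> x)))"
      using low[OF \<kappa>(1)] by (intro LIMSEQ_le_const) auto
    also have "\<dots> = (\<Sum>k\<in>D. ?q K u)"
    proof (rule sum.cong)
      fix k assume "k \<in> D"
      then have k: "k \<in> carrier G" using D by blast
      have "mean (\<lambda>x. kernel_op K (\<lambda>x. u (k \<star> x)) x * cnj (u (k \<star> x))) = mean (\<lambda>x. kernel_op K u (k \<star> x) * cnj (u (k \<star> x)))"
        by (rule mean_cong) (simp add: equivariant_op_act[OF eq u k])
      also have "\<dots> = ip (kernel_op K u) u"
        by (rule mean_act[OF k, of "\<lambda>x. kernel_op K u x * cnj (u x)"]) (intro cts_mult cts_cnj u equivariant_op_cts[OF eq])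
      finally show "?q K (\<lambda>x. u (k \<star> x)) = ?q K u" by simp
    qed simp
    also have "\<dots> = card D * ?q K u" by simp
    finally have "0 < card D * ?q K u" using \<delta>(1) by (meson less_le_trans zero_less_power)
    then show "0 < ?q K u" by (simp add: zero_less_mult_iff)
  qed
  then show ?thesis by blast
qed

section \<open>Eigenfunctions of compact positive operators\<close>

definition quadratic_form :: "(('x \<Rightarrow> complex) \<Rightarrow> 'x \<Rightarrow> complex) \<Rightarrow> ('x \<Rightarrow> complex) \<Rightarrow> real" where
  "quadratic_form S u = Re (ip (S u) u)"

lemma quadratic_form_expand:
  assumes S: "equivariant_op S" "symmetric_op S" and u: "cts u" and v: "cts v"
  shows "quadratic_form S (\<lambda>x. u x + c * v x)
    = quadratic_form S u + 2 * Re (cnj c * ip (S u) v) + (cmod c)\<^sup>2 * quadratic_form S v"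
proof -
  note cS = equivariant_op_cts[OF S(1)]
  have "mean (\<lambda>x. S (\<lambda>x. u x + c * v x) x * cnj (u x + c * v x))
    = mean (\<lambda>x. (S u x + c * S v x) * cnj (u x + c * v x))"
    by (rule mean_cong) (simp add: equivariant_op_linear[OF S(1) u v])
  also have "\<dots> = mean (\<lambda>x. (S u x * cnj (u x) + (c * cnj c) * (S v x * cnj (v x)))
      + (cnj c * (S u x * cnj (v x)) + c * (S v x * cnj (u x))))"
    by (simp add: algebra_simps)
  also have "\<dots> = (ip (S u) u + (c * cnj c) * ip (S v) v)
      + (cnj c * ip (S u) v + c * ip (S v) u)"
    unfolding mean_cmult[symmetric]
    by (subst mean_add; (subst mean_add)?; (subst mean_add)?; (intro cts_add cts_mult cts_const cts_cnj cS u v)?) auto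
  also have "ip (S v) u = cnj (ip (S u) v)"
    using S(2) u v unfolding symmetric_op_def by (simp add: mean_cnj[symmetric] mult.commute)
  finally show ?thesis
    unfolding quadratic_form_def by (simp add: cmod_power2, simp add: algebra_simps power2_eq_square)
qed

lemma quadratic_form_nonneg: "positive_op S \<Longrightarrow> cts u \<Longrightarrow> 0 \<le> quadratic_form S u"
  unfolding positive_op_def quadratic_form_def by blast

lemma quadratic_form_Cauchy_Schwarz:
  assumes S: "equivariant_op S" "symmetric_op S" "positive_op S" and u: "cts u" and v: "cts v"
  shows "(cmod (ip (S u) v))\<^sup>2 \<le> quadratic_form S u * quadratic_form S v"
proof (rule complex_Cauchy_Schwarz)
  show "0 \<le> quadratic_form S v" by (rule quadratic_form_nonneg[OF S(3) v])
  fix c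
  have "cts (\<lambda>x. u x + c * v x)" by (intro cts_add cts_mult cts_const u v)
  then show "0 \<le> quadratic_form S u + 2 * Re (cnj c * ip (S u) v) + (cmod c)\<^sup>2 * quadratic_form S v"
    using quadratic_form_nonneg[OF S(3)] quadratic_form_expand[OF S(1,2) u v] by metis
qed

lemma quadratic_form_cmult:
  assumes S: "equivariant_op S" and u: "cts u"
  shows "quadratic_form S (\<lambda>x. c * u x) = (cmod c)\<^sup>2 * quadratic_form S u"
proof -
  have "mean (\<lambda>x. S (\<lambda>x. c * u x) x * cnj (c * u x)) = mean (\<lambda>x. of_real ((cmod c)\<^sup>2) * (S u x * cnj (u x)))"
    unfolding complex_norm_square by (rule mean_cong) (simp add: equivariant_op_cmult[OF S u])
  then show ?thesis unfolding quadratic_form_def mean_cmult by simp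
qed

lemma quadratic_form_le:
  assumes S: "equivariant_op S" and u: "cts u"
  shows "quadratic_form S u \<le> sqrt (sqnorm (S u) * sqnorm u)"
proof -
  have "(cmod (ip (S u) u))\<^sup>2 \<le> sqnorm (S u) * sqnorm u"
    by (rule Cauchy_Schwarz[OF equivariant_op_cts[OF S u] u])
  then have "cmod (ip (S u) u) \<le> sqrt (sqnorm (S u) * sqnorm u)"
    by (rule real_le_rsqrt)
  then show ?thesis unfolding quadratic_form_def using complex_Re_le_cmod order_trans by blast
qed

text \<open>
  For each accuracy, infinitely many members of a sequence lie in the same set of the finite cover;
  a diagonal sequence serves all accuracies.
\<close>

lemma compact_op_subsequence:
  assumes S: "compact_op S" and u: "\<And>n. u n \<in> L2_ball"
  obtains r :: "nat \<Rightarrow> nat" where "strict_mono r"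
    "\<And>e. e > 0 \<Longrightarrow> \<exists>N. \<forall>i\<ge>N. \<forall>j\<ge>N. \<forall>x\<in>X. cmod (S (u (r i)) x - S (u (r j)) x) \<le> e"
proof -
  define P where "P = (\<lambda>n (s :: nat \<Rightarrow> nat). \<forall>i j. \<forall>x\<in>X.
    cmod (S (u (s i)) x - S (u (s j)) x) \<le> inverse (real (Suc n)))"
  interpret subseqs P
  proof
    fix n and s :: "nat \<Rightarrow> nat" assume "strict_mono s"
    obtain \<A> where \<A>: "finite \<A>" "L2_ball = \<Union>\<A>"
      "\<And>A v w x. \<lbrakk>A \<in> \<A>; v \<in> A; w \<in> A; x \<in> X\<rbrakk> \<Longrightarrow> cmod (S v x - S w x) \<le> inverse (real (Suc n))"
      using compact_opE[OF S, of "inverse (real (Suc n))"] by auto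
    have "\<forall>i. \<exists>A\<in>\<A>. u (s i) \<in> A" using u \<A>(2) by auto
    then obtain c where c: "\<And>i. c i \<in> \<A>" "\<And>i. u (s i) \<in> c i" by metis
    have "\<exists>A\<in>\<A>. infinite {i \<in> UNIV. c i = A}"
      using c(1) \<A>(1) pigeonhole_infinite_rel[of UNIV \<A> "\<lambda>i A. c i = A"] by auto
    then obtain A where A: "A \<in> \<A>" "infinite {i. c i = A}" by auto
    let ?r = "enumerate {i. c i = A}"
    have "strict_mono ?r" by (rule strict_mono_enumerate[OF A(2)])
    moreover have "c (?r i) = A" for i using enumerate_in_set[OF A(2)] by blast
    then have "P n (s \<circ> ?r)"
      unfolding P_def using \<A>(3)[OF A(1)] c(2) by (metis comp_apply)
    ultimately show "\<exists>r'. strict_mono r' \<and> P n (s \<circ> r')" by blast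
  qed
  have P: "P k (diagseq \<circ> ((+) (Suc k)))" for k
    by (rule diagseq_holds) (auto simp: P_def)
  show thesis
  proof (rule that[OF subseq_diagseq])
    fix e :: real assume "e > 0"
    then obtain k where k: "inverse (real (Suc k)) < e" using reals_Archimedean by blast
    have "cmod (S (u (diagseq i)) x - S (u (diagseq j)) x) \<le> e"
      if ij: "i \<ge> Suc k" "j \<ge> Suc k" and x: "x \<in> X" for i j x
    proof -
      obtain i' j' where "i = Suc k + i'" "j = Suc k + j'" using ij le_Suc_ex by metis
      then have "cmod (S (u (diagseq i)) x - S (u (diagseq j)) x) \<le> inverse (real (Suc k))"
        using P[of k] x unfolding P_def comp_def by blast
      then show ?thesis using k by linarith
    qed
    then show "\<exists>N. \<forall>i\<ge>N. \<forall>j\<ge>N. \<forall>x\<in>X. cmod (S (u (diagseq i)) x - S (u (diagseq j)) x) \<le> e" by blast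
  qed
qed

lemma uniform_Cauchy_limit:
  fixes v :: "nat \<Rightarrow> 'x \<Rightarrow> complex"
  assumes v: "\<And>n. cts (v n)"
    and C: "\<And>e. e > 0 \<Longrightarrow> \<exists>N. \<forall>i\<ge>N. \<forall>j\<ge>N. \<forall>x\<in>X. cmod (v i x - v j x) \<le> e"
  obtains w where "cts w" "\<And>e. e > 0 \<Longrightarrow> \<exists>N. \<forall>i\<ge>N. \<forall>x\<in>X. cmod (v i x - w x) \<le> e"
proof -
  define w where "w = (\<lambda>x. lim (\<lambda>n. v n x))"
  have lim: "(\<lambda>n. v n x) \<longlonglongrightarrow> w x" if x: "x \<in> X" for x
  proof -
    have "Cauchy (\<lambda>n. v n x)"
    proof (rule metric_CauchyI)
      fix e :: real assume e: "e > 0"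
      then obtain N where "\<forall>i\<ge>N. \<forall>j\<ge>N. \<forall>x\<in>X. cmod (v i x - v j x) \<le> e/2" using C[of "e/2"] by auto
      then have "\<forall>i\<ge>N. \<forall>j\<ge>N. dist (v i x) (v j x) \<le> e/2" using x by (simp add: dist_norm)
      moreover have "e/2 < e" using e by simp
      ultimately show "\<exists>N. \<forall>i\<ge>N. \<forall>j\<ge>N. dist (v i x) (v j x) < e" using le_less_trans by blast
    qed
    then show ?thesis unfolding w_def using Cauchy_convergent convergent_LIMSEQ_iff by blast
  qed
  have close: "\<exists>N. \<forall>i\<ge>N. \<forall>x\<in>X. cmod (v i x - w x) \<le> e" if e: "e > 0" for e
  proof -
    obtain N where N: "\<forall>i\<ge>N. \<forall>j\<ge>N. \<forall>x\<in>X. cmod (v i x - v j x) \<le> e" using C[OF e] by blast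
    have "cmod (v i x - w x) \<le> e" if "i \<ge> N" "x \<in> X" for i x
    proof (rule LIMSEQ_le_const2)
      show "(\<lambda>j. cmod (v i x - v j x)) \<longlonglongrightarrow> cmod (v i x - w x)" using lim that by (intro tendsto_intros) auto
      show "\<exists>N. \<forall>j\<ge>N. cmod (v i x - v j x) \<le> e" using N that by blast
    qed
    then show ?thesis by blast
  qed
  have "cts w"
  proof (rule cts_uniform_limit)
    fix e :: real assume "e > 0"
    then obtain N where "\<forall>i\<ge>N. \<forall>x\<in>X. cmod (v i x - w x) \<le> e" using close by blast
    then show "\<exists>u. cts u \<and> (\<forall>x\<in>X. cmod (w x - u x) \<le> e)"
      using v by (intro exI[of _ "v N"]) (auto simp: norm_minus_commute)
  qed
  then show thesis using that close by blast
qed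

definition eigenspace :: "(('x \<Rightarrow> complex) \<Rightarrow> 'x \<Rightarrow> complex) \<Rightarrow> real \<Rightarrow> ('x \<Rightarrow> complex) set" where
  "eigenspace S \<rho> = {u. cts u \<and> (\<forall>x\<in>X. S u x = of_real \<rho> * u x)}"

text \<open>
  The eigenvalue is the supremum \<open>\<rho>\<close> of the quadratic form on the unit ball. The
  Cauchy-Schwarz inequality for this form gives
  \<open>\<parallel>S u\<parallel>\<^sup>2 \<le> \<rho> \<langle>S u, u\<rangle>\<close>, so on a maximising sequence \<open>S u - \<rho> u\<close>
  tends to 0. By compactness \<open>S u\<close> converges along a subsequence, and its limit is an
  eigenfunction. The limit is taken in the supremum norm, hence continuous.
\<close>

theorem positive_compact_op_eigenfunction:
  assumes S: "equivariant_op S" "symmetric_op S" "positive_op S" "compact_op S"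
    and nz: "cts u0" "quadratic_form S u0 > 0"
  shows "\<exists>\<rho>>0. \<exists>w\<in>eigenspace S \<rho>. \<exists>x\<in>X. w x \<noteq> 0"
proof -
  obtain C where C: "C > 0" "\<And>u x. \<lbrakk>cts u; x \<in> X\<rbrakk> \<Longrightarrow> cmod (S u x) \<le> C * sqrt (sqnorm u)"
    using equivariant_op_bound[OF S(1)] by metis
  note cS = equivariant_op_cts[OF S(1)]
  have sqnormS: "sqnorm (S u) \<le> C\<^sup>2 * sqnorm u" if u: "cts u" for u
    using sqnorm_bound[of "S u" "C * sqrt (sqnorm u)"] C(2)[OF u] by (simp add: power_mult_distrib sqnorm_nonneg)
  define \<rho> where "\<rho> = Sup (quadratic_form S ` L2_ball)"
  have "quadratic_form S u \<le> C" if "u \<in> L2_ball" for u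
  proof -
    have u: "cts u" "sqnorm u \<le> 1" using that by (auto simp: L2_ball_def)
    have "sqnorm (S u) * sqnorm u \<le> (C\<^sup>2 * 1) * 1"
      using sqnormS[OF u(1)] u(2) sqnorm_nonneg[of u] sqnorm_nonneg[of "S u"] C(1)
      by (intro mult_mono) (auto intro: order_trans mult_left_le)
    then have "sqrt (sqnorm (S u) * sqnorm u) \<le> C" using C(1) by (simp add: real_le_lsqrt sqnorm_nonneg)
    then show ?thesis using quadratic_form_le[OF S(1) u(1)] by linarith
  qed
  then have bdd: "bdd_above (quadratic_form S ` L2_ball)" by (meson bdd_above.I2)
  have "(\<lambda>_. 0) \<in> L2_ball" by (simp add: L2_ball_def sqnorm_def mean_const)
  then have ne: "L2_ball \<noteq> {}" by blast
  have up: "quadratic_form S u \<le> \<rho>" if "u \<in> L2_ball" for u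
    unfolding \<rho>_def by (rule cSUP_upper[OF that bdd])
  have scaled: "quadratic_form S u \<le> \<rho> * sqnorm u" if u: "cts u" for u
  proof (cases "sqnorm u = 0")
    case True
    then show ?thesis using quadratic_form_le[OF S(1) u] by simp
  next
    case False
    then have pos: "sqnorm u > 0" using sqnorm_nonneg[of u] by linarith
    define c where "c = complex_of_real (1 / sqrt (sqnorm u))"
    have c2: "(cmod c)\<^sup>2 = 1 / sqnorm u" using pos by (simp add: c_def power_divide norm_divide sqnorm_nonneg)
    have "(\<lambda>x. c * u x) \<in> L2_ball"
      using u pos by (auto simp: L2_ball_def sqnorm_cmult c2 intro!: cts_mult)
    from up[OF this] show ?thesis using pos by (simp add: quadratic_form_cmult[OF S(1) u] c2 field_simps)
  qed
  have \<rho>: "\<rho> > 0"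
  proof -
    have "0 < \<rho> * sqnorm u0" using scaled[OF nz(1)] nz(2) by linarith
    then show ?thesis using sqnorm_nonneg[of u0] by (simp add: zero_less_mult_iff)
  qed
  have Sq: "sqnorm (S u) \<le> \<rho> * quadratic_form S u" if u: "cts u" for u
  proof (cases "sqnorm (S u) = 0")
    case True
    then show ?thesis using \<rho> quadratic_form_nonneg[OF S(3) u] by simp
  next
    case False
    then have pos: "sqnorm (S u) > 0" using sqnorm_nonneg[of "S u"] by linarith
    have "(sqnorm (S u))\<^sup>2 \<le> quadratic_form S u * quadratic_form S (S u)"
      using quadratic_form_Cauchy_Schwarz[OF S(1-3) u cS[OF u]] by (simp add: mean_self sqnorm_nonneg)
    also have "\<dots> \<le> quadratic_form S u * (\<rho> * sqnorm (S u))"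
      by (intro mult_left_mono scaled cS u quadratic_form_nonneg[OF S(3)])
    finally show ?thesis using pos by (simp add: power2_eq_square mult_ac)
  qed
  have "\<exists>u\<in>L2_ball. \<rho> - inverse (real (Suc n)) < quadratic_form S u" for n
  proof -
    have "\<rho> - inverse (real (Suc n)) < Sup (quadratic_form S ` L2_ball)" unfolding \<rho>_def by simp
    then show ?thesis using less_cSUP_iff[OF ne bdd] by blast
  qed
  then obtain u where u: "\<And>n. u n \<in> L2_ball" "\<And>n. \<rho> - inverse (real (Suc n)) < quadratic_form S (u n)" by metis
  have cu: "cts (u n)" "sqnorm (u n) \<le> 1" for n using u(1)[of n] by (auto simp: L2_ball_def)
  \<comment> \<open>Expanding the square and using \<open>Sq\<close>, the residual is at most
    \<open>\<rho> (\<rho> - \<langle>S u, u\<rangle>)\<close>.\<close>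
  have resid: "sqnorm (\<lambda>x. S (u n) x - \<rho> * u n x) \<le> \<rho> * inverse (real (Suc n))" for n
  proof -
    have "sqnorm (\<lambda>x. S (u n) x + (- \<rho>) * u n x) = sqnorm (S (u n)) - 2 * \<rho> * quadratic_form S (u n) + \<rho>\<^sup>2 * sqnorm (u n)"
      unfolding sqnorm_expand[OF cS[OF cu(1)] cu(1)] quadratic_form_def by simp
    also have "\<dots> \<le> \<rho> * quadratic_form S (u n) - 2 * \<rho> * quadratic_form S (u n) + \<rho>\<^sup>2 * 1"
      using Sq[OF cu(1)[of n]] cu(2)[of n] \<rho> by (intro add_mono diff_mono mult_left_mono) auto
    also have "\<dots> = \<rho> * (\<rho> - quadratic_form S (u n))" by (simp add: algebra_simps power2_eq_square)
    also have "\<dots> \<le> \<rho> * inverse (real (Suc n))" using u(2)[of n] \<rho> by (intro mult_left_mono) auto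
    finally show ?thesis by simp
  qed
  obtain r :: "nat \<Rightarrow> nat" where r: "strict_mono r"
    "\<And>e. e > 0 \<Longrightarrow> \<exists>N. \<forall>i\<ge>N. \<forall>j\<ge>N. \<forall>x\<in>X. cmod (S (u (r i)) x - S (u (r j)) x) \<le> e"
    using compact_op_subsequence[where S = S and u = u, OF S(4) u(1)] by metis
  obtain w where w: "cts w" "\<And>e. e > 0 \<Longrightarrow> \<exists>N. \<forall>i\<ge>N. \<forall>x\<in>X. cmod (S (u (r i)) x - w x) \<le> e"
    using uniform_Cauchy_limit[of "\<lambda>i. S (u (r i))", OF cS[OF cu(1)] r(2)] by metis
  have rge: "inverse (real (Suc (r i))) \<le> inverse (real (Suc i))" for i
    using seq_suble[OF r(1), of i] by (simp add: field_simps)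
  have resid_small: "\<exists>N. \<forall>i\<ge>N. sqnorm (\<lambda>x. S (u (r i)) x - \<rho> * u (r i) x) \<le> e" if e: "e > 0" for e
  proof -
    obtain N where N: "inverse (real (Suc N)) < e / \<rho>" using reals_Archimedean[of "e / \<rho>"] e \<rho> by auto
    have "sqnorm (\<lambda>x. S (u (r i)) x - \<rho> * u (r i) x) \<le> e" if i: "i \<ge> N" for i
    proof -
      have "inverse (real (Suc (r i))) \<le> e / \<rho>"
        using rge[of i] N i by (smt (verit) inverse_le_iff_le of_nat_0_less_iff of_nat_le_iff Suc_le_mono zero_less_Suc)
      then have "\<rho> * inverse (real (Suc (r i))) \<le> e" using \<rho> by (simp add: field_simps)
      then show ?thesis using resid[of "r i"] by linarith
    qed
    then show ?thesis by blast
  qed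
  obtain D where D: "D > 0" "\<And>u v x e. \<lbrakk>cts u; cts v; \<And>y. y \<in> X \<Longrightarrow> cmod (u y - v y) \<le> e; x \<in> X\<rbrakk>
     \<Longrightarrow> cmod (S u x - S v x) \<le> D * e"
    using equivariant_op_sup_bound[OF S(1)] by metis
  have eig: "S w x = of_real \<rho> * w x" if x: "x \<in> X" for x
  proof (rule ccontr)
    assume "S w x \<noteq> of_real \<rho> * w x"
    then have d: "cmod (S w x - \<rho> * w x) > 0" (is "?d > 0") by simp
    define e where "e = (?d / 2) / (D + C + \<rho>)"
    have e: "e > 0" using d C D \<rho> by (simp add: e_def)
    obtain N1 where N1: "\<forall>i\<ge>N1. \<forall>x\<in>X. cmod (S (u (r i)) x - w x) \<le> e" using w(2)[OF e] by blast
    obtain N2 where N2: "\<forall>i\<ge>N2. sqnorm (\<lambda>x. S (u (r i)) x - \<rho> * u (r i) x) \<le> e\<^sup>2" using resid_small[of "e\<^sup>2"] e by auto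
    define v where "v = u (r (max N1 N2))"
    have v: "cts v" and close: "\<And>x. x \<in> X \<Longrightarrow> cmod (S v x - w x) \<le> e"
      and res: "sqnorm (\<lambda>x. S v x - \<rho> * v x) \<le> e\<^sup>2"
      using cu(1) N1 N2 by (auto simp: v_def)
    have cd: "cts (\<lambda>x. \<rho> * v x)" by (intro cts_mult cts_const v)
    have "cmod (S w x - S (S v) x) \<le> D * e"
      using close by (intro D(2) w(1) cS v x) (simp add: norm_minus_commute)
    moreover have "cmod (S (S v) x - \<rho> * S v x) \<le> C * e"
    proof -
      have "S (S v) x - \<rho> * S v x = S (\<lambda>x. S v x - \<rho> * v x) x"
        by (simp add: equivariant_op_diff[OF S(1) cS[OF v] cd x] equivariant_op_cmult[OF S(1) v x])
      also have "cmod \<dots> \<le> C * sqrt (sqnorm (\<lambda>x. S v x - \<rho> * v x))"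
        by (rule C(2)[OF cts_diff[OF cS[OF v] cd] x])
      also have "\<dots> \<le> C * e" using res e C by (intro mult_left_mono real_le_lsqrt) (auto simp: sqnorm_nonneg)
      finally show ?thesis .
    qed
    moreover have "cmod (\<rho> * S v x - \<rho> * w x) \<le> \<rho> * e"
      using close[OF x] \<rho> by (simp add: right_diff_distrib[symmetric] norm_mult)
    moreover have "?d \<le> cmod (S w x - S (S v) x) + cmod (S (S v) x - \<rho> * S v x) + cmod (\<rho> * S v x - \<rho> * w x)"
      using norm_triangle_ineq[of "(S w x - S (S v) x) + (S (S v) x - \<rho> * S v x)" "\<rho> * S v x - \<rho> * w x"]
        norm_triangle_ineq[of "S w x - S (S v) x" "S (S v) x - \<rho> * S v x"] by simp
    ultimately have "?d \<le> (D + C + \<rho>) * e" by (simp add: algebra_simps)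
    also have "\<dots> = ?d / 2"
    proof -
      have "D + C + \<rho> \<noteq> 0" using C D \<rho> by linarith
      then show ?thesis unfolding e_def by (metis nonzero_mult_div_cancel_left times_divide_eq_right)
    qed
    finally show False using d by simp
  qed
  have "\<exists>x\<in>X. w x \<noteq> 0"
  proof (rule ccontr)
    assume "\<not> ?thesis"
    then have w0: "\<And>x. x \<in> X \<Longrightarrow> w x = 0" by blast
    have l4: "\<rho> / 4 > 0" using \<rho> by simp
    obtain N1 where N1: "\<forall>i\<ge>N1. \<forall>x\<in>X. cmod (S (u (r i)) x - w x) \<le> \<rho> / 4" using w(2)[OF l4] by blast
    obtain N2 where N2: "inverse (real (Suc N2)) < \<rho> / 4" using reals_Archimedean[OF l4] by blast
    define n where "n = r (max N1 N2)"
    have "sqnorm (S (u n)) \<le> (\<rho> / 4)\<^sup>2" using N1 w0 by (intro sqnorm_bound) (auto simp: n_def)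
    then have "sqnorm (S (u n)) * sqnorm (u n) \<le> (\<rho> / 4)\<^sup>2 * 1"
      using cu(2)[of n] sqnorm_nonneg by (intro mult_mono) auto
    then have "sqrt (sqnorm (S (u n)) * sqnorm (u n)) \<le> \<rho> / 4" using \<rho> by (intro real_le_lsqrt) (auto simp: sqnorm_nonneg)
    then have "quadratic_form S (u n) \<le> \<rho> / 4" using quadratic_form_le[OF S(1) cu(1)] order_trans by blast
    moreover have "N2 \<le> n" using seq_suble[OF r(1), of "max N1 N2"] by (simp add: n_def)
    then have "inverse (real (Suc n)) \<le> inverse (real (Suc N2))" by (simp add: field_simps)
    ultimately show False using u(2)[of n] N2 \<rho> by linarith
  qed
  moreover have "w \<in> eigenspace S \<rho>" using w(1) eig by (simp add: eigenspace_def)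
  ultimately show ?thesis using \<rho> by blast
qed

section \<open>Finite multiplicity and irreducible subspaces\<close>

definition orthonormal :: "nat \<Rightarrow> (nat \<Rightarrow> 'x \<Rightarrow> complex) \<Rightarrow> bool" where
  "orthonormal k e \<longleftrightarrow> (\<forall>i<k. cts (e i)) \<and>
     (\<forall>i<k. \<forall>j<k. ip (e i) (e j) = (if i = j then 1 else 0))"

lemma orthonormal_coeff:
  assumes e: "orthonormal k e" and j: "j < k"
  shows "mean (\<lambda>x. (\<Sum>i<k. a i * e i x) * cnj (e j x)) = a j"
proof -
  have ce: "cts (e i)" if "i < k" for i using e that orthonormal_def by blast
  have "mean (\<lambda>x. (\<Sum>i<k. a i * e i x) * cnj (e j x)) = mean (\<lambda>x. \<Sum>i<k. a i * (e i x * cnj (e j x)))"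
    by (simp add: sum_distrib_right mult.assoc)
  also have "\<dots> = (\<Sum>i<k. mean (\<lambda>x. a i * (e i x * cnj (e j x))))"
    by (rule mean_sum) (use ce j in \<open>auto intro!: cts_mult cts_cnj\<close>)
  also have "\<dots> = (\<Sum>i<k. if i = j then a j else 0)"
    using e j unfolding mean_cmult orthonormal_def by (intro sum.cong) auto
  finally show ?thesis using j by simp
qed

lemma sqnorm_orthonormal:
  assumes e: "orthonormal k e"
  shows "sqnorm (\<lambda>x. \<Sum>i<k. a i * e i x) = (\<Sum>i<k. (cmod (a i))\<^sup>2)"
proof -
  have ce: "cts (e i)" if "i < k" for i using e that orthonormal_def by blast
  define u where "u = (\<lambda>x. \<Sum>i<k. a i * e i x)"
  have u: "cts u" unfolding u_def by (intro cts_sum cts_mult cts_const ce) auto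
  have "ip u u = mean (\<lambda>x. \<Sum>j<k. cnj (a j) * (u x * cnj (e j x)))"
    by (rule arg_cong[of _ _ mean]) (simp add: u_def sum_distrib_left sum_distrib_right mult_ac)
  also have "\<dots> = (\<Sum>j<k. mean (\<lambda>x. cnj (a j) * (u x * cnj (e j x))))"
    by (rule mean_sum) (use u ce in \<open>auto intro!: cts_mult cts_cnj\<close>)
  also have "\<dots> = (\<Sum>j<k. of_real ((cmod (a j))\<^sup>2))"
    unfolding mean_cmult complex_norm_square
  proof (rule sum.cong)
    fix j assume "j \<in> {..<k}"
    then show "cnj (a j) * ip u (e j) = a j * cnj (a j)"
      using orthonormal_coeff[OF e, of j a] by (simp only: u_def lessThan_iff mult.commute[of "cnj (a j)"])
  qed simp
  finally have "complex_of_real (sqnorm u) = of_real (\<Sum>j<k. (cmod (a j))\<^sup>2)"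
    unfolding mean_self by simp
  then show ?thesis unfolding u_def of_real_eq_iff .
qed

lemma closed_invariant_sum:
  fixes k :: nat
  assumes E: "closed_invariant E" and e: "\<And>i. i < k \<Longrightarrow> e i \<in> E"
  shows "(\<lambda>x. \<Sum>i<k. a i * e i x) \<in> E"
  using e
proof (induction k)
  case 0 then show ?case using closed_invariant_zero[OF E] by simp
next
  case (Suc k)
  then show ?case using closed_invariant_lin[OF E, of "\<lambda>x. \<Sum>i<k. a i * e i x" "e k" "a k"] by simp
qed

lemma closed_invariant_eigenspace:
  assumes S: "equivariant_op S"
  shows "closed_invariant (eigenspace S \<rho>)"
  unfolding closed_invariant_def
proof (intro conjI ballI allI impI)
  show "cts u" if "u \<in> eigenspace S \<rho>" for u using that eigenspace_def by blast
  show "(\<lambda>_. 0) \<in> eigenspace S \<rho>" by (simp add: eigenspace_def equivariant_op_zero[OF S])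
  show "(\<lambda>x. u x + c * v x) \<in> eigenspace S \<rho>" if "u \<in> eigenspace S \<rho>" "v \<in> eigenspace S \<rho>" for u v c
    using that by (auto simp: eigenspace_def equivariant_op_linear[OF S] algebra_simps intro!: cts_add cts_mult)
  show "(\<lambda>x. u (g \<star> x)) \<in> eigenspace S \<rho>" if "u \<in> eigenspace S \<rho>" "g \<in> carrier G" for u g
    using that by (auto simp: eigenspace_def equivariant_op_act[OF S] act_closed intro!: cts_act)
next
  fix u assume u: "\<forall>e>0. \<exists>v\<in>eigenspace S \<rho>. \<forall>x\<in>X. cmod (u x - v x) \<le> e"
  have cu: "cts u" by (rule cts_uniform_limit) (use u in \<open>auto simp: eigenspace_def\<close>)
  obtain D where D: "D > 0" "\<And>u v x e. \<lbrakk>cts u; cts v; \<And>y. y \<in> X \<Longrightarrow> cmod (u y - v y) \<le> e; x \<in> X\<rbrakk>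
     \<Longrightarrow> cmod (S u x - S v x) \<le> D * e"
    using equivariant_op_sup_bound[OF S] by metis
  have "S u x = of_real \<rho> * u x" if x: "x \<in> X" for x
  proof -
    have "cmod (S u x - of_real \<rho> * u x) \<le> 0 + d" if d: "d > 0" for d
    proof -
      define e where "e = d / (D + \<bar>\<rho>\<bar> + 1)"
      have p: "D + \<bar>\<rho>\<bar> + 1 > 0" using D(1) by linarith
      then have e: "e > 0" using d by (simp add: e_def)
      obtain v where v: "v \<in> eigenspace S \<rho>" "\<forall>x\<in>X. cmod (u x - v x) \<le> e" using u e by blast
      have "cmod (S u x - S v x) \<le> D * e" using v x cu by (intro D(2)) (auto simp: eigenspace_def)
      moreover have "cmod (\<rho> * u x - \<rho> * v x) \<le> \<bar>\<rho>\<bar> * e"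
        using v(2) x by (auto simp: right_diff_distrib[symmetric] norm_mult intro!: mult_left_mono)
      moreover have "S v x = \<rho> * v x" using v x by (simp add: eigenspace_def)
      then have "cmod (S u x - of_real \<rho> * u x) \<le> cmod (S u x - S v x) + cmod (\<rho> * u x - \<rho> * v x)"
        using norm_triangle_ineq4[of "S u x - S v x" "\<rho> * u x - \<rho> * v x"] by simp
      ultimately have "cmod (S u x - of_real \<rho> * u x) \<le> (D + \<bar>\<rho>\<bar>) * e" by (simp add: algebra_simps)
      also have "\<dots> \<le> (D + \<bar>\<rho>\<bar> + 1) * e" using e by (intro mult_right_mono) auto
      also have "\<dots> = d" using p unfolding e_def by simp
      finally show ?thesis by simp
    qed
    then have "cmod (S u x - of_real \<rho> * u x) \<le> 0" by (rule field_le_epsilon)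
    then show ?thesis by simp
  qed
  then show "u \<in> eigenspace S \<rho>" using cu by (simp add: eigenspace_def)
qed

text \<open>
  A substitute for the dimension: for a finite-dimensional space its maximum is the dimension.
\<close>

definition orthonormal_sizes :: "('x \<Rightarrow> complex) set \<Rightarrow> nat set" where
  "orthonormal_sizes E = {k. \<exists>e. orthonormal k e \<and> (\<forall>i<k. e i \<in> E)}"

text \<open>
  For an orthonormal family \<open>e\<^sub>i\<close> in the eigenspace, apply the bound of \<open>S\<close> at \<open>x\<close> to
  the function \<open>\<Sum>\<^sub>i cnj (e\<^sub>i x) e\<^sub>i\<close>. This bounds \<open>\<Sum>\<^sub>i |e\<^sub>i x|\<^sup>2\<close> by
  \<open>(C / \<rho>)\<^sup>2\<close> for every \<open>x\<close>, and the integral of this sum is the size of the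
  family.
\<close>

lemma finite_eigenspace_sizes:
  assumes S: "equivariant_op S" and \<rho>: "\<rho> > 0"
  shows "finite (orthonormal_sizes (eigenspace S \<rho>))"
proof -
  obtain C where C: "C > 0" "\<And>u x. \<lbrakk>cts u; x \<in> X\<rbrakk> \<Longrightarrow> cmod (S u x) \<le> C * sqrt (sqnorm u)"
    using equivariant_op_bound[OF S] by metis
  have "real k \<le> (C / \<rho>)\<^sup>2" if k: "k \<in> orthonormal_sizes (eigenspace S \<rho>)" for k
  proof -
    obtain e where e: "orthonormal k e" "\<And>i. i < k \<Longrightarrow> e i \<in> eigenspace S \<rho>"
      using k unfolding orthonormal_sizes_def by blast
    have ce: "cts (e i)" if "i < k" for i using e(1) that orthonormal_def by blast
    have bessel: "(\<Sum>i<k. (cmod (e i x))\<^sup>2) \<le> (C / \<rho>)\<^sup>2" if x: "x \<in> X" for x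
    proof -
      define s where "s = (\<Sum>i<k. (cmod (e i x))\<^sup>2)"
      have s0: "s \<ge> 0" unfolding s_def by (intro sum_nonneg) auto
      define u where "u = (\<lambda>y. \<Sum>i<k. cnj (e i x) * e i y)"
      have u: "u \<in> eigenspace S \<rho>"
        unfolding u_def by (rule closed_invariant_sum[OF closed_invariant_eigenspace[OF S] e(2)])
      have "u x = of_real s"
        unfolding u_def s_def of_real_sum complex_norm_square by (simp add: mult.commute)
      moreover have "sqnorm u = s" unfolding u_def s_def by (simp add: sqnorm_orthonormal[OF e(1)])
      ultimately have "\<rho> * s \<le> C * sqrt s"
        using C(2)[of u x] u x \<rho> s0 by (simp add: eigenspace_def norm_mult)
      then have "\<rho> * sqrt s * sqrt s \<le> C * sqrt s" using s0 by (simp add: mult.assoc)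
      then have "sqrt s \<le> C / \<rho>"
      proof (cases "s = 0")
        case False
        then have "sqrt s > 0" using s0 by simp
        then have "\<rho> * sqrt s \<le> C" using \<open>\<rho> * sqrt s * sqrt s \<le> C * sqrt s\<close> by simp
        then show ?thesis using \<rho> by (simp add: field_simps)
      qed (use C \<rho> in simp)
      then show ?thesis unfolding s_def[symmetric] by (rule sqrt_le_D)
    qed
    have "of_nat k = (\<Sum>i<k. ip (e i) (e i))"
      using e(1) unfolding orthonormal_def by simp
    also have "\<dots> = mean (\<lambda>x. \<Sum>i<k. e i x * cnj (e i x))"
      by (rule mean_sum[symmetric]) (use ce in \<open>auto intro!: cts_mult cts_cnj\<close>)
    also have "\<dots> = mean (\<lambda>x. of_real (\<Sum>i<k. (cmod (e i x))\<^sup>2))"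
      unfolding of_real_sum complex_norm_square ..
    finally have "real k = cmod (mean (\<lambda>x. of_real (\<Sum>i<k. (cmod (e i x))\<^sup>2)))"
      by (metis norm_of_nat)
    also have "\<dots> \<le> (C / \<rho>)\<^sup>2"
    proof (rule mean_bound)
      fix x assume "x \<in> X"
      then show "cmod (complex_of_real (\<Sum>i<k. (cmod (e i x))\<^sup>2)) \<le> (C / \<rho>)\<^sup>2"
        using bessel unfolding norm_of_real by (simp add: sum_nonneg)
    qed
    finally show ?thesis .
  qed
  then have "orthonormal_sizes (eigenspace S \<rho>) \<subseteq> {..nat \<lfloor>(C / \<rho>)\<^sup>2\<rfloor>}"
    by (auto simp: le_nat_floor)
  then show ?thesis using finite_subset by blast
qed

text \<open>
  One Gram-Schmidt step. It shows that the size of a largest orthonormal family, if finite, is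
  strictly monotone on closed invariant subspaces.
\<close>

lemma orthonormal_extend:
  assumes E: "closed_invariant E" and F: "closed_invariant F" and e: "orthonormal k e" "\<And>i. i < k \<Longrightarrow> e i \<in> F"
    and FE: "F \<subseteq> E" and v: "v \<in> E" "v \<notin> F"
  shows "Suc k \<in> orthonormal_sizes E"
proof -
  have ce: "cts (e i)" if "i < k" for i using e(1) that orthonormal_def by blast
  have cv: "cts v" by (rule closed_invariant_cts[OF E v(1)])
  \<comment> \<open>The orthogonal projection of \<open>v\<close> to the span of the family.\<close>
  define p where "p = (\<lambda>x. \<Sum>i<k. mean (\<lambda>y. v y * cnj (e i y)) * e i x)"
  have p: "p \<in> F" unfolding p_def by (rule closed_invariant_sum[OF F e(2)])
  define w where "w = (\<lambda>x. v x + (-1) * p x)"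
  have wE: "w \<in> E" unfolding w_def using p FE v by (intro closed_invariant_lin[OF E]) auto
  have cw: "cts w" by (rule closed_invariant_cts[OF E wE])
  have orth: "ip w (e j) = 0" if j: "j < k" for j
  proof -
    have "ip w (e j) = mean (\<lambda>x. v x * cnj (e j x) - p x * cnj (e j x))"
      by (simp add: w_def algebra_simps)
    also have "\<dots> = ip v (e j) - ip p (e j)"
      by (rule mean_diff) (intro cts_mult cts_cnj cv ce j closed_invariant_cts[OF F p])+
    also have "ip p (e j) = ip v (e j)"
      unfolding p_def by (rule orthonormal_coeff[OF e(1) j])
    finally show ?thesis by simp
  qed
  have "sqnorm w \<noteq> 0"
  proof
    assume "sqnorm w = 0"
    then have "w x = 0" if "x \<in> X" for x using sqnorm_zero[OF cw] that by blast
    then have "v \<in> F" by (intro closed_invariant_cong[OF F p]) (simp add: w_def)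
    then show False using v by blast
  qed
  then have n: "sqnorm w > 0" using sqnorm_nonneg[of w] by linarith
  define c where "c = complex_of_real (1 / sqrt (sqnorm w))"
  have "(cmod c)\<^sup>2 = 1 / sqnorm w" using n by (simp add: c_def power_divide norm_divide sqnorm_nonneg)
  then have nw: "sqnorm (\<lambda>x. c * w x) = 1" using n by (simp add: sqnorm_cmult)
  define e' where "e' = (\<lambda>i. if i = k then (\<lambda>x. c * w x) else e i)"
  have cross: "mean (\<lambda>x. c * w x * cnj (e j x)) = 0" if "j < k" for j
    using orth[OF that] mean_cmult[of c "\<lambda>x. w x * cnj (e j x)"] by (simp add: mult.assoc)
  have cross': "mean (\<lambda>x. e j x * cnj (c * w x)) = 0" if "j < k" for j
    using cross[OF that] mean_cnj[of "\<lambda>x. c * w x * cnj (e j x)"] by (simp add: mult_ac)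
  have self: "mean (\<lambda>x. c * w x * cnj (c * w x)) = 1"
    using mean_self[of "\<lambda>x. c * w x"] nw by simp
  have "orthonormal (Suc k) e'"
    unfolding orthonormal_def
  proof (intro conjI allI impI)
    fix i assume "i < Suc k"
    then show "cts (e' i)" using ce cw by (auto simp: e'_def intro!: cts_mult)
    fix j assume "j < Suc k"
    then show "ip (e' i) (e' j) = (if i = j then 1 else 0)"
      using \<open>i < Suc k\<close> cross cross' self e(1) unfolding e'_def orthonormal_def
      by (cases "i = k"; cases "j = k") (simp_all only: if_True if_False, auto)
  qed
  moreover have "\<forall>i<Suc k. e' i \<in> E"
    using e(2) FE closed_invariant_cmult[OF E wE] by (auto simp: e'_def less_Suc_eq)
  ultimately show ?thesis unfolding orthonormal_sizes_def by blast
qed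

definition irreducible_space :: "('x \<Rightarrow> complex) set \<Rightarrow> bool" where
  "irreducible_space V \<longleftrightarrow> closed_invariant V \<and> (\<exists>v\<in>V. \<exists>x\<in>X. v x \<noteq> 0) \<and>
     (\<forall>F. closed_invariant F \<longrightarrow> F \<subseteq> V \<longrightarrow> (\<exists>v\<in>F. \<exists>x\<in>X. v x \<noteq> 0) \<longrightarrow> F = V)"

text \<open>
  A nonzero closed invariant subspace for which the largest orthonormal family is as small as
  possible.
\<close>

lemma irreducible_subspace_exists:
  assumes E: "closed_invariant E" and fin: "finite (orthonormal_sizes E)"
    and nz: "w \<in> E" "\<exists>x\<in>X. w x \<noteq> 0"
  obtains V where "irreducible_space V" "V \<subseteq> E"
proof -
  define Q where "Q = (\<lambda>V. closed_invariant V \<and> V \<subseteq> E \<and> (\<exists>v\<in>V. \<exists>x\<in>X. v x \<noteq> 0))"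
  define d where "d = (\<lambda>V. Max (orthonormal_sizes V))"
  have "Q E" unfolding Q_def using E nz by blast
  then obtain V where V: "Q V" "\<And>F. Q F \<Longrightarrow> d V \<le> d F"
    using ex_has_least_nat[of Q E d] by blast
  have sizes: "finite (orthonormal_sizes F)" if "F \<subseteq> E" for F
    using fin by (rule finite_subset[rotated]) (use that in \<open>auto simp: orthonormal_sizes_def\<close>)
  have "irreducible_space V"
    unfolding irreducible_space_def
  proof (intro conjI allI impI)
    show "closed_invariant V" "\<exists>v\<in>V. \<exists>x\<in>X. v x \<noteq> 0" using V(1) unfolding Q_def by blast+
    fix F assume F: "closed_invariant F" "F \<subseteq> V" "\<exists>v\<in>F. \<exists>x\<in>X. v x \<noteq> 0"
    then have QF: "Q F" using V(1) unfolding Q_def by blast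
    show "F = V"
    proof (rule ccontr)
      assume "F \<noteq> V"
      then obtain v where v: "v \<in> V" "v \<notin> F" using F(2) by blast
      have finF: "finite (orthonormal_sizes F)" and finV: "finite (orthonormal_sizes V)"
        using sizes QF V(1) unfolding Q_def by blast+
      have "0 \<in> orthonormal_sizes F" by (auto simp: orthonormal_sizes_def orthonormal_def)
      then have "d F \<in> orthonormal_sizes F" unfolding d_def using finF by (intro Max_in) auto
      then obtain e where "orthonormal (d F) e" "\<And>i. i < d F \<Longrightarrow> e i \<in> F"
        unfolding orthonormal_sizes_def by blast
      then have "Suc (d F) \<in> orthonormal_sizes V"
        using orthonormal_extend[of V F "d F" e v] V(1) F v unfolding Q_def by blast
      then have "Suc (d F) \<le> d V" unfolding d_def using finV by (intro Max_ge) (auto simp: d_def)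
      then show False using V(2)[OF QF] by simp
    qed
  qed
  then show thesis using that V(1) unfolding Q_def by blast
qed

text \<open>
  With the averages \<open>R\<close> of \<open>f\<close> and \<open>Q\<close> of \<open>h\<close>, take \<open>S = R Q R\<close>. It is
  nonzero because \<open>\<langle>S h, h\<rangle> = \<langle>Q (R h), R h\<rangle>\<close>, and strict positivity of \<open>R\<close>
  and \<open>Q\<close> applies in turn. On an eigenspace of \<open>S\<close> the map \<open>L = Q R\<close> is
  inverted by \<open>L' = R / \<rho>\<close>, which is why the symmetric product of three factors is used.
\<close>

theorem equivalent_irreducible_subspaces:
  assumes E: "closed_invariant E" and F: "closed_invariant F" and f: "f \<in> E" and h: "h \<in> F"
    and nz: "ip f h \<noteq> 0"
  obtains V L L' where "irreducible_space V" "V \<subseteq> E" "equivariant_op L" "equivariant_op L'"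
    "\<forall>u. cts u \<longrightarrow> L u \<in> F" "\<forall>v\<in>V. \<forall>x\<in>X. L' (L v) x = v x"
proof -
  have cf: "cts f" and ch: "cts h" using closed_invariant_cts E F f h by blast+
  obtain R where "averaging_op f R" using averaging_op_exists[OF cf] by blast
  note R = averaging_opD[OF this]
  obtain Q where "averaging_op h Q" using averaging_op_exists[OF ch] by blast
  note Q = averaging_opD[OF this]
  note cR = equivariant_op_cts[OF R(1)] and cQ = equivariant_op_cts[OF Q(1)]
  define S where "S = (\<lambda>u. R (Q (R u)))"
  have QR: "equivariant_op (\<lambda>u. Q (R u))" by (rule equivariant_op_comp[OF Q(1) R(1)])
  have S1: "equivariant_op S" unfolding S_def by (rule equivariant_op_comp[OF R(1) QR])
  have S4: "compact_op S" unfolding S_def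
    by (rule compact_op_comp[OF R(1) QR compact_op_comp[OF Q(1) R(1) R(4)]])
  have symR: "ip (R u) v = ip u (R v)" if "cts u" "cts v" for u v
    using R(2) that unfolding symmetric_op_def by blast
  have symQ: "ip (Q u) v = ip u (Q v)" if "cts u" "cts v" for u v
    using Q(2) that unfolding symmetric_op_def by blast
  have S2: "symmetric_op S"
    unfolding symmetric_op_def S_def
  proof (intro allI impI)
    fix u v assume u: "cts u" and v: "cts v"
    have "ip (R (Q (R u))) v = ip (Q (R u)) (R v)"
      by (rule symR[OF cQ[OF cR[OF u]] v])
    also have "\<dots> = ip (R u) (Q (R v))" by (rule symQ[OF cR[OF u] cR[OF v]])
    also have "\<dots> = ip u (R (Q (R v)))" by (rule symR[OF u cQ[OF cR[OF v]]])
    finally show "ip (R (Q (R u))) v = ip u (R (Q (R v)))" .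
  qed
  have form: "quadratic_form S u = quadratic_form Q (R u)" if u: "cts u" for u
    unfolding quadratic_form_def S_def using symR[OF cQ[OF cR[OF u]] u] by simp
  have S3: "positive_op S"
    unfolding positive_op_def quadratic_form_def[symmetric]
    using form quadratic_form_nonneg[OF Q(3) cR] by simp
  have "0 < Re (ip (R h) h)"
  proof (rule R(6)[OF ch])
    have "ip h f = cnj (ip f h)"
      by (simp add: mean_cnj[symmetric] mult.commute)
    then show "ip h f \<noteq> 0" using nz by simp
  qed
  then have "ip (R h) h \<noteq> 0" by auto
  then have "quadratic_form S h > 0" using Q(6)[OF cR[OF ch]] form[OF ch] by (simp add: quadratic_form_def)
  then obtain \<rho> w where \<rho>: "\<rho> > 0" and w: "w \<in> eigenspace S \<rho>" "\<exists>x\<in>X. w x \<noteq> 0"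
    using positive_compact_op_eigenfunction[OF S1 S2 S3 S4 ch] by blast
  obtain V where V: "irreducible_space V" "V \<subseteq> eigenspace S \<rho>"
    by (rule irreducible_subspace_exists[OF closed_invariant_eigenspace[OF S1] finite_eigenspace_sizes[OF S1 \<rho>] w])
  have VE: "V \<subseteq> E"
  proof
    fix v assume "v \<in> V"
    then have v: "cts v" "\<And>x. x \<in> X \<Longrightarrow> S v x = of_real \<rho> * v x" using V(2) by (auto simp: eigenspace_def)
    have "S v \<in> E" unfolding S_def by (rule R(5)[OF E f cQ[OF cR[OF v(1)]]])
    then have "(\<lambda>x. of_real (1 / \<rho>) * S v x) \<in> E" by (rule closed_invariant_cmult[OF E])
    then show "v \<in> E" by (rule closed_invariant_cong[OF E]) (use v(2) \<rho> in simp)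
  qed
  define L where "L = (\<lambda>u. Q (R u))"
  have scale: "equivariant_op (\<lambda>u x. of_real (1 / \<rho>) * R u x)"
    unfolding equivariant_op_def
  proof (intro conjI allI ballI impI)
    obtain C where C: "C > 0" "\<And>u x. \<lbrakk>cts u; x \<in> X\<rbrakk> \<Longrightarrow> cmod (R u x) \<le> C * sqrt (sqnorm u)"
      using equivariant_op_bound[OF R(1)] by metis
    show "\<exists>C>0. \<forall>u. \<forall>x\<in>X. cts u \<longrightarrow> cmod (of_real (1 / \<rho>) * R u x) \<le> C * sqrt (sqnorm u)"
      using C \<rho> by (intro exI[of _ "C / \<rho>"]) (auto simp: norm_mult norm_divide field_simps)
    show "cts (\<lambda>x. of_real (1 / \<rho>) * R u x)" if "cts u" for u by (intro cts_mult cts_const cR that)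
  qed (auto simp: equivariant_op_linear[OF R(1)] equivariant_op_act[OF R(1)] algebra_simps)
  show thesis
  proof (rule that[OF V(1) VE])
    show "equivariant_op L" unfolding L_def by (rule QR)
    show "equivariant_op (\<lambda>u x. of_real (1 / \<rho>) * R u x)" by (rule scale)
    show "\<forall>u. cts u \<longrightarrow> L u \<in> F" unfolding L_def using Q(5)[OF F h cR] by blast
    show "\<forall>v\<in>V. \<forall>x\<in>X. of_real (1 / \<rho>) * R (L v) x = v x"
      using V(2) \<rho> by (auto simp: eigenspace_def S_def L_def)
  qed
qed

section \<open>Invariant subspaces and multiplicative functionals\<close>

lemma closed_invariant_Int:
  assumes "closed_invariant E" "closed_invariant F"
  shows "closed_invariant (E \<inter> F)"
  unfolding closed_invariant_def
proof (intro conjI ballI allI impI)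
  show "(\<lambda>_. 0) \<in> E \<inter> F" using assms closed_invariant_zero by blast
  show "cts u" if "u \<in> E \<inter> F" for u using assms(1) that closed_invariant_cts by blast
  show "(\<lambda>x. u x + c * v x) \<in> E \<inter> F" if "u \<in> E \<inter> F" "v \<in> E \<inter> F" for u v c
    using that assms by (simp add: closed_invariant_lin)
  show "(\<lambda>x. u (g \<star> x)) \<in> E \<inter> F" if "u \<in> E \<inter> F" "g \<in> carrier G" for u g
    using that assms by (simp add: closed_invariant_act)
  show "u \<in> E \<inter> F" if u: "\<forall>e>0. \<exists>v\<in>E \<inter> F. \<forall>x\<in>X. cmod (u x - v x) \<le> e" for u
    by (rule IntI; rule closed_invariant_closed, rule assms) (use u in blast)+
qed

lemma closed_invariant_vimage:
  assumes S: "equivariant_op S" and V: "closed_invariant V"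
  shows "closed_invariant {u. cts u \<and> S u \<in> V}"
  unfolding closed_invariant_def mem_Collect_eq
proof (intro conjI ballI allI impI; (elim CollectE conjE)?)
  show "S (\<lambda>_. 0) \<in> V"
    by (rule closed_invariant_cong[OF V closed_invariant_zero[OF V]]) (simp add: equivariant_op_zero[OF S])
next
  fix u v c assume *: "cts u" "S u \<in> V" "cts v" "S v \<in> V"
  then show "cts (\<lambda>x. u x + c * v x)" by (intro cts_add cts_mult cts_const)
  show "S (\<lambda>x. u x + c * v x) \<in> V"
    by (rule closed_invariant_cong[OF V closed_invariant_lin[OF V *(2,4), of c]]) (simp add: equivariant_op_linear[OF S *(1,3)])
next
  fix u g assume *: "cts u" "S u \<in> V" "g \<in> carrier G"
  then show "cts (\<lambda>x. u (g \<star> x))" by (intro cts_act)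
  show "S (\<lambda>x. u (g \<star> x)) \<in> V"
    by (rule closed_invariant_cong[OF V closed_invariant_act[OF V *(2,3)]]) (simp add: equivariant_op_act[OF S *(1,3)])
next
  fix u assume u: "\<forall>e>0. \<exists>v\<in>{u. cts u \<and> S u \<in> V}. \<forall>x\<in>X. cmod (u x - v x) \<le> e"
  show cu: "cts u" by (rule cts_uniform_limit) (use u in blast)
  obtain D where D: "D > 0" "\<And>u v x e. \<lbrakk>cts u; cts v; \<And>y. y \<in> X \<Longrightarrow> cmod (u y - v y) \<le> e; x \<in> X\<rbrakk>
     \<Longrightarrow> cmod (S u x - S v x) \<le> D * e"
    using equivariant_op_sup_bound[OF S] by metis
  show "S u \<in> V"
  proof (rule closed_invariant_closed[OF V])
    fix e :: real assume "e > 0"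
    then have "e / D > 0" using D(1) by simp
    then obtain v where v: "cts v" "S v \<in> V" "\<forall>x\<in>X. cmod (u x - v x) \<le> e / D" using u by blast
    have "cmod (S u x - S v x) \<le> e" if "x \<in> X" for x
      using D(2)[OF cu v(1), of "e / D" x] v(3) that D(1) by simp
    then show "\<exists>v\<in>V. \<forall>x\<in>X. cmod (S u x - v x) \<le> e" using v(2) by blast
  qed
qed simp_all

lemma mean_close:
  assumes "cts u" "cts v" "\<And>x. x \<in> X \<Longrightarrow> cmod (u x - v x) \<le> e"
  shows "cmod (mean u - mean v) \<le> e"
  using mean_bound[of "\<lambda>x. u x - v x" e] assms by (simp add: mean_diff)

lemma closed_invariant_mean_zero:
  assumes A: "closed_invariant A"
  shows "closed_invariant {u \<in> A. mean u = 0}"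
  unfolding closed_invariant_def mem_Collect_eq
proof (intro conjI ballI allI impI; (elim CollectE conjE)?)
  show "cts u" if "u \<in> A" for u by (rule closed_invariant_cts[OF A that])
  show "(\<lambda>_. 0) \<in> A" by (rule closed_invariant_zero[OF A])
  show "mean (\<lambda>_. 0) = 0" by (rule mean_const)
  fix u v c assume uv: "u \<in> A" "mean u = 0" "v \<in> A" "mean v = 0"
  show "(\<lambda>x. u x + c * v x) \<in> A" by (rule closed_invariant_lin[OF A uv(1,3)])
  have "mean (\<lambda>x. u x + c * v x) = mean u + mean (\<lambda>x. c * v x)"
    by (rule mean_add) (intro cts_mult cts_const closed_invariant_cts[OF A] uv)+
  then show "mean (\<lambda>x. u x + c * v x) = 0" using uv by (simp add: mean_cmult)
next
  fix u g assume u: "u \<in> A" "mean u = 0" and g: "g \<in> carrier G"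
  show "(\<lambda>x. u (g \<star> x)) \<in> A" by (rule closed_invariant_act[OF A u(1) g])
  show "mean (\<lambda>x. u (g \<star> x)) = 0" using mean_act[OF g closed_invariant_cts[OF A u(1)]] u by simp
next
  fix u assume u: "\<forall>e>0. \<exists>v\<in>{u \<in> A. mean u = 0}. \<forall>x\<in>X. cmod (u x - v x) \<le> e"
  show uA: "u \<in> A" by (rule closed_invariant_closed[OF A]) (use u in blast)
  have "cmod (mean u) \<le> 0 + e" if e: "e > 0" for e
  proof -
    obtain v where v: "v \<in> A" "mean v = 0" "\<forall>x\<in>X. cmod (u x - v x) \<le> e" using u e by blast
    then show ?thesis using mean_close[of u v e] closed_invariant_cts[OF A] uA by simp
  qed
  then have "cmod (mean u) \<le> 0" by (rule field_le_epsilon)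
  then show "mean u = 0" by simp
qed

lemma closed_invariant_cnj:
  assumes E: "closed_invariant E"
  shows "closed_invariant {u. (\<lambda>x. cnj (u x)) \<in> E}"
  unfolding closed_invariant_def mem_Collect_eq
proof (intro conjI ballI allI impI; (elim CollectE)?)
  show "cts u" if "(\<lambda>x. cnj (u x)) \<in> E" for u
    using cts_cnj[OF closed_invariant_cts[OF E that]] by simp
  show "(\<lambda>x. cnj 0) \<in> E" using closed_invariant_zero[OF E] by simp
  show "(\<lambda>x. cnj (u x + c * v x)) \<in> E" if "(\<lambda>x. cnj (u x)) \<in> E" "(\<lambda>x. cnj (v x)) \<in> E" for u v c
    using closed_invariant_lin[OF E that, of "cnj c"] by simp
  show "(\<lambda>x. cnj (u (g \<star> x))) \<in> E" if "(\<lambda>x. cnj (u x)) \<in> E" "g \<in> carrier G" for u g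
    by (rule closed_invariant_act[OF E that])
next
  fix u assume u: "\<forall>e>0. \<exists>v\<in>{u. (\<lambda>x. cnj (u x)) \<in> E}. \<forall>x\<in>X. cmod (u x - v x) \<le> e"
  show "(\<lambda>x. cnj (u x)) \<in> E"
  proof (rule closed_invariant_closed[OF E])
    fix e :: real assume "e > 0"
    then obtain v where v: "(\<lambda>x. cnj (v x)) \<in> E" "\<forall>x\<in>X. cmod (u x - v x) \<le> e" using u by blast
    have "cmod (cnj (u x) - cnj (v x)) \<le> e" if "x \<in> X" for x
      using v(2) that by (simp flip: complex_cnj_diff)
    then show "\<exists>v\<in>E. \<forall>x\<in>X. cmod (cnj (u x) - v x) \<le> e"
      by (intro bexI[of _ "\<lambda>x. cnj (v x)"] ballI v(1))
  qed
qed

text \<open>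
  If \<open>\<psi> u\<close> were larger than the supremum of \<open>|u|\<close>, rescale to \<open>\<psi> v = 1\<close> with
  \<open>|v| \<le> r < 1\<close>. The geometric series \<open>w = v + v\<^sup>2 + \<dots>\<close> belongs to \<open>A\<close>
  and satisfies \<open>w = v + v w\<close>, so that \<open>\<psi> w = 1 + \<psi> w\<close>.
\<close>

lemma multiplicative_functional_bounded:
  assumes A: "closed_invariant A" and one: "(\<lambda>_. 1) \<in> A" and mult: "\<And>u v. \<lbrakk>u \<in> A; v \<in> A\<rbrakk> \<Longrightarrow> (\<lambda>x. u x * v x) \<in> A"
    and cong: "\<And>u v. (\<And>x. x \<in> X \<Longrightarrow> u x = v x) \<Longrightarrow> \<psi> u = \<psi> v"
    and lin: "\<And>u v c. \<lbrakk>u \<in> A; v \<in> A\<rbrakk> \<Longrightarrow> \<psi> (\<lambda>x. u x + c * v x) = \<psi> u + c * \<psi> v"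
    and \<psi>mult: "\<And>u v. \<lbrakk>u \<in> A; v \<in> A\<rbrakk> \<Longrightarrow> \<psi> (\<lambda>x. u x * v x) = \<psi> u * \<psi> v"
    and u: "u \<in> A" and B: "\<And>x. x \<in> X \<Longrightarrow> cmod (u x) \<le> B"
  shows "cmod (\<psi> u) \<le> B"
proof (rule ccontr)
  assume "\<not> cmod (\<psi> u) \<le> B"
  then have big: "B < cmod (\<psi> u)" by simp
  obtain x0 where "x0 \<in> X" using topspace_M_nonempty by blast
  then have B0: "0 \<le> B" using B norm_ge_zero order_trans by blast
  define r where "r = B / cmod (\<psi> u)"
  have "cmod (\<psi> u) > 0" using B0 big by linarith
  then have r: "0 \<le> r" "r < 1" using B0 big by (simp_all add: r_def)
  define v where "v = (\<lambda>x. (1 / \<psi> u) * u x)"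
  have zero: "\<psi> (\<lambda>_. 0) = 0" using lin[OF one one, of "-1"] by simp
  have vA: "v \<in> A" unfolding v_def by (rule closed_invariant_cmult[OF A u])
  have "\<psi> v = 1"
    using lin[OF closed_invariant_zero[OF A] u, of "1 / \<psi> u"] zero big B0 by (auto simp: v_def)
  have vr: "cmod (v x) \<le> r" if "x \<in> X" for x
    using B[OF that] big B0 by (auto simp: v_def r_def norm_mult norm_divide intro!: divide_right_mono)
  define p where "p = (\<lambda>n x. \<Sum>i<n. v x ^ Suc i)"
  have pw: "(\<lambda>x. v x ^ Suc i) \<in> A" for i
    by (induction i) (use vA mult[OF vA] in auto)
  have pA: "p n \<in> A" for n
  proof (induction n)
    case 0 then show ?case using closed_invariant_zero[OF A] by (simp add: p_def)
  next
    case (Suc n)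
    then show ?case using closed_invariant_lin[OF A Suc pw[of n], of 1] by (simp add: p_def)
  qed
  define w where "w = (\<lambda>x. v x / (1 - v x))"
  have ne: "1 - v x \<noteq> 0" if "x \<in> X" for x using vr[OF that] r by auto
  have wp: "w x - p n x = v x ^ Suc n / (1 - v x)" if x: "x \<in> X" for n x
  proof -
    have "p n x * (1 - v x) = v x - v x ^ Suc n"
    proof (induction n)
      case (Suc n)
      have "p (Suc n) x * (1 - v x) = p n x * (1 - v x) + v x ^ Suc n * (1 - v x)"
        by (simp add: p_def distrib_right)
      then show ?case unfolding Suc.IH by (simp add: algebra_simps)
    qed (simp add: p_def)
    then show ?thesis using ne[OF x] by (simp add: w_def field_simps)
  qed
  have wA: "w \<in> A"
  proof (rule closed_invariant_closed[OF A])
    fix e :: real assume e: "e > 0"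
    then have "e * (1 - r) > 0" using r by simp
    then obtain n where n: "r ^ n < e * (1 - r)" using real_arch_pow_inv r(2) by blast
    have "cmod (w x - p n x) \<le> e" if x: "x \<in> X" for x
    proof -
      have d: "1 - r \<le> cmod (1 - v x)" using vr[OF x] norm_triangle_ineq2[of 1 "v x"] by simp
      have "cmod (v x) ^ Suc n \<le> r ^ Suc n" using vr[OF x] by (intro power_mono) auto
      also have "\<dots> \<le> r ^ n" using r by (simp add: mult_left_le_one_le)
      also have "\<dots> \<le> e * (1 - r)" using n by simp
      also have "\<dots> \<le> e * cmod (1 - v x)" using d e by simp
      finally have "cmod (v x) ^ Suc n \<le> e * cmod (1 - v x)" .
      moreover have "cmod (1 - v x) > 0" using ne[OF x] by simp
      ultimately show ?thesis unfolding wp[OF x] by (simp add: norm_divide norm_power norm_mult divide_le_eq)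
    qed
    then show "\<exists>v\<in>A. \<forall>x\<in>X. cmod (w x - v x) \<le> e" using pA by blast
  qed
  have "\<psi> w = \<psi> (\<lambda>x. v x + 1 * (v x * w x))"
    by (rule cong) (use ne in \<open>simp add: w_def field_simps\<close>)
  also have "\<dots> = 1 + \<psi> w"
    using lin[OF vA mult[OF vA wA], of 1] \<psi>mult[OF vA wA] \<open>\<psi> v = 1\<close> by simp
  finally show False by simp
qed

text \<open>
  In the kernel hull of \<open>f\<close> and 1 no element depends on \<open>y\<close>, and both \<open>\<psi>\<close> and
  the mean are constant on it. The invariant limit does not depend on \<open>y\<close> either, hence is
  constant by transitivity, and \<open>\<psi>\<close> and the mean agree on constants.
\<close>

lemma invariant_functional_eq_mean:
  assumes A: "closed_invariant A" and one: "(\<lambda>_. 1) \<in> A" and \<psi>1: "\<psi> (\<lambda>_. 1) = 1"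
    and lin: "\<And>u v c. \<lbrakk>u \<in> A; v \<in> A\<rbrakk> \<Longrightarrow> \<psi> (\<lambda>x. u x + c * v x) = \<psi> u + c * \<psi> v"
    and bound: "\<And>u B. \<lbrakk>u \<in> A; \<And>x. x \<in> X \<Longrightarrow> cmod (u x) \<le> B\<rbrakk> \<Longrightarrow> cmod (\<psi> u) \<le> B"
    and inv: "\<And>u g. \<lbrakk>u \<in> A; g \<in> carrier G\<rbrakk> \<Longrightarrow> \<psi> (\<lambda>x. u (g \<star> x)) = \<psi> u"
    and f: "f \<in> A"
  shows "\<psi> f = mean f"
proof -
  note cf = closed_invariant_cts[OF A f]
  obtain K where K: "kernel K"
    and Kinv: "\<And>g x y. \<lbrakk>g \<in> carrier G; x \<in> X; y \<in> X\<rbrakk> \<Longrightarrow> K (g \<star> x) (g \<star> y) = K x y"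
    and approx: "\<And>e. e > 0 \<Longrightarrow> \<exists>L\<in>orbit_hull f (\<lambda>_. 1). \<forall>x\<in>X. \<forall>y\<in>X. cmod (K x y - L x y) \<le> e"
    using invariant_kernel_in_closed_hull[OF cf cts_const[of 1]] by metis
  have hull: "(\<lambda>x. L x y) \<in> A \<and> \<psi> (\<lambda>x. L x y) = \<psi> f \<and> mean (\<lambda>x. L x y) = mean f \<and> (\<forall>x y'. L x y = L x y')"
    if "L \<in> orbit_hull f (\<lambda>_. 1)" for L y
    using that
  proof induction
    case (orbit g)
    then show ?case using inv[OF f] mean_act[OF _ cf] closed_invariant_act[OF A f] by simp
  next
    case (midpoint K L)
    then have KA: "(\<lambda>x. K x y) \<in> A" and LA: "(\<lambda>x. L x y) \<in> A" by blast+
    have sA: "(\<lambda>x. K x y + 1 * L x y) \<in> A" by (rule closed_invariant_lin[OF A KA LA])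
    have eq: "(\<lambda>x. (K x y + L x y) / 2) = (\<lambda>x. 0 + (1/2) * (K x y + 1 * L x y))" by (simp add: field_simps)
    have z: "\<psi> (\<lambda>_. 0) = 0" using lin[OF one one, of "-1"] by simp
    have "\<psi> (\<lambda>x. (K x y + L x y) / 2) = \<psi> f"
      unfolding eq lin[OF closed_invariant_zero[OF A] sA] lin[OF KA LA] using midpoint.IH z by simp
    moreover have "(\<lambda>x. (K x y + L x y) / 2) \<in> A"
      unfolding eq by (rule closed_invariant_lin[OF A closed_invariant_zero[OF A] sA])
    moreover have "mean (\<lambda>x. (K x y + L x y) / 2) = (mean (\<lambda>x. K x y) + mean (\<lambda>x. L x y)) / 2"
      using mean_add[OF closed_invariant_cts[OF A KA] closed_invariant_cts[OF A LA]] mean_cmult[of "1/2" "\<lambda>x. K x y + L x y"]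
      by simp
    moreover have "\<forall>x y'. (K x y + L x y) / 2 = (K x y' + L x y') / 2" using midpoint.IH by metis
    ultimately show ?case using midpoint.IH by simp
  qed
  obtain x0 where x0: "x0 \<in> X" using topspace_M_nonempty by blast
  have K_right: "K x y = K x y'" if xy: "x \<in> X" "y \<in> X" "y' \<in> X" for x y y'
  proof -
    have "cmod (K x y - K x y') \<le> 0 + e" if "e > 0" for e
    proof -
      obtain L where L: "L \<in> orbit_hull f (\<lambda>_. 1)" "\<forall>x\<in>X. \<forall>y\<in>X. cmod (K x y - L x y) \<le> e / 2"
        using approx[of "e / 2"] \<open>e > 0\<close> by auto
      have "L x y = L x y'" using hull[OF L(1)] by blast
      then have "cmod (K x y - K x y') = cmod ((K x y - L x y) - (K x y' - L x y'))" by simp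
      also have "\<dots> \<le> cmod (K x y - L x y) + cmod (K x y' - L x y')" by (rule norm_triangle_ineq4)
      also have "\<dots> \<le> e / 2 + e / 2" using L(2) xy by (intro add_mono) auto
      finally show ?thesis by simp
    qed
    then have "cmod (K x y - K x y') \<le> 0" by (rule field_le_epsilon)
    then show ?thesis by simp
  qed
  have Kconst: "K x x0 = K x0 x0" if x: "x \<in> X" for x
  proof -
    obtain g where g: "g \<in> carrier G" "g \<star> x0 = x" using transitive[OF x0 x] by blast
    have "K x x0 = K x x" by (rule K_right[OF x x0 x])
    also have "\<dots> = K x0 x0" using Kinv[OF g(1) x0 x0] g(2) by simp
    finally show ?thesis .
  qed
  have "cmod (\<psi> f - mean f) \<le> 0 + e" if "e > 0" for e
  proof -
    obtain L where L: "L \<in> orbit_hull f (\<lambda>_. 1)" "\<forall>x\<in>X. \<forall>y\<in>X. cmod (K x y - L x y) \<le> e / 2"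
      using approx[of "e / 2"] \<open>e > 0\<close> by auto
    note h = hull[OF L(1), of x0]
    define d where "d = (\<lambda>x. L x x0 + (- K x0 x0) * 1)"
    have dA: "d \<in> A" unfolding d_def using h by (intro closed_invariant_lin[OF A _ one]) auto
    have db: "cmod (d x) \<le> e / 2" if "x \<in> X" for x
      using L(2) Kconst[OF that] that x0 by (simp add: d_def norm_minus_commute) (metis norm_minus_commute)
    have "\<psi> d = \<psi> f - K x0 x0" unfolding d_def using h lin[OF _ one, of "\<lambda>x. L x x0" "- K x0 x0"] \<psi>1 by simp
    then have 1: "cmod (\<psi> f - K x0 x0) \<le> e / 2" using bound[OF dA db] by simp
    have "mean d = mean f - K x0 x0"
      unfolding d_def using h mean_diff[OF closed_invariant_cts[OF A] cts_const, of "\<lambda>x. L x x0" "K x0 x0"] by (simp add: mean_const)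
    then have 2: "cmod (mean f - K x0 x0) \<le> e / 2" using mean_bound[of d, OF db] by simp
    show ?thesis using norm_triangle_ineq4[of "\<psi> f - K x0 x0" "mean f - K x0 x0"] 1 2 by simp
  qed
  then have "cmod (\<psi> f - mean f) \<le> 0" by (rule field_le_epsilon)
  then show ?thesis by simp
qed

end

section \<open>Coset spaces and their representations\<close>

declare mspace_cfunspace [simp del]

text \<open>
  The passage from coset spaces to the abstract transitive actions above.
\<close>

locale compact_coset_space = compact_group G T
  for G :: "('g, 'b) monoid_scheme" (structure) and T +
  fixes H :: "'g set" and M :: "'g set topology" and \<mu> :: "'g set measure"
  assumes subgroup_H: "subgroup H G"
    and M_eq: "M = homogeneous_space G T H"
    and invariant_\<mu>: "invariant_probability G M \<mu>"
begin

abbreviation translate :: "'g \<Rightarrow> 'g set \<Rightarrow> 'g set" (infixr \<open>\<star>\<close> 75) where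
  "g \<star> x \<equiv> g <#\<^bsub>G\<^esub> x"

lemma topspace_M: "topspace M = lcosets H"
  unfolding M_eq by (rule topspace_homogeneous_space[OF topspace_T])

lemma H_carrier: "H \<subseteq> carrier G"
  by (rule subgroup.subset[OF subgroup_H])

lemma coset_carrier: "x \<in> topspace M \<Longrightarrow> x \<subseteq> carrier G"
  using subgroup.lcosets_carrier[OF subgroup_H is_group] topspace_M by simp

lemma cosetE:
  assumes "x \<in> topspace M" obtains a where "a \<in> carrier G" "x = a \<star> H"
  using assms unfolding topspace_M LCOSETS_def by blast

lemma coset_in: "a \<in> carrier G \<Longrightarrow> a \<star> H \<in> topspace M"
  unfolding topspace_M LCOSETS_def by blast

lemma translate_coset: "g \<in> carrier G \<Longrightarrow> a \<in> carrier G \<Longrightarrow> g \<star> (a \<star> H) = (g \<otimes> a) \<star> H"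
  by (rule lcos_m_assoc[OF H_carrier])

text \<open>
  The preimage in \<open>G\<close> of the orbit image of \<open>U\<close> is \<open>U a H\<close>, a union of right
  translates of \<open>U\<close>.
\<close>

lemma coset_orbit_open:
  assumes x: "x \<in> topspace M"
  shows "open_map T M (\<lambda>g. g \<star> x)"
  unfolding open_map_def
proof (intro allI impI)
  fix U assume U: "openin T U"
  then have Uc: "U \<subseteq> carrier G" using openin_subset topspace_T by blast
  obtain a where a: "a \<in> carrier G" "x = a \<star> H" using cosetE[OF x] by blast
  have "{c \<in> topspace T. c \<star> H \<in> (\<lambda>g. g \<star> x) ` U} = (\<Union>h\<in>H. (\<lambda>g. g \<otimes> (a \<otimes> h)) ` U)"
  proof (intro equalityI subsetI)
    fix c assume "c \<in> {c \<in> topspace T. c \<star> H \<in> (\<lambda>g. g \<star> x) ` U}"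
    then obtain g where c: "c \<in> carrier G" and g: "g \<in> U" "c \<star> H = g \<star> x" by (auto simp: topspace_T)
    then have gc: "g \<in> carrier G" using Uc by blast
    have "c \<in> c \<star> H" by (rule lcos_self[OF c subgroup_H])
    then have "c \<in> (g \<otimes> a) \<star> H" using g(2) a translate_coset[OF gc a(1)] by simp
    then obtain h where h: "h \<in> H" "c = (g \<otimes> a) \<otimes> h" unfolding l_coset_def by blast
    then have "c = g \<otimes> (a \<otimes> h)" using gc a H_carrier m_assoc by blast
    then show "c \<in> (\<Union>h\<in>H. (\<lambda>g. g \<otimes> (a \<otimes> h)) ` U)" using g h by blast
  next
    fix c assume "c \<in> (\<Union>h\<in>H. (\<lambda>g. g \<otimes> (a \<otimes> h)) ` U)"
    then obtain h g where hg: "h \<in> H" "g \<in> U" "c = g \<otimes> (a \<otimes> h)" by blast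
    then have gc: "g \<in> carrier G" and hc: "h \<in> carrier G" using Uc H_carrier by blast+
    have "h \<star> H = H" using coset_join3[OF hc subgroup_H hg(1)] .
    then have "c \<star> H = (g \<otimes> a) \<star> H"
      using hg(3) gc hc a(1) by (metis lcos_m_assoc[OF H_carrier] m_assoc m_closed)
    then have "c \<star> H = g \<star> x" using translate_coset[OF gc a(1)] a(2) by simp
    then show "c \<in> {c \<in> topspace T. c \<star> H \<in> (\<lambda>g. g \<star> x) ` U}"
      using hg gc hc a(1) by (auto simp: topspace_T)
  qed
  moreover have "openin T (\<Union>h\<in>H. (\<lambda>g. g \<otimes> (a \<otimes> h)) ` U)"
    using U a(1) H_carrier by (intro openin_Union) (auto intro!: openin_right_translate)
  moreover have "(\<lambda>g. g \<star> x) ` U \<subseteq> lcosets H"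
    using Uc a coset_in by (auto simp: topspace_M[symmetric] translate_coset subset_iff)
  ultimately show "openin M ((\<lambda>g. g \<star> x) ` U)"
    unfolding M_eq openin_homogeneous_space by simp
qed

sublocale compact_homogeneous_space G T M "(\<star>)" \<mu>
proof
  fix g x assume g: "g \<in> carrier G" and x: "x \<in> topspace M"
  obtain a where a: "a \<in> carrier G" "x = a \<star> H" using cosetE[OF x] by blast
  show "g \<star> x \<in> topspace M" using translate_coset[OF g a(1)] a coset_in g by simp
next
  fix x assume x: "x \<in> topspace M"
  show "\<one> \<star> x = x" by (rule lcos_mult_one[OF coset_carrier[OF x]])
  show "open_map T M (\<lambda>g. g \<star> x)" by (rule coset_orbit_open[OF x])
  obtain a where a: "a \<in> carrier G" "x = a \<star> H" using cosetE[OF x] by blast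
  have "continuous_map T M (\<lambda>g. g \<star> H)"
    unfolding M_eq by (rule quotient_imp_continuous_map[OF quotient_map_homogeneous_space[OF topspace_T]])
  from continuous_map_compose[OF right_mult_continuous[OF a(1)] this]
  have "continuous_map T M (\<lambda>g. (g \<otimes> a) \<star> H)" by (simp add: o_def)
  then show "continuous_map T M (\<lambda>g. g \<star> x)"
    by (rule continuous_map_eq) (simp add: topspace_T a translate_coset)
next
  fix g h x assume "g \<in> carrier G" "h \<in> carrier G" and x: "x \<in> topspace M"
  then show "(g \<otimes> h) \<star> x = g \<star> (h \<star> x)" using lcos_m_assoc[OF coset_carrier[OF x]] by simp
next
  fix x y assume x: "x \<in> topspace M" and y: "y \<in> topspace M"
  obtain a where a: "a \<in> carrier G" "x = a \<star> H" using cosetE[OF x] by blast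
  obtain b where b: "b \<in> carrier G" "y = b \<star> H" using cosetE[OF y] by blast
  have "(b \<otimes> inv a) \<star> x = y" using a b by (simp add: translate_coset m_assoc)
  then show "\<exists>g\<in>carrier G. g \<star> x = y" using a b by blast
next
  show "space \<mu> = topspace M" "sets \<mu> = sigma_sets (topspace M) {U. openin M U}" "emeasure \<mu> (space \<mu>) = 1"
    using invariant_\<mu> unfolding invariant_probability_def by blast+
  show "emeasure \<mu> ((\<star>) g ` B) = emeasure \<mu> B" if "g \<in> carrier G" "B \<in> sets \<mu>" for g B
    using invariant_\<mu> that unfolding invariant_probability_def by blast
qed

text \<open>
  Elements of \<open>C(M)\<close> are extensional functions, whereas the subspaces above contain all
  functions with the prescribed values on \<open>M\<close>. Restriction translates between the two.
\<close>

abbreviation res :: "('g set \<Rightarrow> complex) \<Rightarrow> 'g set \<Rightarrow> complex" where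
  "res u \<equiv> restrict u (X)"

lemma mspace_CM: "mspace (CM M) = {f \<in> extensional (X). cts f}"
  using compactin_mspace_cfunspace[of M "euclidean_metric :: complex metric"] compact_M
  by (auto simp: compact_space_def)

lemma res_CM: "cts u \<Longrightarrow> res u \<in> mspace (CM M)"
  unfolding mspace_CM using cts_cong[of u "res u"] by simp

lemma closedin_CM:
  "closedin (mtopology_of (CM M)) E \<longleftrightarrow> E \<subseteq> mspace (CM M) \<and>
     (\<forall>u\<in>mspace (CM M). (\<forall>e>0. \<exists>v\<in>E. \<forall>x\<in>X. cmod (u x - v x) \<le> e) \<longrightarrow> u \<in> E)"
proof -
  interpret C: Metric_space "mspace (CM M)" "mdist (CM M)" by (rule Metric_space_mspace_mdist)
  have close: "mdist (CM M) u v \<le> e" if "\<forall>x\<in>X. cmod (u x - v x) \<le> e" "e > 0" for u v e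
    using that by (intro mdist_cfunspace_le) (auto simp: dist_norm)
  have apart: "cmod (u x - v x) \<le> e" if "u \<in> mspace (CM M)" "v \<in> mspace (CM M)" "mdist (CM M) u v \<le> e" "x \<in> X" for u v e x
    using mdist_cfunspace_imp_mdist_le[OF that] by (simp add: dist_norm)
  show ?thesis
    unfolding mtopology_of_def C.closedin_metric
  proof (intro conj_cong refl iffI ballI allI impI)
    fix u assume E: "E \<subseteq> mspace (CM M)" and cl: "\<forall>u. u \<in> mspace (CM M) - E \<longrightarrow> (\<exists>r>0. disjnt E (C.mball u r))"
      and u: "u \<in> mspace (CM M)" and app: "\<forall>e>0. \<exists>v\<in>E. \<forall>x\<in>X. cmod (u x - v x) \<le> e"
    show "u \<in> E"
    proof (rule ccontr)
      assume "u \<notin> E"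
      then obtain r where r: "r > 0" "disjnt E (C.mball u r)" using cl u by blast
      then have "r / 2 > 0" by simp
      then obtain v where v: "v \<in> E" "\<forall>x\<in>X. cmod (u x - v x) \<le> r / 2" using app by blast
      have "mdist (CM M) u v < r" using close[OF v(2)] r(1) by simp
      then have "v \<in> C.mball u r" using u v E by auto
      then show False using r(2) v(1) by (auto simp: disjnt_iff)
    qed
  next
    fix u assume E: "E \<subseteq> mspace (CM M)"
      and cl: "\<forall>u\<in>mspace (CM M). (\<forall>e>0. \<exists>v\<in>E. \<forall>x\<in>X. cmod (u x - v x) \<le> e) \<longrightarrow> u \<in> E"
      and u: "u \<in> mspace (CM M) - E"
    show "\<exists>r>0. disjnt E (C.mball u r)"
    proof (rule ccontr)
      assume no: "\<not> (\<exists>r>0. disjnt E (C.mball u r))"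
      have "\<exists>v\<in>E. \<forall>x\<in>X. cmod (u x - v x) \<le> e" if "e > 0" for e
      proof -
        have "\<not> disjnt E (C.mball u e)" using no \<open>e > 0\<close> by blast
        then obtain v where v: "v \<in> E" "v \<in> mspace (CM M)" "mdist (CM M) u v < e"
          unfolding disjnt_iff by auto
        then show ?thesis using apart[of u v e] u by auto
      qed
      then show False using cl u by blast
    qed
  qed
qed

lemma quasiregular_res:
  assumes "g \<in> carrier G"
  shows "quasiregular G M g (res u) = res (\<lambda>x. u (inv g \<star> x))"
  unfolding quasiregular_def using act_closed[of "inv g"] assms by (intro restrict_ext) simp

definition lift :: "('g set \<Rightarrow> complex) set \<Rightarrow> ('g set \<Rightarrow> complex) set" where
  "lift E = {u. res u \<in> E}"

lemma closed_invariant_lift: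
  assumes "subrepresentation G M E"
  shows "closed_invariant (lift E)"
proof -
  have E: "E \<subseteq> mspace (CM M)" "cf_const M 0 \<in> E" "\<And>f g. f \<in> E \<Longrightarrow> g \<in> E \<Longrightarrow> cf_add M f g \<in> E"
    "\<And>c f. f \<in> E \<Longrightarrow> cf_scale M c f \<in> E" "\<And>g f. g \<in> carrier G \<Longrightarrow> f \<in> E \<Longrightarrow> quasiregular G M g f \<in> E"
    and closed: "closedin (mtopology_of (CM M)) E"
    using assms unfolding subrepresentation_def linear_subspace_def invariant_def by auto
  show ?thesis
    unfolding closed_invariant_def lift_def mem_Collect_eq
  proof (intro conjI ballI allI impI; (elim CollectE)?)
    show "cts u" if "res u \<in> E" for u
      using E(1) that cts_cong[of "res u" u] by (auto simp: mspace_CM)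
    show "res (\<lambda>_. 0) \<in> E" using E(2) by (simp add: cf_const_def)
    show "res (\<lambda>x. u x + c * v x) \<in> E" if "res u \<in> E" "res v \<in> E" for u v c
    proof -
      have "res (\<lambda>x. u x + c * v x) = cf_add M (res u) (cf_scale M c (res v))"
        unfolding cf_add_def cf_scale_def by (rule restrict_ext) simp
      then show ?thesis using E that by simp
    qed
    show "res (\<lambda>x. u (g \<star> x)) \<in> E" if "res u \<in> E" "g \<in> carrier G" for u g
      using E(5)[of "inv g" "res u"] that quasiregular_res[of "inv g" u] by simp
  next
    fix u assume u: "\<forall>e>0. \<exists>v\<in>{u. res u \<in> E}. \<forall>x\<in>X. cmod (u x - v x) \<le> e"
    have app: "\<exists>v\<in>E. \<forall>x\<in>X. cmod (u x - v x) \<le> e" if e: "e > 0" for e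
    proof -
      obtain v where "res v \<in> E" "\<forall>x\<in>X. cmod (u x - v x) \<le> e" using u e by blast
      then show ?thesis by (intro bexI[of _ "res v"]) auto
    qed
    have "cts u"
    proof (rule cts_uniform_limit)
      fix e :: real assume "e > 0"
      then show "\<exists>v. cts v \<and> (\<forall>x\<in>X. cmod (u x - v x) \<le> e)"
        using app E(1) unfolding mspace_CM by blast
    qed
    then have "res u \<in> mspace (CM M)" by (rule res_CM)
    then show "res u \<in> E" using closed app unfolding closedin_CM by simp
  qed
qed

lemma subrepresentation_extensional:
  assumes E: "closed_invariant E"
  shows "subrepresentation G M (E \<inter> extensional (X))"
proof -
  have resE: "res u \<in> E \<inter> extensional (X)" if "u \<in> E" for u
    using closed_invariant_cong[OF E that, of "res u"] by simp
  have sub: "E \<inter> extensional (X) \<subseteq> mspace (CM M)"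
    using closed_invariant_cts[OF E] by (auto simp: mspace_CM)
  show ?thesis
    unfolding subrepresentation_def linear_subspace_def invariant_def closedin_CM
  proof (intro conjI ballI allI impI)
    show "cf_const M 0 \<in> E \<inter> extensional (X)"
      unfolding cf_const_def by (rule resE[OF closed_invariant_zero[OF E]])
    show "cf_add M f g \<in> E \<inter> extensional (X)" if "f \<in> E \<inter> extensional (X)" "g \<in> E \<inter> extensional (X)" for f g
      unfolding cf_add_def using resE[OF closed_invariant_lin[OF E, of f g 1]] that by simp
    show "cf_scale M c f \<in> E \<inter> extensional (X)" if "f \<in> E \<inter> extensional (X)" for c f
      unfolding cf_scale_def using resE[OF closed_invariant_cmult[OF E, of f c]] that by simp
    show "quasiregular G M g f \<in> E \<inter> extensional (X)" if "g \<in> carrier G" "f \<in> E \<inter> extensional (X)" for g f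
      unfolding quasiregular_def using resE[OF closed_invariant_act[OF E, of f "inv g"]] that by simp
    show "u \<in> E \<inter> extensional (X)" if u: "u \<in> mspace (CM M)"
      and app: "\<forall>e>0. \<exists>v\<in>E \<inter> extensional (X). \<forall>x\<in>X. cmod (u x - v x) \<le> e" for u
    proof
      show "u \<in> E" by (rule closed_invariant_closed[OF E]) (use app in blast)
      show "u \<in> extensional (X)" using u by (simp add: mspace_CM)
    qed
  qed (use sub in auto)
qed

lemma equivariant_op_continuous:
  assumes L: "equivariant_op L" and V: "closed_invariant V" and W: "closed_invariant W" and VW: "\<And>v. v \<in> V \<Longrightarrow> L v \<in> W"
  shows "continuous_map (subtopology (mtopology_of (CM M)) (V \<inter> extensional (X)))
     (subtopology (mtopology_of (CM M)) (W \<inter> extensional (X))) (\<lambda>v. res (L v))"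
proof -
  obtain D where D: "D > 0" "\<And>u v x e. \<lbrakk>cts u; cts v; \<And>y. y \<in> X \<Longrightarrow> cmod (u y - v y) \<le> e; x \<in> X\<rbrakk>
     \<Longrightarrow> cmod (L u x - L v x) \<le> D * e"
    using equivariant_op_sup_bound[OF L] by metis
  note cV = closed_invariant_cts[OF V]
  have mV: "u \<in> mspace (CM M)" if "u \<in> V \<inter> extensional (X)" for u
    using that cV by (auto simp: mspace_CM)
  have img: "res (L v) \<in> W \<inter> extensional (X)" if "v \<in> V" for v
    using closed_invariant_cong[OF W VW[OF that], of "res (L v)"] by simp
  have "Lipschitz_continuous_map (submetric (CM M) (V \<inter> extensional (X)))
     (submetric (CM M) (W \<inter> extensional (X))) (\<lambda>v. res (L v))"
    unfolding Lipschitz_continuous_map_def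
  proof (intro conjI exI[of _ D] ballI)
    show "(\<lambda>v. res (L v)) \<in> mspace (submetric (CM M) (V \<inter> extensional (X))) \<rightarrow> mspace (submetric (CM M) (W \<inter> extensional (X)))"
      using img cV res_CM equivariant_op_cts[OF L] by auto
    fix u v assume "u \<in> mspace (submetric (CM M) (V \<inter> extensional (X)))" "v \<in> mspace (submetric (CM M) (V \<inter> extensional (X)))"
    then have uv: "u \<in> V" "v \<in> V" "u \<in> mspace (CM M)" "v \<in> mspace (CM M)" by auto
    have near: "cmod (u y - v y) \<le> mdist (CM M) u v" if "y \<in> X" for y
      using mdist_cfunspace_imp_mdist_le[OF uv(3,4) order_refl that] by (simp add: dist_norm)
    have "mdist (CM M) (res (L u)) (res (L v)) \<le> D * mdist (CM M) u v"
    proof (rule mdist_cfunspace_le)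
      show "0 \<le> D * mdist (CM M) u v" using D(1) by simp
      fix x assume "x \<in> X"
      then show "mdist euclidean_metric (res (L u) x) (res (L v) x) \<le> D * mdist (CM M) u v"
        using D(2)[OF cV[OF uv(1)] cV[OF uv(2)] near] by (simp add: dist_norm)
    qed
    then show "mdist (submetric (CM M) (W \<inter> extensional (X))) (res (L u)) (res (L v))
       \<le> D * mdist (submetric (CM M) (V \<inter> extensional (X))) u v" by simp
  qed
  then show ?thesis
    using Lipschitz_continuous_imp_continuous_map by (fastforce simp: mtopology_of_submetric)
qed

text \<open>
  Commutativity in the form in which it is applied: independent closed invariant subspaces are
  orthogonal. Otherwise an irreducible \<open>V\<close> in \<open>E\<close> has an equivalent copy \<open>W\<close>
  in \<open>F\<close>, and \<open>V\<close> and \<open>W\<close> are two independent copies of \<open>V\<close> in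
  \<open>C(M)\<close>.
\<close>

theorem commutative_orthogonality:
  assumes comm: "commutative_space G M"
    and E: "closed_invariant E" and F: "closed_invariant F"
    and disj: "\<And>u x. \<lbrakk>u \<in> E; u \<in> F; x \<in> X\<rbrakk> \<Longrightarrow> u x = 0"
    and f: "f \<in> E" and h: "h \<in> F"
  shows "ip f h = 0"
proof (rule ccontr)
  assume nz: "ip f h \<noteq> 0"
  obtain V L L' where irrV: "irreducible_space V" and VE: "V \<subseteq> E"
    and L: "equivariant_op L" and L': "equivariant_op L'"
    and LF0: "\<forall>u. cts u \<longrightarrow> L u \<in> F" and L'L0: "\<forall>v\<in>V. \<forall>x\<in>X. L' (L v) x = v x"
    by (rule equivalent_irreducible_subspaces[OF E F f h nz])
  have V: "closed_invariant V" "V \<subseteq> E" "\<exists>v\<in>V. \<exists>x\<in>X. v x \<noteq> 0"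
    using irrV VE unfolding irreducible_space_def by blast+
  have Vmin: "\<And>W. \<lbrakk>closed_invariant W; W \<subseteq> V; \<exists>v\<in>W. \<exists>x\<in>X. v x \<noteq> 0\<rbrakk> \<Longrightarrow> W = V"
    using irrV unfolding irreducible_space_def by blast
  have LF: "\<And>u. cts u \<Longrightarrow> L u \<in> F" and L'L: "\<And>v x. \<lbrakk>v \<in> V; x \<in> X\<rbrakk> \<Longrightarrow> L' (L v) x = v x"
    using LF0 L'L0 by auto
  note cV = closed_invariant_cts[OF V(1)]
  \<comment> \<open>The image of \<open>V\<close> under \<open>L\<close>, described by closed conditions so that it is
    evidently a closed invariant subspace.\<close>
  define W where "W = eigenspace (\<lambda>u. L (L' u)) 1 \<inter> {u. cts u \<and> L' u \<in> V}"
  have W: "closed_invariant W"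
    unfolding W_def
    by (rule closed_invariant_Int[OF closed_invariant_eigenspace[OF equivariant_op_comp[OF L L']]
        closed_invariant_vimage[OF L' V(1)]])
  have LW: "L v \<in> W" if v: "v \<in> V" for v
  proof -
    have c: "cts (L v)" "cts (L' (L v))" using cV[OF v] equivariant_op_cts L L' by blast+
    have "L (L' (L v)) x = L v x" if "x \<in> X" for x
      by (rule equivariant_op_cong[OF L c(2) cV[OF v] L'L[OF v] that])
    moreover have "L' (L v) \<in> V"
      by (rule closed_invariant_cong[OF V(1) v]) (simp add: L'L[OF v])
    ultimately show ?thesis unfolding W_def eigenspace_def using c by simp
  qed
  have L'V: "L' w \<in> V" and LL': "\<And>x. x \<in> X \<Longrightarrow> L (L' w) x = w x" and cW: "cts w" if "w \<in> W" for w
    using that unfolding W_def eigenspace_def by auto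
  have WF: "w \<in> F" if w: "w \<in> W" for w
    by (rule closed_invariant_cong[OF F LF[OF cV[OF L'V[OF w]]]]) (rule LL'[OF w])
  let ?V = "V \<inter> extensional (X)" and ?W = "W \<inter> extensional (X)"
  have cres: "cts (res u)" if "cts u" for u using cts_cong[OF that, of "res u"] by simp
  have irr: "irreducible_subrepresentation G M ?V"
    unfolding irreducible_subrepresentation_def
  proof (intro conjI allI impI; (elim conjE)?)
    show "subrepresentation G M ?V" by (rule subrepresentation_extensional[OF V(1)])
    obtain v x where v: "v \<in> V" "x \<in> X" "v x \<noteq> 0" using V(3) by blast
    have "res v \<in> ?V" using closed_invariant_cong[OF V(1) v(1), of "res v"] by simp
    moreover have "res v \<noteq> cf_const M 0"
      using v(2,3) by (auto simp: cf_const_def dest!: fun_cong[of _ _ x])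
    ultimately show "?V \<noteq> {cf_const M 0}" by blast
    fix S assume S: "subrepresentation G M S" "S \<subseteq> ?V"
    have cS: "closed_invariant (lift S)" by (rule closed_invariant_lift[OF S(1)])
    have resS: "res u = u" if "u \<in> S" for u using S(2) that extensional_restrict by blast
    have SV: "lift S \<subseteq> V"
    proof
      fix u assume "u \<in> lift S"
      then have "res u \<in> V" using S(2) by (auto simp: lift_def)
      then show "u \<in> V" by (rule closed_invariant_cong[OF V(1)]) simp
    qed
    show "S = {cf_const M 0} \<or> S = ?V"
    proof (cases "\<exists>v\<in>lift S. \<exists>x\<in>X. v x \<noteq> 0")
      case True
      then have "lift S = V" using Vmin[OF cS SV] by blast
      then have "?V \<subseteq> S" unfolding lift_def using extensional_restrict by fastforce
      then show ?thesis using S(2) by blast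
    next
      case False
      have "u = cf_const M 0" if u: "u \<in> S" for u
      proof -
        have "u \<in> lift S" using u resS[OF u] by (simp add: lift_def)
        then have "\<forall>x\<in>X. u x = 0" using False by blast
        then have "res u = res (\<lambda>_. 0)" by (intro restrict_ext) blast
        then show ?thesis using resS[OF u] by (simp add: cf_const_def)
      qed
      moreover have "cf_const M 0 \<in> S" using S(1) by (simp add: subrepresentation_def linear_subspace_def)
      ultimately show ?thesis by blast
    qed
  qed
  have "homeomorphic_maps (subtopology (mtopology_of (CM M)) ?V) (subtopology (mtopology_of (CM M)) ?W)
     (\<lambda>v. res (L v)) (\<lambda>w. res (L' w))"
    unfolding homeomorphic_maps_def
  proof (intro conjI ballI)
    show "continuous_map (subtopology (mtopology_of (CM M)) ?V) (subtopology (mtopology_of (CM M)) ?W) (\<lambda>v. res (L v))"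
      by (rule equivariant_op_continuous[OF L V(1) W LW])
    show "continuous_map (subtopology (mtopology_of (CM M)) ?W) (subtopology (mtopology_of (CM M)) ?V) (\<lambda>w. res (L' w))"
      by (rule equivariant_op_continuous[OF L' W V(1) L'V])
    fix v assume "v \<in> topspace (subtopology (mtopology_of (CM M)) ?V)"
    then have v: "v \<in> V" "v \<in> extensional (X)" by auto
    have "res (L' (res (L v))) = res v"
    proof (rule restrict_ext)
      fix x assume x: "x \<in> X"
      have cL: "cts (L v)" by (rule equivariant_op_cts[OF L cV[OF v(1)]])
      have "L' (res (L v)) x = L' (L v) x"
        by (rule equivariant_op_cong[OF L' cres[OF cL] cL _ x]) simp
      then show "L' (res (L v)) x = v x" using L'L[OF v(1) x] by simp
    qed
    then show "res (L' (res (L v))) = v" using extensional_restrict[OF v(2)] by simp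
  next
    fix w assume "w \<in> topspace (subtopology (mtopology_of (CM M)) ?W)"
    then have w: "w \<in> W" "w \<in> extensional (X)" by auto
    have "res (L (res (L' w))) = res w"
    proof (rule restrict_ext)
      fix x assume x: "x \<in> X"
      have cL: "cts (L' w)" by (rule equivariant_op_cts[OF L' cW[OF w(1)]])
      have "L (res (L' w)) x = L (L' w) x"
        by (rule equivariant_op_cong[OF L cres[OF cL] cL _ x]) simp
      then show "L (res (L' w)) x = w x" using LL'[OF w(1) x] by simp
    qed
    then show "res (L (res (L' w))) = w" using extensional_restrict[OF w(2)] by simp
  qed
  then have homeo: "homeomorphic_map (subtopology (mtopology_of (CM M)) ?V) (subtopology (mtopology_of (CM M)) ?W) (\<lambda>v. res (L v))"
    by (rule homeomorphic_maps_imp_map)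
  have equivW: "equivalent_representations G M ?V ?W"
    unfolding equivalent_representations_def
  proof (intro exI[of _ "\<lambda>v. res (L v)"] conjI ballI allI homeo)
    fix u v assume "u \<in> ?V" "v \<in> ?V"
    then have c: "cts u" "cts v" using cV by blast+
    have ca: "cts (\<lambda>x. u x + 1 * v x)" by (intro cts_add cts_mult cts_const c)
    show "res (L (cf_add M u v)) = cf_add M (res (L u)) (res (L v))"
      unfolding cf_add_def
    proof (rule restrict_ext)
      fix x assume x: "x \<in> X"
      have "L (res (\<lambda>x. u x + v x)) x = L (\<lambda>x. u x + 1 * v x) x"
        by (rule equivariant_op_cong[OF L _ ca _ x]) (use cres[OF cts_add[OF c]] in simp_all)
      then show "L (res (\<lambda>x. u x + v x)) x = res (L u) x + res (L v) x"
        using equivariant_op_linear[OF L c x, of 1] x by simp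
    qed
  next
    fix c u assume "u \<in> ?V"
    then have u: "cts u" using cV by blast
    have cu: "cts (\<lambda>x. c * u x)" by (intro cts_mult cts_const u)
    show "res (L (cf_scale M c u)) = cf_scale M c (res (L u))"
      unfolding cf_scale_def
    proof (rule restrict_ext)
      fix x assume x: "x \<in> X"
      have "L (res (\<lambda>x. c * u x)) x = L (\<lambda>x. c * u x) x"
        by (rule equivariant_op_cong[OF L cres[OF cu] cu _ x]) simp
      then show "L (res (\<lambda>x. c * u x)) x = c * res (L u) x"
        using equivariant_op_cmult[OF L u x] x by simp
    qed
  next
    fix g u assume g: "g \<in> carrier G" and "u \<in> ?V"
    then have u: "cts u" using cV by blast
    have ig: "inv g \<in> carrier G" using g by simp
    have cu: "cts (\<lambda>x. u (inv g \<star> x))" by (rule cts_act[OF ig u])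
    show "res (L (quasiregular G M g u)) = quasiregular G M g (res (L u))"
      unfolding quasiregular_def
    proof (rule restrict_ext)
      fix x assume x: "x \<in> X"
      have "L (res (\<lambda>x. u (inv g \<star> x))) x = L (\<lambda>x. u (inv g \<star> x)) x"
        by (rule equivariant_op_cong[OF L cres[OF cu] cu _ x]) simp
      then show "L (res (\<lambda>x. u (inv g \<star> x))) x = res (L u) (inv g \<star> x)"
        using equivariant_op_act[OF L u ig x] act_closed[OF ig x] by simp
    qed
  qed
  have equivV: "equivalent_representations G M ?V ?V"
    unfolding equivalent_representations_def
    by (intro exI[of _ "\<lambda>v. v"] conjI ballI allI refl) (use homeomorphic_map_id[of "subtopology (mtopology_of (CM M)) ?V"] in \<open>simp add: id_def\<close>)
  define Fs where "Fs = (\<lambda>i::nat. if i = 0 then ?V else ?W)"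
  have "independent_subspaces M 2 Fs"
    unfolding independent_subspaces_def
  proof (intro allI impI; elim conjE)
    fix v i assume v: "\<forall>i<2. v i \<in> Fs i" and sum: "\<forall>x\<in>X. (\<Sum>i<2. v i x) = 0" and i: "i < (2::nat)"
    have v0: "v 0 \<in> ?V" and v1: "v 1 \<in> ?W" using v[rule_format, of 0] v[rule_format, of 1] by (auto simp: Fs_def)
    have s: "v 0 x + v 1 x = 0" if "x \<in> X" for x
      using sum that by (simp add: numeral_2_eq_2)
    have "(\<lambda>x. (-1) * v 1 x) \<in> F" using WF v1 by (intro closed_invariant_cmult[OF F]) blast
    then have "v 0 \<in> F"
      by (rule closed_invariant_cong[OF F]) (use s in \<open>simp add: add_eq_0_iff2\<close>)
    then have z0: "v 0 x = 0" if "x \<in> X" for x using disj v0 V(2) that by blast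
    then have z1: "v 1 x = 0" if "x \<in> X" for x using s[OF that] that by simp
    have "res (v i) = res (\<lambda>_. 0)" using i z0 z1 by (intro restrict_ext) (auto simp: numeral_2_eq_2 less_Suc_eq)
    moreover have "res (v i) = v i" using v0 v1 i by (intro extensional_restrict) (auto simp: numeral_2_eq_2 less_Suc_eq)
    ultimately show "v i = cf_const M 0" by (simp add: cf_const_def)
  qed
  moreover have "\<forall>i<2. subrepresentation G M (Fs i) \<and> equivalent_representations G M ?V (Fs i)"
    using equivV equivW subrepresentation_extensional[OF V(1)] subrepresentation_extensional[OF W] by (simp add: Fs_def)
  ultimately have "enat 2 \<le> multiplicity_in_CM G M ?V"
    unfolding multiplicity_in_CM_def by (intro Sup_upper) blast
  also have "\<dots> \<le> 1" using comm irr unfolding commutative_space_def by blast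
  finally show False by (simp add: one_enat_def)
qed

end

section \<open>Invariant function algebras\<close>

locale invariant_algebra = compact_coset_space G T H M \<mu>
  for G :: "('g, 'b) monoid_scheme" (structure) and T H M \<mu> +
  fixes A :: "('g set \<Rightarrow> complex) set"
  assumes algebra_A: "invariant_function_algebra G M A"
begin

lemma A_closed_invariant: "closed_invariant (lift A)"
  by (rule closed_invariant_lift) (use algebra_A in \<open>simp add: invariant_function_algebra_def subrepresentation_def\<close>)

lemma A_subset: "f \<in> A \<Longrightarrow> cts f" "f \<in> A \<Longrightarrow> f \<in> extensional (X)"
  using algebra_A unfolding invariant_function_algebra_def linear_subspace_def mspace_CM by blast+

lemma res_A: "f \<in> A \<Longrightarrow> res f = f"
  by (rule extensional_restrict[OF A_subset(2)])

lemma A_lift: "f \<in> A \<Longrightarrow> f \<in> lift A"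
  by (simp add: lift_def res_A)

lemma lift_const: "(\<lambda>_. c) \<in> lift A"
  using algebra_A unfolding invariant_function_algebra_def lift_def cf_const_def by blast

lemma cf_add_res: "cf_add M (res u) (res v) = res (\<lambda>x. u x + v x)"
  unfolding cf_add_def by (rule restrict_ext) simp

lemma cf_scale_res: "cf_scale M c (res u) = res (\<lambda>x. c * u x)"
  unfolding cf_scale_def by (rule restrict_ext) simp

lemma cf_mult_res: "cf_mult M (res u) (res v) = res (\<lambda>x. u x * v x)"
  unfolding cf_mult_def by (rule restrict_ext) simp

lemma lift_mult:
  assumes "u \<in> lift A" "v \<in> lift A" shows "(\<lambda>x. u x * v x) \<in> lift A"
proof -
  have "cf_mult M (res u) (res v) \<in> A"
    using algebra_A assms unfolding invariant_function_algebra_def lift_def by blast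
  then show ?thesis by (simp add: lift_def cf_mult_res)
qed

lemma mean_res: "mean (res u) = mean u"
  by (rule mean_cong) simp

text \<open>
  A function that lies both in \<open>E\<close> and in \<open>F\<close> has its real and imaginary parts in
  \<open>A\<close>. Antisymmetry makes these constant, and having mean 0 they vanish. Orthogonality of
  \<open>f - mean f\<close> to the conjugate of \<open>g - mean g\<close> is the claim.
\<close>

lemma antisymmetric_imp_mean_mult:
  assumes comm: "commutative_space G M" and anti: "antisymmetric M A" and f: "f \<in> lift A" and g: "g \<in> lift A"
  shows "mean (\<lambda>x. f x * g x) = mean f * mean g"
proof -
  note lin = closed_invariant_lin[OF A_closed_invariant] and c = closed_invariant_cts[OF A_closed_invariant]
  define E where "E = {u \<in> lift A. mean u = 0}"
  define F where "F = {u. (\<lambda>x. cnj (u x)) \<in> E}"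
  have E: "closed_invariant E" unfolding E_def by (rule closed_invariant_mean_zero[OF A_closed_invariant])
  have F: "closed_invariant F" unfolding F_def by (rule closed_invariant_cnj[OF E])
  have real_zero: "u x = 0" if u: "u \<in> lift A" "mean u = 0" "\<And>x. u x \<in> \<real>" and x: "x \<in> X" for u x
  proof -
    obtain k where k: "res u = cf_const M k"
      using anti u(1,3) unfolding antisymmetric_def lift_def by fastforce
    have uk: "u y = k" if "y \<in> X" for y
      using fun_cong[OF k, of y] that by (simp add: cf_const_def)
    have "mean u = mean (\<lambda>_. k)" by (rule mean_cong) (rule uk)
    then have "k = 0" using u(2) by (simp add: mean_const)
    then show ?thesis using uk[OF x] by simp
  qed
  have "mean (\<lambda>x. (f x + (- mean f) * 1) * cnj (cnj (g x + (- mean g) * 1))) = 0"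
  proof (rule commutative_orthogonality[OF comm E F])
    have centred: "(\<lambda>x. u x + (- mean u) * 1) \<in> E" if u: "u \<in> lift A" for u
      unfolding E_def using lin[OF u lift_const, of "- mean u" 1] mean_diff[OF c[OF u] cts_const, of "mean u"]
      by (simp add: mean_const)
    show "(\<lambda>x. f x + (- mean f) * 1) \<in> E" by (rule centred[OF f])
    show "(\<lambda>x. cnj (g x + (- mean g) * 1)) \<in> F" unfolding F_def using centred[OF g] by simp
    fix u x assume "u \<in> E" "u \<in> F" and x: "x \<in> X"
    then have u: "u \<in> lift A" "mean u = 0" and cu: "(\<lambda>x. cnj (u x)) \<in> lift A" "mean (\<lambda>x. cnj (u x)) = 0"
      by (simp_all add: E_def F_def)
    have "u x + 1 * cnj (u x) = 0"
    proof (rule real_zero[OF lin[OF u(1) cu(1)] _ _ x])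
      show "mean (\<lambda>x. u x + 1 * cnj (u x)) = 0" using mean_add[OF c[OF u(1)] c[OF cu(1)]] u(2) cu(2) by simp
      show "u y + 1 * cnj (u y) \<in> \<real>" for y by (simp add: complex_is_Real_iff)
    qed
    moreover have "\<i> * (u x + (-1) * cnj (u x)) = 0"
    proof (rule real_zero[OF closed_invariant_cmult[OF A_closed_invariant lin[OF u(1) cu(1)]] _ _ x])
      show "mean (\<lambda>x. \<i> * (u x + (-1) * cnj (u x))) = 0"
        unfolding mean_cmult using mean_diff[OF c[OF u(1)] c[OF cu(1)]] u(2) cu(2) by simp
      show "\<i> * (u y + (-1) * cnj (u y)) \<in> \<real>" for y by (simp add: complex_is_Real_iff)
    qed
    ultimately show "u x = 0" by (simp add: complex_eq_iff)
  qed
  also have "mean (\<lambda>x. (f x + (- mean f) * 1) * cnj (cnj (g x + (- mean g) * 1)))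
    = mean (\<lambda>x. (f x * g x - mean g * f x) - (mean f * g x - mean f * mean g))"
    by (rule arg_cong[of _ _ mean]) (simp add: fun_eq_iff algebra_simps)
  also have "\<dots> = mean (\<lambda>x. f x * g x) - mean f * mean g"
    by (subst mean_diff; (subst mean_diff)?; (intro cts_diff cts_mult cts_const c f g)?)
      (simp add: mean_diff mean_cmult mean_const c f g cts_mult cts_const)
  finally show ?thesis by simp
qed

lemma character_extensional:
  "\<phi> \<in> topspace (maximal_ideal_space M A) \<longleftrightarrow> \<phi> \<in> extensional A \<and> character M A \<phi>"
  unfolding maximal_ideal_space_def by (auto simp: PiE_def)

lemma mean_character:
  assumes mult: "\<And>f g. \<lbrakk>f \<in> lift A; g \<in> lift A\<rbrakk> \<Longrightarrow> mean (\<lambda>x. f x * g x) = mean f * mean g"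
  shows "multiplicative_measure M A \<mu>"
proof -
  note c = closed_invariant_cts[OF A_closed_invariant]
  have ops: "cf_add M f g \<in> A" "cf_mult M f g \<in> A" "cf_scale M k f \<in> A" if "f \<in> A" "g \<in> A" for f g k
    using algebra_A that unfolding invariant_function_algebra_def linear_subspace_def by blast+
  have m: "mean (cf_add M f g) = mean f + mean g" "mean (cf_scale M k f) = k * mean f" "mean (cf_mult M f g) = mean f * mean g"
    if fg: "f \<in> A" "g \<in> A" for f g k
  proof -
    show "mean (cf_add M f g) = mean f + mean g"
      using mean_add[OF A_subset(1)[OF fg(1)] A_subset(1)[OF fg(2)]] by (simp add: cf_add_def mean_res)
    show "mean (cf_scale M k f) = k * mean f" by (simp add: cf_scale_def mean_res mean_cmult)
    show "mean (cf_mult M f g) = mean f * mean g" using mult[OF A_lift[OF fg(1)] A_lift[OF fg(2)]] by (simp add: cf_mult_def mean_res)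
  qed
  have "cf_const M 1 \<in> A" using algebra_A unfolding invariant_function_algebra_def by blast
  moreover have "mean (cf_const M 1) = 1" by (simp add: cf_const_def mean_res mean_const)
  ultimately have one: "\<exists>f\<in>A. restrict mean A f \<noteq> 0" by (intro bexI[of _ "cf_const M 1"]) auto
  have "character M A (restrict mean A)"
    unfolding character_def using one by (auto simp: ops m)
  then show ?thesis
    unfolding multiplicative_measure_def character_extensional
    by (intro bexI[of _ "restrict mean A"]) (auto simp: mean_def character_extensional)
qed

lemma multiplicative_imp_fixed_point:
  assumes "multiplicative_measure M A \<mu>"
  shows "\<exists>\<phi>. \<phi> \<in> fixed_points G M A"
proof -
  obtain \<phi> where \<phi>: "\<phi> \<in> topspace (maximal_ideal_space M A)" "\<And>f. f \<in> A \<Longrightarrow> \<phi> f = mean f"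
    using assms unfolding multiplicative_measure_def mean_def by blast
  have "dual_action G M A g \<phi> = \<phi>" if g: "g \<in> carrier G" for g
  proof
    fix f
    show "dual_action G M A g \<phi> f = \<phi> f"
    proof (cases "f \<in> A")
      case True
      have q: "quasiregular G M (inv g) f = res (\<lambda>x. f (g \<star> x))"
        using quasiregular_res[of "inv g" f] g res_A[OF True] by simp
      have qA: "quasiregular G M (inv g) f \<in> A"
        using algebra_A True g unfolding invariant_function_algebra_def invariant_def by simp
      then show ?thesis
        using True mean_act[OF g A_subset(1)[OF True]]
        by (simp add: dual_action_def \<phi>(2)[OF qA] \<phi>(2)[OF True], simp add: q mean_res)
    next
      case False
      then show ?thesis using \<phi>(1) by (simp add: dual_action_def character_extensional extensional_def)
    qed
  qed
  then show ?thesis using \<phi>(1) unfolding fixed_points_def by blast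
qed

lemma fixed_point_eq_mean:
  assumes \<phi>: "\<phi> \<in> fixed_points G M A" and f: "f \<in> A"
  shows "\<phi> f = mean f"
proof -
  have char: "character M A \<phi>" and fixed: "\<And>g. g \<in> carrier G \<Longrightarrow> dual_action G M A g \<phi> = \<phi>"
    using \<phi> unfolding fixed_points_def character_extensional by auto
  define \<psi> where "\<psi> = (\<lambda>u. \<phi> (res u))"
  have lin: "\<psi> (\<lambda>x. u x + c * v x) = \<psi> u + c * \<psi> v" if u: "u \<in> lift A" and v: "v \<in> lift A" for u v c
  proof -
    have uv: "res u \<in> A" "res v \<in> A" using u v by (simp_all add: lift_def)
    have sv: "cf_scale M c (res v) \<in> A" using algebra_A uv unfolding invariant_function_algebra_def linear_subspace_def by blast
    have "\<psi> (\<lambda>x. u x + c * v x) = \<phi> (cf_add M (res u) (cf_scale M c (res v)))"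
      by (simp add: \<psi>_def cf_scale_res cf_add_res)
    also have "\<dots> = \<phi> (res u) + c * \<phi> (res v)" using char uv sv unfolding character_def by simp
    finally show ?thesis by (simp add: \<psi>_def)
  qed
  have mult: "\<psi> (\<lambda>x. u x * v x) = \<psi> u * \<psi> v" if "u \<in> lift A" "v \<in> lift A" for u v
    using char that unfolding character_def \<psi>_def lift_def by (simp flip: cf_mult_res)
  have one: "\<psi> (\<lambda>_. 1) = 1"
  proof -
    obtain h where h: "h \<in> A" "\<phi> h \<noteq> 0" using char unfolding character_def by blast
    have "\<psi> (\<lambda>x. 1 * h x) = \<psi> (\<lambda>_. 1) * \<psi> h" by (rule mult[OF lift_const A_lift[OF h(1)]])
    then show ?thesis using h res_A[OF h(1)] by (simp add: \<psi>_def)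
  qed
  have cong: "\<psi> u = \<psi> v" if "\<And>x. x \<in> X \<Longrightarrow> u x = v x" for u v
    unfolding \<psi>_def using restrict_ext[of "X" u v] that by metis
  have inv: "\<psi> (\<lambda>x. u (g \<star> x)) = \<psi> u" if u: "u \<in> lift A" and g: "g \<in> carrier G" for u g
  proof -
    have "\<psi> (\<lambda>x. u (g \<star> x)) = \<phi> (quasiregular G M (inv g) (res u))"
      using quasiregular_res[of "inv g" u] g by (simp add: \<psi>_def)
    also have "\<dots> = dual_action G M A g \<phi> (res u)" using u by (simp add: dual_action_def lift_def)
    finally show ?thesis by (simp add: fixed[OF g] \<psi>_def)
  qed
  have "\<psi> f = mean f"
  proof (rule invariant_functional_eq_mean[OF A_closed_invariant lift_const one lin _ inv A_lift[OF f]])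
    show "cmod (\<psi> u) \<le> B" if "u \<in> lift A" "\<And>x. x \<in> X \<Longrightarrow> cmod (u x) \<le> B" for u B
      by (rule multiplicative_functional_bounded[where \<psi> = \<psi>, OF A_closed_invariant lift_const lift_mult cong lin mult that])
  qed
  then show ?thesis by (simp add: \<psi>_def res_A[OF f])
qed

text \<open>
  For real \<open>f\<close> with \<open>mean (f\<^sup>2) = (mean f)\<^sup>2\<close> the variance of \<open>f\<close>
  vanishes.
\<close>

lemma multiplicative_imp_antisymmetric:
  assumes "multiplicative_measure M A \<mu>"
  shows "antisymmetric M A"
  unfolding antisymmetric_def
proof (intro ballI impI)
  have "\<exists>\<phi>\<in>topspace (maximal_ideal_space M A). \<forall>f\<in>A. \<phi> f = mean f"
    using assms unfolding multiplicative_measure_def mean_def .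
  then obtain \<phi> where "\<phi> \<in> topspace (maximal_ideal_space M A)" and \<phi>m: "\<And>f. f \<in> A \<Longrightarrow> \<phi> f = mean f"
    by blast
  then have \<phi>: "character M A \<phi>" by (simp add: character_extensional)
  fix f assume f: "f \<in> A" and real: "\<forall>x\<in>X. f x \<in> \<real>"
  note cf = A_subset(1)[OF f]
  have ff: "cf_mult M f f \<in> A" using algebra_A f unfolding invariant_function_algebra_def by blast
  have "mean (cf_mult M f f) = mean f * mean f" using \<phi> f ff unfolding character_def by (simp flip: \<phi>m)
  then have sq: "mean (\<lambda>x. f x * f x) = mean f * mean f" by (simp add: cf_mult_def mean_res)
  have r: "cnj (f x) = f x" if "x \<in> X" for x using real that Reals_cnj_iff by blast
  have mr: "cnj (mean f) = mean f" using mean_cong[of "\<lambda>x. cnj (f x)" f] r by (simp add: mean_cnj)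
  have "complex_of_real (sqnorm (\<lambda>x. f x - mean f)) = mean (\<lambda>x. (f x - mean f) * cnj (f x - mean f))"
    by (rule mean_self[symmetric])
  also have "\<dots> = mean (\<lambda>x. (f x * f x - mean f * f x) - (mean f * f x - mean f * mean f))"
    by (rule mean_cong) (simp add: r mr algebra_simps)
  also have "\<dots> = 0"
    by (subst mean_diff; (subst mean_diff)?; (intro cts_diff cts_mult cts_const cf)?)
      (simp add: mean_diff mean_cmult mean_const cf sq cts_mult cts_const)
  finally have "sqnorm (\<lambda>x. f x - mean f) = 0" by simp
  then have "f x - mean f = 0" if "x \<in> X" for x
    using sqnorm_zero[OF cts_diff[OF cf cts_const]] that by blast
  then have "res f = cf_const M (mean f)" unfolding cf_const_def by (intro restrict_ext) simp
  then show "\<exists>c. f = cf_const M c" using res_A[OF f] by metis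
qed

end

theorem theorem4:
  fixes G :: "('g, 'b) monoid_scheme" and T :: "'g topology"
    and n :: nat and \<A> :: "('g set \<times> ('g \<Rightarrow> nat \<Rightarrow> real)) set"
    and H :: "'g set" and M :: "'g set topology"
    and A :: "('g set \<Rightarrow> complex) set" and \<mu> :: "'g set measure"
  assumes "lie_group G T n \<A>" and "compact_space T"
    and "subgroup H G" and "closedin T H"
    and "M = homogeneous_space G T H"
    and "commutative_space G M"
    and "invariant_function_algebra G M A"
    and "invariant_probability G M \<mu>"
  shows "(antisymmetric M A \<longleftrightarrow> multiplicative_measure M A \<mu>) \<and>
         (multiplicative_measure M A \<mu> \<longleftrightarrow> (\<exists>\<phi>. \<phi> \<in> fixed_points G M A)) \<and>
         (\<forall>\<phi> \<in> fixed_points G M A. \<forall>\<psi> \<in> fixed_points G M A. \<phi> = \<psi>)"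
proof -
  interpret compact_group G T
    by unfold_locales (use assms(1,2) in \<open>simp_all add: lie_group_def\<close>)
  interpret subgroup H G by (rule assms(3))
  interpret invariant_algebra G T H M \<mu> A
    by unfold_locales (use assms in simp_all)
  have unique: "\<phi> = \<psi>" if \<phi>: "\<phi> \<in> fixed_points G M A" and \<psi>: "\<psi> \<in> fixed_points G M A" for \<phi> \<psi>
  proof (rule extensionalityI[of _ A])
    show "\<phi> \<in> extensional A" "\<psi> \<in> extensional A"
      using \<phi> \<psi> by (auto simp: fixed_points_def character_extensional)
    show "\<phi> f = \<psi> f" if "f \<in> A" for f
      using fixed_point_eq_mean[OF \<phi> that] fixed_point_eq_mean[OF \<psi> that] by simp
  qed
  have "multiplicative_measure M A \<mu>" if \<phi>: "\<phi> \<in> fixed_points G M A" for \<phi>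
    using that fixed_point_eq_mean[OF \<phi>] unfolding multiplicative_measure_def mean_def fixed_points_def by blast
  moreover have "antisymmetric M A \<Longrightarrow> multiplicative_measure M A \<mu>"
    using antisymmetric_imp_mean_mult[OF assms(6)] by (rule mean_character)
  ultimately show ?thesis
    using multiplicative_imp_antisymmetric multiplicative_imp_fixed_point unique by blast
qed

end
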